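(* Let $(\Omega,\mu)$ be a $\sigma$-finite measure space. For any collection $\mathcal S$ of random variables, all continuous with respect to $\mu$, there exists a coupling of the variables in $\mathcal S$ such that, for any $X,Y\in\mathcal S$ with densities $g,h$ respectively, $$\mathbb P(X\neq Y)=F(d_{\mathrm{TV}}(X,Y))-\frac{1}{1+d_{\mathrm{TV}}(X,Y)}\int_\Omega \min(g(x),h(x))\cdot\big|\mathbb P(X=x)-\mathbb P(Y=x)\big|\,d\mu(x),$$ where $F(t)=\frac{2t}{1+t}$. In particular, if $\mu$ has no atoms, then $\mathbb P(X\ne Y)=F(d_{\mathrm{TV}}(X,Y))$ for all $X,Y\in\mathcal S$.
   Context: An $\Omega$-valued random variable $X$ is said to be continuous with respect to $\mu$ if there is a density function $g$ such that $\mathbb P(X\in A)=\int_A g\,d\mu$ for all measurable $A\subset\Omega$ ($\mu$ need not be Lebesgue measure and may have atoms). A coupling of a collection of random variables $(X_i)_{i\in I}$ is a family $(X_i')_{i\in I}$ of random variables on one common probability space such that each $X_i'$ has the same law as $X_i$; primes are omitted, so that $\mathbb P(X\neq Y)$ is computed in the coupling. The total variation distance is $d_{\mathrm{TV}}(X,Y)=\sup_A|\mathbb P(X\in A)-\mathbb P(Y\in A)|$, over all measurable sets $A$. *)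

theory Defs
  imports "HOL-Probability.Probability"
begin

definition has_density :: "'b measure \<Rightarrow> 'a measure \<Rightarrow> ('b \<Rightarrow> 'a) \<Rightarrow> ('a \<Rightarrow> real) \<Rightarrow> bool" where
  "has_density Q M X g \<longleftrightarrow>
     (\<forall>x\<in>space M. 0 \<le> g x) \<and> distributed Q M X (\<lambda>x. ennreal (g x))"

definition continuous_wrt :: "'b measure \<Rightarrow> 'a measure \<Rightarrow> ('b \<Rightarrow> 'a) \<Rightarrow> bool" where
  "continuous_wrt Q M X \<longleftrightarrow> (\<exists>g. has_density Q M X g)"

definition tv_dist ::
    "'a measure \<Rightarrow> 'b measure \<Rightarrow> ('b \<Rightarrow> 'a) \<Rightarrow> 'c measure \<Rightarrow> ('c \<Rightarrow> 'a) \<Rightarrow> real" where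
  "tv_dist M P X Q Y =
     (SUP A\<in>sets M. \<bar>\<P>(\<omega> in P. X \<omega> \<in> A) - \<P>(\<omega> in Q. Y \<omega> \<in> A)\<bar>)"

text \<open>The random variables \<open>X i\<close> may live on different probability spaces \<open>Q i\<close>;
  the coupled variables \<open>X' i\<close> all live on \<open>P\<close>.\<close>

definition is_coupling ::
    "'i set \<Rightarrow> 'a measure \<Rightarrow> ('i \<Rightarrow> 'b measure) \<Rightarrow> ('i \<Rightarrow> 'b \<Rightarrow> 'a) \<Rightarrow>
     'c measure \<Rightarrow> ('i \<Rightarrow> 'c \<Rightarrow> 'a) \<Rightarrow> bool" where
  "is_coupling I M Q X P X' \<longleftrightarrow>
     prob_space P \<and>
     (\<forall>i\<in>I. X' i \<in> measurable P M \<and> distr P M (X' i) = distr (Q i) M (X i))"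

text \<open>Atoms are understood as points of positive mass. When singletons are measurable, such a
  singleton is also an atom in the set sense (a measurable set of positive measure without
  measurable subsets of intermediate measure), so a measure without atoms in the set sense
  satisfies \<open>no_atoms\<close>.\<close>

definition no_atoms :: "'a measure \<Rightarrow> bool" where
  "no_atoms M \<longleftrightarrow> (\<forall>x\<in>space M. emeasure M {x} = 0)"

definition F :: "real \<Rightarrow> real" where
  "F t = 2 * t / (1 + t)"

end

theory Submission imports Defs begin

text \<open>Pass to a probability measure \<open>\<nu>\<close> equivalent to \<open>M\<close> and take a Poisson process of unit
  intensity of points with a position (measured by \<open>\<nu>\<close>), a height \<open>\<ge> 0\<close> and a time \<open>\<ge> 0\<close>.
  For a density \<open>g\<close> let \<open>X\<^sub>g\<close> be the position of the earliest point below the graph of \<open>g\<close>. For two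
  densities at total variation distance \<open>d\<close>, the region below \<open>max g h\<close> has volume \<open>1 + d\<close>, the one
  below \<open>min g h\<close> has volume \<open>1 - d\<close>, and the two variables share their earliest point exactly when
  the earliest point below \<open>max g h\<close> is below \<open>min g h\<close>: this has probability \<open>(1 - d) / (1 + d)\<close>.
  Distinct points can still have the same position \<open>x\<close>, but almost surely only at an atom: say
  \<open>h x \<le> g x\<close>; then the earliest point lies over \<open>x\<close> between the two graphs, and by the memoryless
  property the first point below \<open>h\<close> is still distributed according to \<open>h\<close>. Summing over the atoms
  gives the integral in the formula.\<close>

section \<open>Poisson superposition\<close>

text \<open>A single process serves all densities at once, so arbitrarily many variables are coupled
  simultaneously. The function \<open>F\<close> is forced by the races:
  \<open>1 - (1 - d) / (1 + d) = F d\<close>, and the correction term carries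
  \<open>1 / (1 + d)\<close> because every race for a pair takes place in a region of volume
  \<open>1 + d\<close>. If \<open>\<nu>\<close> has density \<open>w\<close> with respect to
  \<open>M\<close>, then \<open>g\<close> becomes \<open>g / w\<close>, and \<open>w\<close> cancels
  from every integral of the formula. The obstacle is measurability. Singletons are measurable, but
  the diagonal need not be, so \<open>X \<noteq> Y\<close> need not be an event, and there may be
  uncountably many pairs. The configurations with a coincidence away from the atoms form a set that
  can have full outer measure, so completion does not help; but it contains no event of positive
  probability. The measure therefore extends to one under which this set and all its subsets are
  null, for all pairs together. The result is finally carried over to functions from
  \<open>I\<close>, with a sigma-algebra large enough to keep these events measurable.\<close>

text \<open>The configuration \<open>\<omega>\<close> has \<open>fst (\<omega> c)\<close> points in cell \<open>c\<close>, a Poisson(1) number; they are the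
  initial terms of the i.i.d. sequence \<open>snd (\<omega> c)\<close>, whose remaining terms are ignored.\<close>

locale poisson_superposition =
  fixes L :: "nat \<Rightarrow> 's measure"
  assumes prob_L: "prob_space (L c)"
begin

definition cell_space :: "nat \<Rightarrow> (nat \<times> (nat \<Rightarrow> 's)) measure" where
  "cell_space c = measure_pmf (poisson_pmf 1) \<Otimes>\<^sub>M (\<Pi>\<^sub>M r\<in>UNIV. L c)"

definition config_space :: "(nat \<Rightarrow> nat \<times> (nat \<Rightarrow> 's)) measure" where
  "config_space = (\<Pi>\<^sub>M c\<in>UNIV. cell_space c)"

definition hits :: "nat \<times> (nat \<Rightarrow> 's) \<Rightarrow> 's set \<Rightarrow> bool" where
  "hits y E \<longleftrightarrow> (\<exists>r<fst y. snd y r \<in> E)"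

lemma prob_marks: "prob_space (\<Pi>\<^sub>M r\<in>(UNIV::nat set). L c)"
  by (intro prob_space_PiM prob_L)

lemma prob_cell_space: "prob_space (cell_space c)"
  unfolding cell_space_def
  by (intro prob_space_pair prob_space_measure_pmf prob_marks)

lemma prob_config_space: "prob_space config_space"
  unfolding config_space_def by (intro prob_space_PiM prob_cell_space)

lemma measurable_cell [measurable]: "(\<lambda>\<omega>. \<omega> c) \<in> measurable config_space (cell_space c)"
  unfolding config_space_def by measurable

lemma measurable_count [measurable]: "fst \<in> measurable (cell_space c) (count_space UNIV)"
proof -
  have "fst \<in> measurable (cell_space c) (measure_pmf (poisson_pmf 1))"
    unfolding cell_space_def by (rule measurable_fst)
  then show ?thesis by simp
qed

lemma measurable_mark [measurable]: "(\<lambda>y. snd y r) \<in> measurable (cell_space c) (L c)"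
  unfolding cell_space_def by measurable

lemma hits_sets [measurable]:
  assumes "E \<in> sets (L c)"
  shows "{y \<in> space (cell_space c). hits y E} \<in> sets (cell_space c)"
proof -
  have "(\<lambda>y. snd y r) -` E \<inter> space (cell_space c) \<in> sets (cell_space c)" for r
    using measurable_mark assms by (rule measurable_sets)
  then have "{y \<in> space (cell_space c). snd y r \<in> E} \<in> sets (cell_space c)" for r
    by (simp add: vimage_def Int_def conj_commute)
  moreover have "{y \<in> space (cell_space c). r < fst y} \<in> sets (cell_space c)" for r
    by measurable
  ultimately show ?thesis
    unfolding hits_def by (intro sets.sets_Collect)
qed

text \<open>Given \<open>n\<close> points, all of them miss \<open>E\<close> with probability
  \<open>q ^ n\<close>, where \<open>q = 1 - measure (L c) E\<close>; averaging over the Poisson(1)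
  count gives \<open>exp (-1) * exp q\<close>.\<close>

lemma measure_cell_void:
  assumes [measurable]: "E \<in> sets (L c)"
  shows "measure (cell_space c) {y \<in> space (cell_space c). \<not> hits y E} = exp (- measure (L c) E)"
proof -
  interpret L: prob_space "L c" by (rule prob_L)
  interpret P: prob_space "\<Pi>\<^sub>M r\<in>(UNIV::nat set). L c" by (rule prob_marks)
  interpret PL: product_prob_space "\<lambda>_. L c" "UNIV :: nat set" ..
  interpret C: prob_space "cell_space c" by (rule prob_cell_space)
  let ?q = "1 - measure (L c) E"
  let ?V = "{y \<in> space (cell_space c). \<not> hits y E}"
  have q: "0 \<le> ?q" by simp
  have slice: "emeasure (\<Pi>\<^sub>M r\<in>UNIV. L c) (Pair n -` ?V) = ennreal (?q ^ n)" for n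
  proof -
    have "Pair n -` ?V = {f \<in> space (\<Pi>\<^sub>M r\<in>UNIV. L c). \<forall>r\<in>{..<n}. f r \<in> space (L c) - E}"
      by (auto simp: cell_space_def space_pair_measure hits_def space_PiM)
    also have "emeasure (\<Pi>\<^sub>M r\<in>UNIV. L c) \<dots> = (\<Prod>r\<in>{..<n}. emeasure (L c) (space (L c) - E))"
      by (intro PL.emeasure_PiM_Collect) auto
    also have "\<dots> = ennreal (?q ^ n)"
      by (simp add: L.emeasure_eq_measure L.prob_compl ennreal_power)
    finally show ?thesis .
  qed
  have S: "(\<lambda>n. ?q ^ n / fact n) sums exp ?q"
    using exp_converges[of ?q] by (simp add: field_simps)
  have "emeasure (cell_space c) ?V =
      (\<integral>\<^sup>+n. emeasure (\<Pi>\<^sub>M r\<in>UNIV. L c) (Pair n -` ?V) \<partial>measure_pmf (poisson_pmf 1))"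
    unfolding cell_space_def
    by (rule P.emeasure_pair_measure_alt) (unfold cell_space_def [symmetric], measurable)
  also have "\<dots> = (\<integral>\<^sup>+n. ennreal (?q ^ n) \<partial>measure_pmf (poisson_pmf 1))"
    unfolding slice ..
  also have "\<dots> = (\<integral>\<^sup>+n. ennreal (exp (-1) * (?q ^ n / fact n)) \<partial>count_space UNIV)"
    by (simp add: nn_integral_measure_pmf q ennreal_mult[symmetric] mult.commute)
  also have "\<dots> = (\<Sum>n. ennreal (exp (-1) * (?q ^ n / fact n)))"
    by (rule nn_integral_count_space_nat)
  also have "\<dots> = ennreal (exp (-1) * exp ?q)"
    using q sums_mult[OF S, of "exp (-1)"] by (intro suminf_ennreal_eq) auto
  finally have "emeasure (cell_space c) ?V = ennreal (exp (- measure (L c) E))"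
    by (simp add: exp_add[symmetric])
  then show ?thesis by (simp add: measure_def)
qed

text \<open>The cells are independent, so void probabilities multiply over finitely many of them,
  and the infinite intersection is a decreasing limit. All laws of arrival times below come from
  this formula.\<close>

lemma measure_config_void:
  assumes E [measurable]: "\<And>c. E \<in> sets (L c)" and summ: "summable (\<lambda>c. measure (L c) E)"
  shows "measure config_space {\<omega> \<in> space config_space. \<forall>c. \<not> hits (\<omega> c) E} =
    exp (- (\<Sum>c. measure (L c) E))"
proof -
  interpret C: prob_space "cell_space c" for c by (rule prob_cell_space)
  interpret P: product_prob_space cell_space "UNIV :: nat set" ..
  interpret N: prob_space config_space by (rule prob_config_space)
  let ?V = "\<lambda>c. {y \<in> space (cell_space c). \<not> hits y E}"
  let ?A = "\<lambda>n. {\<omega> \<in> space config_space. \<forall>c\<in>{..<n}. \<omega> c \<in> ?V c}"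
  have sp: "\<omega> \<in> space config_space \<Longrightarrow> \<omega> c \<in> space (cell_space c)" for \<omega> c
    using measurable_space[OF measurable_cell] by blast
  have "emeasure config_space (?A n) = (\<Prod>c<n. emeasure (cell_space c) (?V c))" for n
    unfolding config_space_def by (rule P.emeasure_PiM_Collect) auto
  then have "emeasure config_space (?A n) = ennreal (\<Prod>c<n. exp (- measure (L c) E))" for n
    by (simp add: C.emeasure_eq_measure measure_cell_void prod_ennreal)
  then have An: "measure config_space (?A n) = exp (- (\<Sum>c<n. measure (L c) E))" for n
    by (simp add: N.emeasure_eq_measure prod_nonneg exp_sum[symmetric] sum_negf)
  have "(\<lambda>n. measure config_space (?A n)) \<longlonglongrightarrow> measure config_space (\<Inter>n. ?A n)"
    by (intro N.finite_Lim_measure_decseq) (auto simp: decseq_def)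
  moreover have "(\<Inter>n. ?A n) = {\<omega> \<in> space config_space. \<forall>c. \<not> hits (\<omega> c) E}"
    using sp by auto
  moreover have "(\<lambda>n. measure config_space (?A n)) \<longlonglongrightarrow> exp (- (\<Sum>c. measure (L c) E))"
    unfolding An by (intro tendsto_exp tendsto_minus summable_LIMSEQ summ)
  ultimately show ?thesis using LIMSEQ_unique by fastforce
qed

text \<open>Borel-Cantelli: cell \<open>c\<close> is hit with probability
  \<open>1 - exp (- m) \<le> m\<close>, where \<open>m = measure (L c) E\<close>. This local
  finiteness later turns an infimum of times into a minimum.\<close>

lemma AE_finitely_many_cells_hit:
  assumes E [measurable]: "\<And>c. E \<in> sets (L c)" and summ: "summable (\<lambda>c. measure (L c) E)"
  shows "AE \<omega> in config_space. finite {c. hits (\<omega> c) E}"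
proof -
  interpret N: prob_space config_space by (rule prob_config_space)
  interpret C: prob_space "cell_space c" for c by (rule prob_cell_space)
  interpret P: product_prob_space cell_space "UNIV :: nat set" ..
  let ?H = "\<lambda>c. {\<omega> \<in> space config_space. \<omega> c \<in> {y \<in> space (cell_space c). hits y E}}"
  have sp: "\<omega> \<in> space config_space \<Longrightarrow> \<omega> c \<in> space (cell_space c)" for \<omega> c
    using measurable_space[OF measurable_cell] by blast
  have le: "measure config_space (?H c) \<le> measure (L c) E" for c
  proof -
    have "measure config_space (?H c) = measure (cell_space c) {y \<in> space (cell_space c). hits y E}"
      unfolding measure_def config_space_def by (subst P.emeasure_PiM_Collect_single) auto
    also have "\<dots> = 1 - exp (- measure (L c) E)"
      using C.prob_neg[of c "\<lambda>y. hits y E"] measure_cell_void[of E c] by simp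
    also have "\<dots> \<le> measure (L c) E"
      using exp_ge_add_one_self[of "- measure (L c) E"] by simp
    finally show ?thesis .
  qed
  have "AE \<omega> in config_space. eventually (\<lambda>c. \<omega> \<in> space config_space - ?H c) sequentially"
  proof (rule borel_cantelli_AE1)
    show "summable (\<lambda>c. measure config_space (?H c))"
      by (rule summable_comparison_test'[OF summ]) (use le in simp)
  qed (auto simp: less_top[symmetric])
  then show ?thesis
  proof (rule AE_mp, intro AE_I2 impI)
    fix \<omega> assume w: "\<omega> \<in> space config_space"
      "eventually (\<lambda>c. \<omega> \<in> space config_space - ?H c) sequentially"
    then obtain n where "\<And>c. c \<ge> n \<Longrightarrow> \<not> hits (\<omega> c) E"
      using sp by (auto simp: eventually_sequentially)
    then have "{c. hits (\<omega> c) E} \<subseteq> {..<n}" using not_less by auto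
    then show "finite {c. hits (\<omega> c) E}" by (rule finite_subset) simp
  qed
qed

end

section \<open>The Poisson process of positions, heights and times\<close>

type_synonym 'a config = "nat \<Rightarrow> nat \<times> (nat \<Rightarrow> ('a \<times> real) \<times> real)"

locale poisson_race = prob_space \<nu> for \<nu> :: "'a measure"
begin

definition plane :: "('a \<times> real) measure" where
  "plane = \<nu> \<Otimes>\<^sub>M lborel"

text \<open>Unit boxes in height and time, over all positions, tile the part where height and time
  are nonnegative. Each has mass 1 because \<open>\<nu>\<close> is a probability measure; hence the
  restriction to a box is a law of marks, and a Poisson(1) number of marks gives unit
  intensity.\<close>

definition cell :: "nat \<Rightarrow> (('a \<times> real) \<times> real) set" where
  "cell c = (case prod_decode c of (a, b) \<Rightarrow>
     (space \<nu> \<times> {real a..<real a + 1}) \<times> {real b..<real b + 1})"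

definition mark_law :: "nat \<Rightarrow> (('a \<times> real) \<times> real) measure" where
  "mark_law c = density (plane \<Otimes>\<^sub>M lborel) (indicator (cell c))"

lemma cell_sets [measurable]: "cell c \<in> sets (plane \<Otimes>\<^sub>M lborel)"
  unfolding cell_def plane_def by (cases "prod_decode c") auto

lemma sets_mark_law [measurable_cong, simp]: "sets (mark_law c) = sets (plane \<Otimes>\<^sub>M lborel)"
  by (simp add: mark_law_def)

lemma space_mark_law: "space (mark_law c) = (space \<nu> \<times> UNIV) \<times> UNIV"
  by (simp add: mark_law_def plane_def space_pair_measure)

lemma emeasure_plane_times:
  "A \<in> sets \<nu> \<Longrightarrow> U \<in> sets borel \<Longrightarrow> emeasure plane (A \<times> U) = emeasure \<nu> A * emeasure lborel U"
  unfolding plane_def by (simp add: lborel.emeasure_pair_measure_Times)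

lemma emeasure_mark_law:
  assumes E: "E \<in> sets (plane \<Otimes>\<^sub>M lborel)"
  shows "emeasure (mark_law c) E = emeasure (plane \<Otimes>\<^sub>M lborel) (cell c \<inter> E)"
proof -
  have "emeasure (mark_law c) E =
      (\<integral>\<^sup>+p. indicator (cell c) p * indicator E p \<partial>(plane \<Otimes>\<^sub>M lborel))"
    unfolding mark_law_def by (rule emeasure_density) (rule borel_measurable_indicator, rule cell_sets, rule E)
  also have "\<dots> = (\<integral>\<^sup>+p. indicator (cell c \<inter> E) p \<partial>(plane \<Otimes>\<^sub>M lborel))"
    by (intro nn_integral_cong) (auto simp: indicator_def)
  also have "\<dots> = emeasure (plane \<Otimes>\<^sub>M lborel) (cell c \<inter> E)"
    by (rule nn_integral_indicator) (rule sets.Int[OF cell_sets E])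
  finally show ?thesis .
qed

lemma prob_mark_law: "prob_space (mark_law c)"
proof
  obtain a b where ab: "prod_decode c = (a, b)" by fastforce
  have "cell c \<inter> space (mark_law c) = cell c"
    using sets.sets_into_space[OF cell_sets] by (auto simp: mark_law_def)
  then have "emeasure (mark_law c) (space (mark_law c)) = emeasure (plane \<Otimes>\<^sub>M lborel) (cell c)"
    using emeasure_mark_law[of "space (mark_law c)" c] sets.top[of "mark_law c"]
    unfolding sets_mark_law by simp
  also have "\<dots> = emeasure plane (space \<nu> \<times> {real a..<real a + 1}) * emeasure lborel {real b..<real b + 1}"
    unfolding cell_def ab prod.case
    by (rule lborel.emeasure_pair_measure_Times) (auto simp: plane_def)
  also have "\<dots> = 1"
    by (simp add: emeasure_plane_times emeasure_space_1)
  finally show "emeasure (mark_law c) (space (mark_law c)) = 1" .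
qed

sublocale poisson_superposition mark_law
  by (rule poisson_superposition.intro) (rule prob_mark_law)

text \<open>The boxes are disjoint, and the point with height \<open>u\<close> and time
  \<open>t\<close> lies in the box coded by the integer parts of \<open>u\<close> and
  \<open>t\<close>. Their union stops at height and time 0, whence \<open>sub\<close>.\<close>

lemma suminf_emeasure_mark_law:
  assumes E [measurable]: "E \<in> sets (plane \<Otimes>\<^sub>M lborel)" and sub: "E \<subseteq> (space \<nu> \<times> {0..}) \<times> {0..}"
  shows "(\<Sum>c. emeasure (mark_law c) E) = emeasure (plane \<Otimes>\<^sub>M lborel) E"
proof -
  have "(\<Sum>c. emeasure (mark_law c) E) = (\<Sum>c. emeasure (plane \<Otimes>\<^sub>M lborel) (E \<inter> cell c))"
    unfolding emeasure_mark_law[OF E] by (simp add: Int_commute)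
  also have "\<dots> = emeasure (plane \<Otimes>\<^sub>M lborel) (\<Union>c. E \<inter> cell c)"
  proof (rule suminf_emeasure)
    have floor_eq: "m = n" if "real m \<le> u" "u < real m + 1" "real n \<le> u" "u < real n + 1" for m n u
      using that by linarith
    have "c = c'" if "p \<in> cell c" "p \<in> cell c'" for p c c'
    proof -
      obtain a b a' b' where "prod_decode c = (a, b)" "prod_decode c' = (a', b')" by fastforce
      with that have "prod_decode c = prod_decode c'"
        by (auto simp: cell_def intro: floor_eq)
      then show ?thesis by simp
    qed
    then show "disjoint_family (\<lambda>c. E \<inter> cell c)"
      by (auto simp: disjoint_family_on_def)
    show "range (\<lambda>c. E \<inter> cell c) \<subseteq> sets (plane \<Otimes>\<^sub>M lborel)"
      using sets.Int[OF E cell_sets] by blast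
  qed
  also have "(\<Union>c. E \<inter> cell c) = E"
  proof -
    have "p \<in> (\<Union>c. cell c)" if "p \<in> E" for p
    proof -
      obtain x u t where p: "p = ((x, u), t)" by (metis surj_pair)
      with that sub have "x \<in> space \<nu>" "0 \<le> u" "0 \<le> t" by auto
      then have "p \<in> cell (prod_encode (nat \<lfloor>u\<rfloor>, nat \<lfloor>t\<rfloor>))"
        by (auto simp: p cell_def)
      then show ?thesis by blast
    qed
    then show ?thesis by blast
  qed
  finally show ?thesis .
qed

lemma sums_measure_mark_law:
  assumes E: "E \<in> sets (plane \<Otimes>\<^sub>M lborel)" and sub: "E \<subseteq> (space \<nu> \<times> {0..}) \<times> {0..}"
    and m: "emeasure (plane \<Otimes>\<^sub>M lborel) E = ennreal m" "0 \<le> m"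
  shows "(\<lambda>c. measure (mark_law c) E) sums m"
proof -
  interpret L: prob_space "mark_law c" for c by (rule prob_mark_law)
  have eq: "(\<Sum>c. ennreal (measure (mark_law c) E)) = ennreal m"
    using suminf_emeasure_mark_law[OF E sub] m by (simp add: L.emeasure_eq_measure)
  have "summable (\<lambda>c. measure (mark_law c) E)"
    by (rule summable_suminf_not_top) (simp_all add: eq)
  with eq have "(\<Sum>c. measure (mark_law c) E) = m"
    using m by (simp add: suminf_ennreal2 suminf_nonneg)
  then show ?thesis using \<open>summable _\<close> by (simp add: sums_iff)
qed

text \<open>These are the competitors in the races. Finite volume ensures that only finitely many
  points of the region arrive in bounded time.\<close>

definition region :: "('a \<times> real) set \<Rightarrow> bool" where
  "region A \<longleftrightarrow> A \<in> sets plane \<and> A \<subseteq> space \<nu> \<times> {0..} \<and> emeasure plane A < \<infinity>"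

definition vol :: "('a \<times> real) set \<Rightarrow> real" where
  "vol A = measure plane A"

lemma emeasure_region: "region A \<Longrightarrow> emeasure plane A = ennreal (vol A)"
  unfolding region_def vol_def by (simp add: emeasure_eq_ennreal_measure less_top)

lemma vol_nonneg: "0 \<le> vol A"
  by (simp add: vol_def)

text \<open>A label \<open>k\<close> is a cell together with a mark number. Labels are countable and
  do not depend on the configuration; every label has a mark, also those beyond the count of their
  cell.\<close>

definition loc :: "nat \<times> nat \<Rightarrow> 'a config \<Rightarrow> 'a \<times> real" where
  "loc k \<omega> = fst (snd (\<omega> (fst k)) (snd k))"

definition tm :: "nat \<times> nat \<Rightarrow> 'a config \<Rightarrow> real" where
  "tm k \<omega> = snd (snd (\<omega> (fst k)) (snd k))"

text \<open>The times of the marks are nonnegative only almost surely; demanding it here makes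
  \<open>arrival\<close> nonnegative on the whole space, as \<open>exp_time\<close>
  requires.\<close>

definition live :: "nat \<times> nat \<Rightarrow> 'a config \<Rightarrow> bool" where
  "live k \<omega> \<longleftrightarrow> snd k < fst (\<omega> (fst k)) \<and> 0 \<le> tm k \<omega>"

definition arrival :: "('a \<times> real) set \<Rightarrow> 'a config \<Rightarrow> ereal" where
  "arrival A \<omega> = (INF k. if live k \<omega> \<and> loc k \<omega> \<in> A then ereal (tm k \<omega>) else \<infinity>)"

lemma measurable_point [measurable]:
  "(\<lambda>\<omega>. snd (\<omega> c) r) \<in> measurable config_space (plane \<Otimes>\<^sub>M lborel)"
proof -
  have "(\<lambda>\<omega>. snd (\<omega> c) r) \<in> measurable config_space (mark_law c)"
    by (rule measurable_compose[OF measurable_cell measurable_mark])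
  then show ?thesis by (simp cong: measurable_cong_sets)
qed

lemma measurable_loc [measurable]: "loc k \<in> measurable config_space plane"
  unfolding loc_def using measurable_compose[OF measurable_point measurable_fst] by blast

lemma measurable_tm [measurable]: "tm k \<in> borel_measurable config_space"
  unfolding tm_def using measurable_compose[OF measurable_point measurable_snd] by simp

lemma measurable_live [measurable]: "Measurable.pred config_space (live k)"
proof -
  have "(\<lambda>\<omega>. fst (\<omega> c)) \<in> measurable config_space (count_space UNIV)" for c
    by (rule measurable_compose[OF measurable_cell measurable_count])
  note this[measurable]
  show ?thesis unfolding live_def by measurable
qed

lemma measurable_loc_in [measurable]:
  "A \<in> sets plane \<Longrightarrow> Measurable.pred config_space (\<lambda>\<omega>. loc k \<omega> \<in> A)"
  using measurable_sets[OF measurable_loc, of A k]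
  by (simp add: pred_def vimage_def Int_def conj_commute)

lemma measurable_arrival [measurable]:
  "A \<in> sets plane \<Longrightarrow> arrival A \<in> borel_measurable config_space"
  unfolding arrival_def by measurable

lemma le_arrival_iff:
  "ereal t \<le> arrival A \<omega> \<longleftrightarrow> (\<forall>k. live k \<omega> \<and> loc k \<omega> \<in> A \<longrightarrow> t \<le> tm k \<omega>)"
  unfolding arrival_def le_INF_iff by auto

lemma arrival_le: "live k \<omega> \<Longrightarrow> loc k \<omega> \<in> A \<Longrightarrow> arrival A \<omega> \<le> ereal (tm k \<omega>)"
  unfolding arrival_def by (rule INF_lower2[of k]) auto

lemma arrival_antimono: "A \<subseteq> B \<Longrightarrow> arrival B \<omega> \<le> arrival A \<omega>"
  unfolding arrival_def by (intro INF_mono) auto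

lemma arrival_nonneg: "0 \<le> arrival A \<omega>"
  unfolding arrival_def by (intro INF_greatest) (auto simp: live_def)

text \<open>No point of \<open>A j\<close> before time \<open>t j\<close>, for all \<open>j\<close>,
  is a void event for the union of the sets \<open>A j \<times> {0..<t j}\<close>, whose volumes add
  up by disjointness. The truncation by \<open>max 0\<close> reflects that a negative threshold is
  no restriction. The joint survival function thus factorises.\<close>

lemma prob_le_arrival:
  assumes J: "finite J" "disjoint_family_on A J" and A: "\<And>j. j \<in> J \<Longrightarrow> region (A j)"
  shows "measure config_space {\<omega> \<in> space config_space. \<forall>j\<in>J. ereal (t j) \<le> arrival (A j) \<omega>} =
    exp (- (\<Sum>j\<in>J. vol (A j) * max 0 (t j)))"
proof -
  let ?E = "\<Union>j\<in>J. A j \<times> {0..<t j}"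
  have sets: "A j \<times> {0..<t j} \<in> sets (plane \<Otimes>\<^sub>M lborel)" if "j \<in> J" for j
    using A[OF that] by (auto simp: region_def)
  have em: "emeasure (plane \<Otimes>\<^sub>M lborel) (A j \<times> {0..<t j}) = ennreal (vol (A j) * max 0 (t j))"
    if "j \<in> J" for j
    using A[OF that]
    using emeasure_region[OF A[OF that]]
    by (auto simp: lborel.emeasure_pair_measure_Times region_def vol_nonneg
          ennreal_mult max_def not_le ennreal_neg)
  have "emeasure (plane \<Otimes>\<^sub>M lborel) ?E = (\<Sum>j\<in>J. emeasure (plane \<Otimes>\<^sub>M lborel) (A j \<times> {0..<t j}))"
    using J sets by (intro sum_emeasure [symmetric]) (auto simp: disjoint_family_on_def)
  also have "\<dots> = ennreal (\<Sum>j\<in>J. vol (A j) * max 0 (t j))"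
    by (simp add: em sum_ennreal vol_def cong: sum.cong)
  finally have S: "(\<lambda>c. measure (mark_law c) ?E) sums (\<Sum>j\<in>J. vol (A j) * max 0 (t j))"
    using A sets J
    by (intro sums_measure_mark_law sets.finite_UN) (auto simp: region_def vol_def intro!: sum_nonneg)
  have "{\<omega> \<in> space config_space. \<forall>j\<in>J. ereal (t j) \<le> arrival (A j) \<omega>} =
      {\<omega> \<in> space config_space. \<forall>c. \<not> hits (\<omega> c) ?E}"
    by (auto simp: le_arrival_iff live_def loc_def tm_def hits_def not_le [symmetric] split_beta
          mem_Times_iff)
  moreover have "?E \<in> sets (mark_law c)" for c
    unfolding sets_mark_law using J(1) sets by (rule sets.finite_UN)
  ultimately show ?thesis
    using measure_config_void[of ?E] S by (simp only: sums_iff)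
qed

text \<open>Before any fixed time almost surely only finitely many cells have a point in
  \<open>A\<close>, and each has finitely many live marks, so the infimum is taken over a finite
  set.\<close>

lemma AE_arrival_attained:
  assumes A: "region A"
  shows "AE \<omega> in config_space. arrival A \<omega> < \<infinity> \<longrightarrow>
    (\<exists>k. live k \<omega> \<and> loc k \<omega> \<in> A \<and> arrival A \<omega> = ereal (tm k \<omega>))"
proof -
  have "AE \<omega> in config_space. finite {c. hits (\<omega> c) (A \<times> {0..<real n})}" for n
  proof (rule AE_finitely_many_cells_hit)
    have "emeasure (plane \<Otimes>\<^sub>M lborel) (A \<times> {0..<real n}) = ennreal (vol A * real n)"
      using A by (simp add: lborel.emeasure_pair_measure_Times region_def vol_nonneg
          emeasure_region[OF A] ennreal_mult)
    then show "summable (\<lambda>c. measure (mark_law c) (A \<times> {0..<real n}))"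
      using A by (intro sums_summable sums_measure_mark_law) (auto simp: region_def vol_def)
  qed (use A in \<open>auto simp: region_def\<close>)
  then have "AE \<omega> in config_space. \<forall>n. finite {c. hits (\<omega> c) (A \<times> {0..<real n})}"
    by (simp add: AE_all_countable)
  then show ?thesis
  proof (rule AE_mp, intro AE_I2 impI)
    fix \<omega> assume fin: "\<forall>n. finite {c. hits (\<omega> c) (A \<times> {0..<real n})}" and "arrival A \<omega> < \<infinity>"
    then obtain n where n: "arrival A \<omega> < ereal (real n)"
      using less_PInf_Ex_of_nat by auto
    let ?K = "{k. live k \<omega> \<and> loc k \<omega> \<in> A \<and> tm k \<omega> < real n}"
    have "?K \<subseteq> (SIGMA c:{c. hits (\<omega> c) (A \<times> {0..<real n})}. {..<fst (\<omega> c)})"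
      by (auto simp: live_def loc_def tm_def hits_def mem_Times_iff)
    then have finK: "finite ?K"
      by (rule finite_subset) (use fin in auto)
    have "\<not> ereal (real n) \<le> arrival A \<omega>" using n by simp
    then have "?K \<noteq> {}" unfolding le_arrival_iff by (auto simp: not_le)
    then obtain k where k: "k \<in> ?K" "\<And>l. l \<in> ?K \<Longrightarrow> tm k \<omega> \<le> tm l \<omega>"
      using arg_min_if_finite(1)[OF finK, of "\<lambda>k. tm k \<omega>"] arg_min_least[OF finK, of _ "\<lambda>k. tm k \<omega>"]
      by blast
    have "ereal (tm k \<omega>) \<le> arrival A \<omega>"
      unfolding le_arrival_iff using k by (metis (mono_tags, lifting) linorder_not_le mem_Collect_eq order.strict_trans2 order_less_imp_le)
    with k show "\<exists>k. live k \<omega> \<and> loc k \<omega> \<in> A \<and> arrival A \<omega> = ereal (tm k \<omega>)"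
      using arrival_le by (metis (mono_tags, lifting) antisym mem_Collect_eq)
  qed
qed

end

section \<open>Races between exponential times\<close>

text \<open>With this generator, survival probabilities at real thresholds determine laws of
  extended times. The ray at \<open>\<infinity>\<close> is the intersection of the rays at natural
  numbers; \<open>UNIV\<close> is added because no ray with a real endpoint contains minus
  infinity.\<close>

lemma borel_ereal_eq_sigma_sets:
  "sets (borel :: ereal measure) = sigma_sets UNIV (insert UNIV (range (\<lambda>t::real. {ereal t..})))"
proof
  let ?E = "insert UNIV (range (\<lambda>t::real. {ereal t..}))"
  show "sigma_sets UNIV ?E \<subseteq> sets borel"
    by (intro sets.sigma_sets_subset[of _ borel, simplified]) auto
  interpret S: sigma_algebra UNIV "sigma_sets UNIV ?E"
    by (rule sigma_algebra_sigma_sets) simp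
  have Ici: "{a..} \<in> sigma_sets UNIV ?E" for a :: ereal
  proof (cases a)
    case PInf
    have "a \<le> x" if "\<forall>n. ereal (real n) \<le> x" for x
      using that less_PInf_Ex_of_nat[of x] PInf by (cases "x = \<infinity>") (auto simp: not_le[symmetric])
    then have "{a..} = (\<Inter>n. {ereal (real n)..})" using PInf by (auto simp: PInf)
    also have "\<dots> \<in> sigma_sets UNIV ?E"
      by (intro S.countable_INT) auto
    finally show ?thesis .
  qed (auto simp: atLeast_eq_UNIV_iff top.extremum_unique bot_ereal_def[symmetric] intro: S.top)
  have "{..<a} \<in> sigma_sets UNIV ?E" for a :: ereal
  proof -
    have "UNIV - {a..} \<in> sigma_sets UNIV ?E" using Ici by (rule S.compl_sets)
    also have "UNIV - {a..} = {..<a}" by auto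
    finally show ?thesis .
  qed
  then show "sets borel \<subseteq> sigma_sets UNIV ?E"
    unfolding borel_Iio by (subst sets_measure_of) (auto intro!: S.sigma_sets_subset)
qed

lemma Int_stable_Ici_ereal: "Int_stable (insert UNIV (range (\<lambda>t::real. {ereal t..})))"
proof -
  have "{ereal s..} \<inter> {ereal t..} = {ereal (max s t)..}" for s t
  proof (intro set_eqI)
    show "x \<in> {ereal s..} \<inter> {ereal t..} \<longleftrightarrow> x \<in> {ereal (max s t)..}" for x
      by (cases x) (auto simp: max_def split: if_splits)
  qed
  then show ?thesis
    unfolding Int_stable_def by blast
qed

lemma pred_ereal_le [measurable]:
  fixes f g :: "'b \<Rightarrow> ereal"
  assumes "f \<in> borel_measurable M" "g \<in> borel_measurable M"
  shows "Measurable.pred M (\<lambda>x. f x \<le> g x)"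
  using borel_measurable_le[OF assms] by (simp add: pred_def)

lemma nn_integral_exp_Ici:
  fixes r a :: real
  assumes "0 < r"
  shows "(\<integral>\<^sup>+t. ennreal (r * exp (- r * t)) * indicator {a..} t \<partial>lborel) = ennreal (exp (- r * a))"
proof -
  have "(\<integral>\<^sup>+t. ennreal (r * exp (- r * t)) * indicator {a..} t \<partial>lborel) = 0 - (- exp (- r * a))"
  proof (rule nn_integral_FTC_atLeast)
    show "((\<lambda>t. - exp (- r * t)) \<longlongrightarrow> 0) at_top"
      using assms by real_asymp
  qed (use assms in \<open>auto intro!: derivative_eq_intros\<close>)
  then show ?thesis by simp
qed

lemma nn_integral_exp_Icc:
  fixes a c t :: real
  assumes "0 < a" "0 \<le> c" "0 \<le> t"
  shows "(\<integral>\<^sup>+x. ennreal (c * exp (- a * x)) * indicator {0..t} x \<partial>lborel) =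
    ennreal (c / a * (1 - exp (- a * t)))"
proof -
  have "(\<integral>\<^sup>+x. ennreal (c * exp (- a * x)) * indicator {0..t} x \<partial>lborel) =
      ennreal (- c / a * exp (- a * t) - (- c / a * exp (- a * 0)))"
    using assms by (intro nn_integral_FTC_Icc) (auto intro!: derivative_eq_intros)
  then show ?thesis by (simp add: algebra_simps)
qed

lemma nn_integral_exp_diff_Ici:
  fixes a b c :: real
  assumes "0 < a" "a \<le> b" "0 \<le> c"
  shows "(\<integral>\<^sup>+x. ennreal (c * (exp (- a * x) - exp (- b * x))) * indicator {0..} x \<partial>lborel) =
    ennreal (c * (1 / a - 1 / b))"
proof -
  let ?G = "\<lambda>x. c * (exp (- b * x) / b - exp (- a * x) / a)"
  have "(\<integral>\<^sup>+x. ennreal (c * (exp (- a * x) - exp (- b * x))) * indicator {0..} x \<partial>lborel) =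
      ennreal (0 - ?G 0)"
  proof (rule nn_integral_FTC_atLeast)
    have "0 < b" using assms by simp
    then have "((\<lambda>x. exp (- b * x)) \<longlongrightarrow> 0) at_top" "((\<lambda>x. exp (- a * x)) \<longlongrightarrow> 0) at_top"
      using \<open>0 < a\<close> by real_asymp+
    then have "(?G \<longlongrightarrow> c * (0 / b - 0 / a)) at_top"
      using \<open>0 < a\<close> \<open>0 < b\<close> by (intro tendsto_intros) auto
    then show "(?G \<longlongrightarrow> 0) at_top" by simp
    show "0 \<le> c * (exp (- a * x) - exp (- b * x))" if "0 \<le> x" for x
      using assms that by (auto simp: mult_right_mono)
    show "(?G has_real_derivative c * (exp (- a * x) - exp (- b * x))) (at x)" for x
      using assms by (auto intro!: derivative_eq_intros)
  qed measurable
  then show ?thesis by (simp add: algebra_simps)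
qed

lemma emeasure_exponential_Ici:
  assumes "0 < r"
  shows "emeasure (density lborel (exponential_density r)) {t..} = ennreal (exp (- r * max 0 t))"
proof -
  have "emeasure (density lborel (exponential_density r)) {t..} =
      (\<integral>\<^sup>+x. ennreal (r * exp (- r * x)) * indicator {max 0 t..} x \<partial>lborel)"
    by (subst emeasure_density)
       (auto intro!: nn_integral_cong simp: exponential_density_def indicator_def mult.commute)
  then show ?thesis using nn_integral_exp_Ici[OF assms] by simp
qed

section \<open>Exponential times with values in the extended reals\<close>

context prob_space
begin

text \<open>The rate \<open>r = 0\<close> is allowed and means that \<open>T\<close> is almost surely infinite.\<close>

definition exp_time :: "real \<Rightarrow> ('a \<Rightarrow> ereal) \<Rightarrow> bool" where
  "exp_time r T \<longleftrightarrow> T \<in> borel_measurable M \<and> (\<forall>\<omega>\<in>space M. 0 \<le> T \<omega>) \<and>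
     (\<forall>t. \<P>(\<omega> in M. ereal t \<le> T \<omega>) = exp (- r * max 0 t))"

lemma exp_time_measurable: "exp_time r T \<Longrightarrow> T \<in> borel_measurable M"
  by (simp add: exp_time_def)

lemma AE_exp_time_infinite:
  assumes "exp_time 0 T"
  shows "AE \<omega> in M. T \<omega> = \<infinity>"
proof -
  have [measurable]: "T \<in> borel_measurable M" using assms by (rule exp_time_measurable)
  have "AE \<omega> in M. ereal (real n) \<le> T \<omega>" for n
    using assms by (intro AE_I_eq_1) (auto simp: exp_time_def emeasure_eq_measure)
  then have "AE \<omega> in M. \<forall>n. ereal (real n) \<le> T \<omega>"
    by (simp add: AE_all_countable)
  then show ?thesis
  proof (rule AE_mp, intro AE_I2 impI)
    fix \<omega> assume "\<forall>n. ereal (real n) \<le> T \<omega>"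
    then show "T \<omega> = \<infinity>"
      using less_PInf_Ex_of_nat[of "T \<omega>"] by (auto simp: not_le[symmetric])
  qed
qed

lemma AE_exp_time_finite:
  assumes T: "exp_time r T" and r: "0 < r"
  shows "AE \<omega> in M. T \<omega> < \<infinity>"
proof -
  have [measurable]: "T \<in> borel_measurable M" using T by (rule exp_time_measurable)
  have "\<P>(\<omega> in M. T \<omega> = \<infinity>) \<le> exp (- r * real n)" for n
  proof -
    have "\<P>(\<omega> in M. T \<omega> = \<infinity>) \<le> \<P>(\<omega> in M. ereal (real n) \<le> T \<omega>)"
      by (intro finite_measure_mono) auto
    then show ?thesis using T by (simp add: exp_time_def)
  qed
  moreover have "(\<lambda>n. exp (- r * real n)) \<longlonglongrightarrow> 0"
    using r by real_asymp
  ultimately have "\<P>(\<omega> in M. T \<omega> = \<infinity>) \<le> 0"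
    by (intro LIMSEQ_le_const) auto
  then have "AE \<omega> in M. \<not> T \<omega> = \<infinity>"
    by (subst prob_Collect_eq_0[symmetric]) (auto simp: measure_le_0_iff)
  then show ?thesis by auto
qed

text \<open>Both laws have the same survival function, and the rays form a generator stable under
  intersection. The rate must be positive: at rate 0 all mass sits at \<open>\<infinity>\<close> and
  there is no density.\<close>

lemma distr_exp_time:
  assumes T: "exp_time r T" and r: "0 < r"
  shows "distr M borel T = distr (density lborel (exponential_density r)) borel ereal"
proof -
  have [measurable]: "T \<in> borel_measurable M" using T by (rule exp_time_measurable)
  interpret X: prob_space "density lborel (exponential_density r)"
    by (rule prob_space_exponential_density[OF r])
  interpret D: prob_space "distr M borel T" by (rule prob_space_distr) simp
  show ?thesis
  proof (rule measure_eqI_generator_eq[OF Int_stable_Ici_ereal, where A="\<lambda>_. UNIV"])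
    fix A :: "ereal set" assume "A \<in> insert UNIV (range (\<lambda>t::real. {ereal t..}))"
    then consider "A = UNIV" | t where "A = {ereal t..}" by auto
    then show "emeasure (distr M borel T) A =
        emeasure (distr (density lborel (exponential_density r)) borel ereal) A"
    proof cases
      case 1
      then show ?thesis
        using X.emeasure_space_1 emeasure_space_1 by (simp add: emeasure_distr)
    next
      case 2
      have "emeasure (distr M borel T) A = ennreal (\<P>(\<omega> in M. ereal t \<le> T \<omega>))"
        by (auto simp: 2 emeasure_distr emeasure_eq_measure vimage_def Int_def conj_commute)
      moreover have "ereal -` {ereal t..} = {t..}" by auto
      ultimately show ?thesis
        using T emeasure_exponential_Ici[OF r, of t] by (simp add: 2 emeasure_distr exp_time_def)
    qed
  qed (auto simp: borel_ereal_eq_sigma_sets D.emeasure_finite simp del: emeasure_distr)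
qed

text \<open>Fubini, conditioning on the value of \<open>T j\<close>. It reduces the probability of a
  race to a one-dimensional integral whose integrand is the probability of a race with one
  competitor fewer.\<close>

lemma emeasure_exp_time_indep:
  fixes T :: "'i \<Rightarrow> 'a \<Rightarrow> ereal"
  assumes T: "exp_time r (T j)" and r: "0 < r"
    and ind: "indep_vars (\<lambda>_. borel) T I" and K: "insert j K \<subseteq> I" "j \<notin> K"
    and Q [measurable]: "Q \<in> sets (borel \<Otimes>\<^sub>M (\<Pi>\<^sub>M k\<in>K. borel))"
  shows "emeasure M {\<omega> \<in> space M. (T j \<omega>, \<lambda>k\<in>K. T k \<omega>) \<in> Q} =
    (\<integral>\<^sup>+t. ennreal (r * exp (- r * t)) * indicator {0..} t *
       emeasure M {\<omega> \<in> space M. (ereal t, \<lambda>k\<in>K. T k \<omega>) \<in> Q} \<partial>lborel)"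
proof -
  \<comment> \<open>\<open>indep_var_restrict\<close> speaks of restrictions of the family to index
    sets, so \<open>T j\<close> is treated as a function on \<open>{j}\<close> and unwrapped again
    through \<open>?Q\<close>.\<close>
  let ?S = "\<Pi>\<^sub>M k\<in>K. (borel :: ereal measure)" and ?S1 = "\<Pi>\<^sub>M k\<in>{j}. (borel :: ereal measure)"
  let ?R = "\<lambda>\<omega>. \<lambda>k\<in>K. T k \<omega>" and ?R1 = "\<lambda>\<omega>. \<lambda>k\<in>{j}. T k \<omega>"
  have indep: "indep_var ?S1 ?R1 ?S ?R"
    using K by (intro indep_var_restrict[OF ind]) auto
  then have R1 [measurable]: "?R1 \<in> measurable M ?S1" and [measurable]: "?R \<in> measurable M ?S"
    by (auto dest: indep_var_rv1 indep_var_rv2)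
  have [measurable]: "T j \<in> borel_measurable M" using T by (rule exp_time_measurable)
  interpret R: prob_space "distr M ?S ?R" by (rule prob_space_distr) simp
  let ?Q = "{p \<in> space (?S1 \<Otimes>\<^sub>M ?S). (fst p j, snd p) \<in> Q}"
  have Q' [measurable]: "?Q \<in> sets (?S1 \<Otimes>\<^sub>M ?S)" by measurable
  have m1 [measurable]: "(\<lambda>t. emeasure (distr M ?S ?R) (Pair t -` Q)) \<in> borel_measurable borel"
    by (rule R.measurable_emeasure_Pair) simp
  have m2 [measurable]: "(\<lambda>f. emeasure (distr M ?S ?R) (Pair f -` ?Q)) \<in> borel_measurable ?S1"
    by (rule R.measurable_emeasure_Pair, subst sets_pair_measure_cong[OF refl sets_distr], rule Q')
  have sp: "?R \<omega> \<in> space ?S" "?R1 \<omega> \<in> space ?S1" for \<omega>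
    by (auto simp: space_PiM)
  have "emeasure M {\<omega> \<in> space M. (T j \<omega>, ?R \<omega>) \<in> Q} =
      emeasure (distr M (?S1 \<Otimes>\<^sub>M ?S) (\<lambda>\<omega>. (?R1 \<omega>, ?R \<omega>))) ?Q"
    using sp by (subst emeasure_distr) (auto simp: space_pair_measure intro!: arg_cong[where f="emeasure M"])
  also have "distr M (?S1 \<Otimes>\<^sub>M ?S) (\<lambda>\<omega>. (?R1 \<omega>, ?R \<omega>)) = distr M ?S1 ?R1 \<Otimes>\<^sub>M distr M ?S ?R"
    using indep unfolding indep_var_distribution_eq by simp
  also have "emeasure \<dots> ?Q = (\<integral>\<^sup>+f. emeasure (distr M ?S ?R) (Pair f -` ?Q) \<partial>distr M ?S1 ?R1)"
    by (rule R.emeasure_pair_measure_alt) simp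
  also have "\<dots> = (\<integral>\<^sup>+\<omega>. emeasure (distr M ?S ?R) (Pair (?R1 \<omega>) -` ?Q) \<partial>M)"
    by (rule nn_integral_distr, rule R1, unfold measurable_distr_eq1, rule m2)
  also have "\<dots> = (\<integral>\<^sup>+\<omega>. emeasure (distr M ?S ?R) (Pair (T j \<omega>) -` Q) \<partial>M)"
    using sets.sets_into_space[OF Q] sp
    by (intro nn_integral_cong arg_cong[where f="emeasure _"])
       (auto simp: space_pair_measure)
  also have "\<dots> = (\<integral>\<^sup>+t. emeasure (distr M ?S ?R) (Pair t -` Q) \<partial>distr M borel (T j))"
    by (subst nn_integral_distr) auto
  also have "\<dots> = (\<integral>\<^sup>+t. ennreal (exponential_density r t) *
      emeasure (distr M ?S ?R) (Pair (ereal t) -` Q) \<partial>lborel)"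
    unfolding distr_exp_time[OF T r]
    by (subst nn_integral_distr) (auto intro!: nn_integral_density)
  also have "\<dots> = (\<integral>\<^sup>+t. ennreal (r * exp (- r * t)) * indicator {0..} t *
       emeasure M {\<omega> \<in> space M. (ereal t, ?R \<omega>) \<in> Q} \<partial>lborel)"
  proof (intro nn_integral_cong)
    fix t :: real
    have "Pair (ereal t) -` Q \<in> sets ?S" by (rule sets_Pair1[OF Q])
    then have "emeasure (distr M ?S ?R) (Pair (ereal t) -` Q) =
        emeasure M {\<omega> \<in> space M. (ereal t, ?R \<omega>) \<in> Q}"
      by (subst emeasure_distr) (auto intro!: arg_cong[where f="emeasure M"])
    then show "ennreal (exponential_density r t) * emeasure (distr M ?S ?R) (Pair (ereal t) -` Q) =
        ennreal (r * exp (- r * t)) * indicator {0..} t *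
       emeasure M {\<omega> \<in> space M. (ereal t, ?R \<omega>) \<in> Q}"
      by (auto simp: exponential_density_def indicator_def mult.commute)
  qed
  finally show ?thesis .
qed

text \<open>Independence may be tested on a generator stable under intersection, and on rays it is
  the factorisation \<open>surv\<close> of the joint survival function.\<close>

lemma indep_vars_exp_time:
  assumes J: "finite J" "J \<noteq> {}" and T: "\<And>j. j \<in> J \<Longrightarrow> exp_time (r j) (T j)"
    and surv: "\<And>t. \<P>(\<omega> in M. \<forall>j\<in>J. ereal (t j) \<le> T j \<omega>) = (\<Prod>j\<in>J. exp (- r j * max 0 (t j)))"
  shows "indep_vars (\<lambda>_. borel) T J"
proof (subst indep_vars_finite[where E="\<lambda>_. insert UNIV (range (\<lambda>t::real. {ereal t..}))"])
  let ?E = "insert UNIV (range (\<lambda>t::real. {ereal t..}))"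
  show "\<forall>A\<in>J \<rightarrow> ?E. prob (\<Inter>j\<in>J. T j -` A j \<inter> space M) = (\<Prod>j\<in>J. prob (T j -` A j \<inter> space M))"
  proof
    fix A assume A: "A \<in> J \<rightarrow> ?E"
    \<comment> \<open>The generator \<open>UNIV\<close> also has the form of a threshold event:
      threshold 0 works, since \<open>T j\<close> is nonnegative everywhere.\<close>
    have "\<exists>t. T j -` A j \<inter> space M = {\<omega> \<in> space M. ereal t \<le> T j \<omega>}" if "j \<in> J" for j
    proof -
      from A that consider "A j = UNIV" | t where "A j = {ereal t..}" by blast
      then show ?thesis
      proof cases
        case 1
        then show ?thesis using T[OF that] by (intro exI[of _ 0]) (auto simp: exp_time_def zero_ereal_def)
      qed auto
    qed
    then obtain t where t: "\<And>j. j \<in> J \<Longrightarrow> T j -` A j \<inter> space M = {\<omega> \<in> space M. ereal (t j) \<le> T j \<omega>}"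
      by metis
    have "(\<Inter>j\<in>J. T j -` A j \<inter> space M) = {\<omega> \<in> space M. \<forall>j\<in>J. ereal (t j) \<le> T j \<omega>}"
      using J by (auto simp: t)
    moreover have "(\<Prod>j\<in>J. prob (T j -` A j \<inter> space M)) = (\<Prod>j\<in>J. exp (- r j * max 0 (t j)))"
      using T by (intro prod.cong) (auto simp: t exp_time_def)
    ultimately show "prob (\<Inter>j\<in>J. T j -` A j \<inter> space M) = (\<Prod>j\<in>J. prob (T j -` A j \<inter> space M))"
      using surv by simp
  qed
qed (use J T in \<open>auto simp: borel_ereal_eq_sigma_sets Int_stable_Ici_ereal intro: exp_time_measurable\<close>)

end

section \<open>Races between the arrival times of disjoint regions\<close>

context poisson_race
begin

sublocale config: prob_space config_space
  by (rule prob_config_space)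

lemma exp_time_arrival: "region A \<Longrightarrow> config.exp_time (vol A) (arrival A)"
  using prob_le_arrival[of "{()}" "\<lambda>_. A"]
  by (auto simp: config.exp_time_def region_def arrival_nonneg disjoint_family_on_def)

text \<open>The independence of a Poisson process over disjoint regions, in the form that the races
  need; it follows from void probabilities alone.\<close>

lemma indep_arrivals:
  assumes "finite J" "J \<noteq> {}" "disjoint_family_on A J" "\<And>j. j \<in> J \<Longrightarrow> region (A j)"
  shows "config.indep_vars (\<lambda>_. borel) (\<lambda>j. arrival (A j)) J"
  using assms
  by (intro config.indep_vars_exp_time[where r="\<lambda>j. vol (A j)"])
     (auto intro: exp_time_arrival simp: prob_le_arrival exp_sum[symmetric] sum_negf[symmetric])

text \<open>Competing exponential clocks: given that \<open>A\<close> arrives at time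
  \<open>t\<close>, the region \<open>B\<close> is still silent with probability
  \<open>exp (- vol B * t)\<close>. If \<open>vol A = 0\<close> there is no density to integrate,
  but then \<open>A\<close> never arrives, while \<open>pos\<close> makes \<open>B\<close>
  arrive.\<close>

lemma prob_arrival_le:
  assumes A: "region A" and B: "region B" and disj: "A \<inter> B = {}" and pos: "0 < vol A + vol B"
  shows "measure config_space {\<omega> \<in> space config_space. arrival A \<omega> \<le> arrival B \<omega>} =
    vol A / (vol A + vol B)"
proof (cases "vol A = 0")
  case True
  then have "0 < vol B" using pos by simp
  then have "AE \<omega> in config_space. \<not> arrival A \<omega> \<le> arrival B \<omega>"
    using config.AE_exp_time_infinite[of "arrival A"] exp_time_arrival[OF A]
      config.AE_exp_time_finite[OF exp_time_arrival[OF B]]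
    by (auto simp: True)
  then have "measure config_space {\<omega> \<in> space config_space. arrival A \<omega> \<le> arrival B \<omega>} = 0"
    using A B by (subst config.prob_Collect_eq_0) (auto simp: region_def)
  then show ?thesis by (simp add: True)
next
  case False
  then have r: "0 < vol A" using vol_nonneg[of A] by simp
  let ?T = "\<lambda>b. arrival (case_bool A B b)" and ?R = "vol A + vol B"
  have ind: "config.indep_vars (\<lambda>_. borel) ?T UNIV"
    using A B disj by (intro indep_arrivals) (auto simp: disjoint_family_on_def split: bool.splits)
  have T: "config.exp_time (vol A) (?T True)" using exp_time_arrival[OF A] by simp
  let ?Q = "{p \<in> space (borel \<Otimes>\<^sub>M (\<Pi>\<^sub>M b\<in>{False}. borel)). fst p \<le> (snd p False :: ereal)}"
  have "?Q \<in> sets (borel \<Otimes>\<^sub>M (\<Pi>\<^sub>M b\<in>{False}. borel))" by measurable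
  then have "emeasure config_space {\<omega> \<in> space config_space. (?T True \<omega>, \<lambda>b\<in>{False}. ?T b \<omega>) \<in> ?Q} =
    (\<integral>\<^sup>+t. ennreal (vol A * exp (- vol A * t)) * indicator {0..} t *
       emeasure config_space {\<omega> \<in> space config_space. (ereal t, \<lambda>b\<in>{False}. ?T b \<omega>) \<in> ?Q} \<partial>lborel)"
    by (intro config.emeasure_exp_time_indep[OF T r ind]) auto
  also have "\<dots> = (\<integral>\<^sup>+t. ennreal (vol A / ?R) *
      (ennreal (?R * exp (- ?R * t)) * indicator {0..} t) \<partial>lborel)"
  proof (intro nn_integral_cong)
    fix t :: real
    have "emeasure config_space {\<omega> \<in> space config_space. (ereal t, \<lambda>b\<in>{False}. ?T b \<omega>) \<in> ?Q} =
        ennreal (exp (- vol B * max 0 t))"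
      using exp_time_arrival[OF B]
      by (simp add: config.exp_time_def config.emeasure_eq_measure space_pair_measure space_PiM)
    moreover have "vol A * exp (- vol A * t) * exp (- vol B * t) = vol A / ?R * (?R * exp (- ?R * t))"
    proof -
      have "exp (- vol A * t) * exp (- vol B * t) = exp (- ?R * t)"
        by (simp add: mult_exp_exp algebra_simps)
      then show ?thesis using pos by (simp add: mult.assoc)
    qed
    ultimately show "ennreal (vol A * exp (- vol A * t)) * indicator {0..} t *
       emeasure config_space {\<omega> \<in> space config_space. (ereal t, \<lambda>b\<in>{False}. ?T b \<omega>) \<in> ?Q} =
       ennreal (vol A / ?R) * (ennreal (?R * exp (- ?R * t)) * indicator {0..} t)"
      using r pos by (auto simp: indicator_def ennreal_mult[symmetric] vol_nonneg simp del: mult_minus_left)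
  qed
  also have "\<dots> = ennreal (vol A / ?R)"
    using nn_integral_exp_Ici[OF pos, of 0] by (subst nn_integral_cmult) auto
  finally show ?thesis
    using r pos by (simp add: measure_def space_pair_measure space_PiM)
qed

text \<open>The probabilities of the two weak orders add up to 1 and one of the orders always holds,
  so both hold with probability 0. Two regions of volume 0 tie at \<open>\<infinity>\<close>, hence
  the form of the conclusion.\<close>

lemma AE_arrival_neq:
  assumes A: "region A" and B: "region B" and disj: "A \<inter> B = {}"
  shows "AE \<omega> in config_space. arrival A \<omega> = arrival B \<omega> \<longrightarrow> arrival A \<omega> = \<infinity>"
proof (cases "vol A = 0")
  case True
  then show ?thesis
    using config.AE_exp_time_infinite[of "arrival A"] exp_time_arrival[OF A] by auto
next
  case False
  have [measurable]: "A \<in> sets plane" "B \<in> sets plane" using A B by (auto simp: region_def)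
  let ?L = "{\<omega> \<in> space config_space. arrival A \<omega> \<le> arrival B \<omega>}"
  let ?G = "{\<omega> \<in> space config_space. arrival B \<omega> \<le> arrival A \<omega>}"
  have pos: "0 < vol A + vol B" using False vol_nonneg[of A] vol_nonneg[of B] by simp
  have "measure config_space ?L + measure config_space ?G = 1"
    using prob_arrival_le[OF A B disj pos] prob_arrival_le[OF B A] disj pos
    by (simp add: Int_commute add.commute add_divide_distrib[symmetric])
  moreover have "measure config_space (?L \<union> ?G) = measure config_space ?L + measure config_space (?G - ?L)"
    by (rule config.finite_measure_Union') auto
  moreover have "measure config_space (?G - ?L) = measure config_space ?G - measure config_space (?G \<inter> ?L)"
    by (rule config.finite_measure_Diff') auto
  moreover have "?L \<union> ?G = space config_space" by auto
  ultimately have "measure config_space (?G \<inter> ?L) = 0"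
    using config.prob_space by simp
  moreover have "?G \<inter> ?L = {\<omega> \<in> space config_space. arrival A \<omega> = arrival B \<omega>}" by auto
  ultimately have "AE \<omega> in config_space. \<not> arrival A \<omega> = arrival B \<omega>"
    by (subst config.prob_Collect_eq_0[symmetric]) auto
  then show ?thesis by auto
qed

text \<open>By the memoryless property, once a point has fallen into \<open>A 1\<close> before all others, the race
  between \<open>A 0\<close> and \<open>A 3\<close> starts afresh; this explains the product of two quotients of rates.\<close>

lemma prob_double_race:
  fixes A :: "nat \<Rightarrow> ('a \<times> real) set"
  assumes A: "\<And>j. j < 4 \<Longrightarrow> region (A j)" and disj: "disjoint_family_on A {..<4}"
    and pos: "0 < vol (A 0) + vol (A 3)"
  shows "measure config_space {\<omega> \<in> space config_space. arrival (A 1) \<omega> \<le> arrival (A 0) \<omega> \<and>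
      arrival (A 1) \<omega> \<le> arrival (A 2) \<omega> \<and> arrival (A 0) \<omega> \<le> arrival (A 3) \<omega>} =
    vol (A 0) * vol (A 1) /
      ((vol (A 0) + vol (A 3)) * (vol (A 0) + vol (A 1) + vol (A 2) + vol (A 3)))"
    (is "measure _ ?E = _")
proof -
  have reg: "region (A 0)" "region (A 1)" "region (A 2)" "region (A 3)"
    using A by auto
  then have [measurable]: "arrival (A 0) \<in> borel_measurable config_space"
      "arrival (A 1) \<in> borel_measurable config_space"
      "arrival (A 2) \<in> borel_measurable config_space"
      "arrival (A 3) \<in> borel_measurable config_space"
    by (auto simp: region_def intro: measurable_arrival)
  have E: "?E \<in> sets config_space" by measurable
  let ?T = "\<lambda>j. arrival (A j)"
  have indep: "config.indep_vars (\<lambda>_. borel) ?T {..<4}"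
    using A disj by (intro indep_arrivals) (auto simp: lessThan_empty_iff)
  \<comment> \<open>Conditioning on the arrivals in \<open>A 0\<close> and \<open>A 1\<close> needs
    positive rates; if one of these rates is 0, both sides vanish.\<close>
  consider "vol (A 0) = 0" | "vol (A 0) > 0" "vol (A 1) = 0" | "vol (A 0) > 0" "vol (A 1) > 0"
    using vol_nonneg[of "A 0"] vol_nonneg[of "A 1"] by linarith
  then show ?thesis
  proof cases
    case 1
    then have "AE \<omega> in config_space. \<not> ?T 0 \<omega> \<le> ?T 3 \<omega>"
      using config.AE_exp_time_infinite[of "?T 0"] exp_time_arrival[OF reg(1)] pos
        config.AE_exp_time_finite[OF exp_time_arrival[OF reg(4)]] by auto
    then have "measure config_space ?E = 0"
      by (subst config.prob_Collect_eq_0[OF E]) (auto elim: eventually_mono)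
    then show ?thesis by (simp add: 1)
  next
    case 2
    then have "AE \<omega> in config_space. \<not> ?T 1 \<omega> \<le> ?T 0 \<omega>"
      using config.AE_exp_time_infinite[of "?T 1"] exp_time_arrival[OF reg(2)]
        config.AE_exp_time_finite[OF exp_time_arrival[OF reg(1)]] by auto
    then have "measure config_space ?E = 0"
      by (subst config.prob_Collect_eq_0[OF E]) (auto elim: eventually_mono)
    then show ?thesis by (simp only: 2(2) mult_zero_right div_0)
  next
    case 3
    let ?r = "vol (A 0)" and ?s = "vol (A 1)" and ?w = "vol (A 2)" and ?v = "vol (A 3)"
    have nn: "0 \<le> ?w" "0 \<le> ?v" by (rule vol_nonneg)+
    \<comment> \<open>The arrival in \<open>A 0\<close> is frozen at time \<open>t\<close>. What
      remains is that \<open>A 1\<close> arrives by time \<open>t\<close> and no later than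
      \<open>A 2\<close>, while \<open>A 3\<close> is silent until \<open>t\<close>; the integral
      runs over the arrival time of \<open>A 1\<close>.\<close>
    have inner: "emeasure config_space {\<omega> \<in> space config_space. ?T 1 \<omega> \<le> ereal t \<and>
          ?T 1 \<omega> \<le> ?T 2 \<omega> \<and> ereal t \<le> ?T 3 \<omega>} =
        ennreal (?s / (?s + ?w) * (exp (- ?v * t) - exp (- (?s + ?w + ?v) * t)))" if "0 \<le> t" for t
    proof -
      let ?Q = "{p \<in> space (borel \<Otimes>\<^sub>M (\<Pi>\<^sub>M j\<in>{2, 3}. borel)).
        fst p \<le> ereal t \<and> fst p \<le> snd p (2::nat) \<and> ereal t \<le> snd p 3}"
      have "?Q \<in> sets (borel \<Otimes>\<^sub>M (\<Pi>\<^sub>M j\<in>{2, 3}. borel))"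
        by measurable
      then have "emeasure config_space {\<omega> \<in> space config_space. (?T 1 \<omega>, \<lambda>j\<in>{2, 3}. ?T j \<omega>) \<in> ?Q} =
          (\<integral>\<^sup>+x. ennreal (?s * exp (- ?s * x)) * indicator {0..} x *
            emeasure config_space {\<omega> \<in> space config_space. (ereal x, \<lambda>j\<in>{2, 3}. ?T j \<omega>) \<in> ?Q} \<partial>lborel)"
        using exp_time_arrival[OF reg(2)]
        by (intro config.emeasure_exp_time_indep[OF _ 3(2) indep]) auto
      also have "\<dots> = (\<integral>\<^sup>+x. ennreal (?s * exp (- ?v * t) * exp (- (?s + ?w) * x)) * indicator {0..t} x \<partial>lborel)"
      proof (intro nn_integral_cong)
        fix x :: real
        have "emeasure config_space {\<omega> \<in> space config_space. (ereal x, \<lambda>j\<in>{2, 3}. ?T j \<omega>) \<in> ?Q} = ennreal (exp (- ?w * x - ?v * t))"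
          if x: "0 \<le> x" "x \<le> t"
        proof -
          \<comment> \<open>The thresholds are \<open>x\<close> for index 2 and \<open>t\<close> for
            index 3, so one use of the joint survival formula handles both regions.\<close>
          have "measure config_space {\<omega> \<in> space config_space. \<forall>j\<in>{2, 3}.
              ereal (((\<lambda>_. t)(2 := x)) j) \<le> ?T j \<omega>} = exp (- ?w * x - ?v * t)"
            using disj A x \<open>0 \<le> t\<close>
            by (subst prob_le_arrival) (auto simp: disjoint_family_on_def)
          then show ?thesis
            using x by (simp add: config.emeasure_eq_measure space_pair_measure space_PiM)
        qed
        then show "ennreal (?s * exp (- ?s * x)) * indicator {0..} x *
            emeasure config_space {\<omega> \<in> space config_space. (ereal x, \<lambda>j\<in>{2, 3}. ?T j \<omega>) \<in> ?Q} =
            ennreal (?s * exp (- ?v * t) * exp (- (?s + ?w) * x)) * indicator {0..t} x"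
          using 3 by (auto simp: indicator_def ennreal_mult[symmetric] mult_exp_exp algebra_simps)
      qed
      also have "\<dots> = ennreal (?s * exp (- ?v * t) / (?s + ?w) * (1 - exp (- (?s + ?w) * t)))"
        using 3 nn \<open>0 \<le> t\<close> by (intro nn_integral_exp_Icc) auto
      also have "?s * exp (- ?v * t) / (?s + ?w) * (1 - exp (- (?s + ?w) * t)) =
          ?s / (?s + ?w) * (exp (- ?v * t) - exp (- ?v * t) * exp (- (?s + ?w) * t))"
        by (simp add: field_simps)
      also have "exp (- ?v * t) * exp (- (?s + ?w) * t) = exp (- (?s + ?w + ?v) * t)"
        by (simp add: mult_exp_exp algebra_simps)
      finally show ?thesis
        by (simp add: space_pair_measure space_PiM PiE_def extensional_def)
    qed
    let ?Q = "{p \<in> space (borel \<Otimes>\<^sub>M (\<Pi>\<^sub>M j\<in>{1, 2, 3}. borel)).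
      snd p 1 \<le> (fst p :: ereal) \<and> snd p 1 \<le> snd p (2::nat) \<and> fst p \<le> snd p 3}"
    have "?Q \<in> sets (borel \<Otimes>\<^sub>M (\<Pi>\<^sub>M j\<in>{1, 2, 3}. borel))"
      by measurable
    then have "emeasure config_space {\<omega> \<in> space config_space. (?T 0 \<omega>, \<lambda>j\<in>{1, 2, 3}. ?T j \<omega>) \<in> ?Q} =
        (\<integral>\<^sup>+x. ennreal (?r * exp (- ?r * x)) * indicator {0..} x *
          emeasure config_space {\<omega> \<in> space config_space. (ereal x, \<lambda>j\<in>{1, 2, 3}. ?T j \<omega>) \<in> ?Q} \<partial>lborel)"
      using exp_time_arrival[OF reg(1)]
      by (intro config.emeasure_exp_time_indep[OF _ 3(1) indep]) auto
    also have "\<dots> = (\<integral>\<^sup>+x. ennreal (?r * ?s / (?s + ?w) * (exp (- (?r + ?v) * x) -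
        exp (- (?r + ?s + ?w + ?v) * x))) * indicator {0..} x \<partial>lborel)"
    proof (intro nn_integral_cong)
      fix x :: real
      show "ennreal (?r * exp (- ?r * x)) * indicator {0..} x *
          emeasure config_space {\<omega> \<in> space config_space. (ereal x, \<lambda>j\<in>{1, 2, 3}. ?T j \<omega>) \<in> ?Q} =
          ennreal (?r * ?s / (?s + ?w) * (exp (- (?r + ?v) * x) -
            exp (- (?r + ?s + ?w + ?v) * x))) * indicator {0..} x"
      proof (cases "0 \<le> x")
        case True
        have "- (?s + ?w + ?v) * x \<le> - ?v * x"
          using 3 nn True by (intro mult_right_mono) auto
        then have "?s / (?s + ?w) * (exp (- ?v * x) - exp (- (?s + ?w + ?v) * x)) \<ge> 0"
          using 3 nn by (intro mult_nonneg_nonneg) (auto simp del: mult_minus_left)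
        moreover have "?r * exp (- ?r * x) * (?s / (?s + ?w) *
              (exp (- ?v * x) - exp (- (?s + ?w + ?v) * x))) =
            ?r * ?s / (?s + ?w) * (exp (- (?r + ?v) * x) - exp (- (?r + ?s + ?w + ?v) * x))"
        proof -
          have exps: "exp (- ?r * x) * exp (- ?v * x) = exp (- (?r + ?v) * x)"
            "exp (- ?r * x) * exp (- (?s + ?w + ?v) * x) = exp (- (?r + ?s + ?w + ?v) * x)"
            by (simp_all add: mult_exp_exp algebra_simps)
          show ?thesis unfolding exps[symmetric] by (simp add: algebra_simps)
        qed
        moreover have "emeasure config_space {\<omega> \<in> space config_space. (ereal x, \<lambda>j\<in>{1, 2, 3}. ?T j \<omega>) \<in> ?Q} =
            ennreal (?s / (?s + ?w) * (exp (- ?v * x) - exp (- (?s + ?w + ?v) * x)))"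
          unfolding inner[OF True, symmetric]
          by (auto simp: space_pair_measure space_PiM intro!: arg_cong[where f="emeasure _"])
        moreover have "0 \<le> ?r * exp (- ?r * x)" using 3 by simp
        moreover have "indicator {0..} x = (1 :: ennreal)" using True by simp
        ultimately show ?thesis by (simp only: ennreal_mult[symmetric] mult_1_right)
      qed simp
    qed
    also have "\<dots> = ennreal (?r * ?s / (?s + ?w) * (1 / (?r + ?v) - 1 / (?r + ?s + ?w + ?v)))"
      using 3 nn by (intro nn_integral_exp_diff_Ici) auto
    also have "?r * ?s / (?s + ?w) * (1 / (?r + ?v) - 1 / (?r + ?s + ?w + ?v)) =
        ?r * ?s / ((?r + ?v) * (?r + ?s + ?w + ?v))"
    proof -
      \<comment> \<open>The numerator \<open>?s + ?w\<close> of this difference cancels the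
        denominator left over from the inner integral.\<close>
      have "1 / (?r + ?v) - 1 / (?r + ?s + ?w + ?v) =
          (?s + ?w) / ((?r + ?v) * (?r + ?s + ?w + ?v))"
        using 3 nn by (simp add: divide_simps)
      then show ?thesis using 3 nn by simp
    qed
    finally have "emeasure config_space ?E = ennreal (?r * ?s / ((?r + ?v) * (?r + ?s + ?w + ?v)))"
      by (simp add: space_pair_measure space_PiM PiE_def extensional_def)
    then show ?thesis using 3 nn by (simp add: measure_def)
  qed
qed


section \<open>The earliest point of a region\<close>

definition win :: "('a \<times> real) set \<Rightarrow> nat \<times> nat \<Rightarrow> 'a config \<Rightarrow> bool" where
  "win A k \<omega> \<longleftrightarrow> live k \<omega> \<and> loc k \<omega> \<in> A \<and> arrival A \<omega> = ereal (tm k \<omega>)"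

text \<open>Ties have probability 0. If \<open>A\<close> has no earliest point, \<open>first A \<omega>\<close> is a junk value; this is a null
  event when \<open>A\<close> has positive volume.\<close>

definition first :: "('a \<times> real) set \<Rightarrow> 'a config \<Rightarrow> nat \<times> nat" where
  "first A \<omega> = prod_decode (LEAST n. win A (prod_decode n) \<omega>)"

definition pick :: "('a \<times> real) set \<Rightarrow> 'a config \<Rightarrow> 'a" where
  "pick A \<omega> = fst (loc (first A \<omega>) \<omega>)"

lemma measurable_first [measurable]:
  assumes [measurable]: "A \<in> sets plane"
  shows "first A \<in> measurable config_space (count_space UNIV)"
proof -
  have [measurable]: "Measurable.pred config_space (\<lambda>\<omega>. arrival A \<omega> = ereal (tm k \<omega>))" for k
    unfolding pred_def by (intro borel_measurable_eq) measurable
  show ?thesis unfolding first_def win_def by measurable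
qed

lemma measurable_pick [measurable]:
  assumes [measurable]: "A \<in> sets plane"
  shows "pick A \<in> measurable config_space \<nu>"
proof -
  have "(\<lambda>\<omega>. fst (loc k \<omega>)) \<in> measurable config_space \<nu>" for k
    using measurable_loc[of k] unfolding plane_def by (rule measurable_compose[OF _ measurable_fst])
  then show ?thesis
    unfolding pick_def by (rule measurable_compose_countable) measurable
qed

lemma win_first: "win A k \<omega> \<Longrightarrow> win A (first A \<omega>) \<omega>"
  unfolding first_def by (rule LeastI[of "\<lambda>n. win A (prod_decode n) \<omega>" "prod_encode k"]) simp

text \<open>Taking the least code among all winners makes \<open>first\<close> a function of the set
  of winners; two regions with the same winners therefore have the same \<open>first\<close> even
  under a tie.\<close>

lemma first_cong: "(\<And>k. win A k \<omega> \<longleftrightarrow> win B k \<omega>) \<Longrightarrow> first A \<omega> = first B \<omega>"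
  unfolding first_def by simp

lemma win_subset: "win A k \<omega> \<Longrightarrow> B \<subseteq> A \<Longrightarrow> loc k \<omega> \<in> B \<Longrightarrow> win B k \<omega>"
  using arrival_le[of k \<omega> B] arrival_antimono[of B A \<omega>] by (auto simp: win_def)

lemma win_arrival_le: "win A k \<omega> \<Longrightarrow> B \<subseteq> A \<Longrightarrow> ereal (tm k \<omega>) \<le> arrival B \<omega>"
  using arrival_antimono[of B A \<omega>] by (auto simp: win_def)

lemma win_finite: "win A k \<omega> \<Longrightarrow> arrival A \<omega> < \<infinity>"
  by (simp add: win_def)

lemma AE_win:
  assumes "region A" "0 < vol A"
  shows "AE \<omega> in config_space. win A (first A \<omega>) \<omega>"
  using AE_arrival_attained[OF assms(1), folded win_def] config.AE_exp_time_finite[OF exp_time_arrival[OF assms(1)] assms(2)]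
  by eventually_elim (auto intro: win_first)

lemma region_subset: "region A \<Longrightarrow> B \<in> sets plane \<Longrightarrow> B \<subseteq> A \<Longrightarrow> region B"
  unfolding region_def using emeasure_mono[of B A plane] by (auto intro: le_less_trans)

lemma region_Un: "region A \<Longrightarrow> region B \<Longrightarrow> region (A \<union> B)"
  unfolding region_def using emeasure_subadditive[of A plane B]
  by (auto intro: le_less_trans simp: ennreal_add_less_top)

lemma vol_Un: "region A \<Longrightarrow> region B \<Longrightarrow> A \<inter> B = {} \<Longrightarrow> vol (A \<union> B) = vol A + vol B"
  unfolding region_def vol_def by (intro measure_Union) (auto simp: less_top)

lemma cyl_sets [measurable]: "C \<in> sets \<nu> \<Longrightarrow> C \<times> UNIV \<in> sets plane"
  unfolding plane_def by simp

text \<open>Cut \<open>A\<close> into the parts over \<open>C\<close> and off \<open>C\<close>: the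
  earliest point of \<open>A\<close> lies over \<open>C\<close> exactly when the first part wins the
  race, up to ties of probability 0.\<close>

lemma prob_pick:
  assumes A: "region A" "vol A = 1" and C: "C \<in> sets \<nu>"
  shows "measure config_space {\<omega> \<in> space config_space. pick A \<omega> \<in> C} = vol (A \<inter> C \<times> UNIV)"
proof -
  let ?A1 = "A \<inter> C \<times> UNIV" and ?A2 = "A - C \<times> UNIV"
  have [measurable]: "A \<in> sets plane" "C \<in> sets \<nu>" using A C by (auto simp: region_def)
  have r: "region ?A1" "region ?A2" by (rule region_subset[OF A(1)]; force)+
  have s: "vol ?A1 + vol ?A2 = 1"
  proof -
    have "?A1 \<inter> ?A2 = {}" "?A1 \<union> ?A2 = A" by auto
    then show ?thesis using vol_Un[OF r] A by simp
  qed
  have "AE \<omega> in config_space. win A (first A \<omega>) \<omega>"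
    using A by (intro AE_win) auto
  moreover have "AE \<omega> in config_space. arrival ?A1 \<omega> = arrival ?A2 \<omega> \<longrightarrow> arrival ?A1 \<omega> = \<infinity>"
    by (rule AE_arrival_neq[OF r]) auto
  ultimately have "AE \<omega> in config_space. pick A \<omega> \<in> C \<longleftrightarrow> arrival ?A1 \<omega> \<le> arrival ?A2 \<omega>"
  proof eventually_elim
    case (elim \<omega>)
    let ?k = "first A \<omega>"
    have t: "arrival A \<omega> = ereal (tm ?k \<omega>)" "loc ?k \<omega> \<in> A" using elim(1) by (auto simp: win_def)
    show ?case
    proof (cases "loc ?k \<omega> \<in> C \<times> UNIV")
      case True
      then have "win ?A1 ?k \<omega>" using elim(1) t by (intro win_subset[OF elim(1)]) auto
      then have "arrival ?A1 \<omega> \<le> arrival ?A2 \<omega>"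
        using arrival_antimono[of ?A2 A \<omega>] t by (auto simp: win_def)
      then show ?thesis using True by (auto simp: pick_def mem_Times_iff)
    next
      case False
      then have w: "win ?A2 ?k \<omega>" using elim(1) t by (intro win_subset[OF elim(1)]) auto
      then have "arrival ?A2 \<omega> \<le> arrival ?A1 \<omega>"
        using arrival_antimono[of ?A1 A \<omega>] t by (auto simp: win_def)
      then have "\<not> arrival ?A1 \<omega> \<le> arrival ?A2 \<omega>"
        using elim(2) win_finite[OF w] by auto
      then show ?thesis using False by (auto simp: pick_def mem_Times_iff)
    qed
  qed
  then have "measure config_space {\<omega> \<in> space config_space. pick A \<omega> \<in> C} =
      measure config_space {\<omega> \<in> space config_space. arrival ?A1 \<omega> \<le> arrival ?A2 \<omega>}"
    by (intro config.finite_measure_eq_AE) (auto elim!: eventually_mono)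
  also have "\<dots> = vol ?A1 / (vol ?A1 + vol ?A2)"
    using s by (intro prob_arrival_le r) auto
  finally show ?thesis using s by simp
qed

text \<open>The race is between \<open>A \<inter> B\<close> and the symmetric difference. A common
  earliest point lies in the former and precedes all points of the latter; conversely, if the former
  is ahead, neither region has an earlier point of its own.\<close>

lemma prob_same_first:
  assumes A: "region A" "0 < vol A" and B: "region B" "0 < vol B"
  shows "measure config_space {\<omega> \<in> space config_space. first A \<omega> = first B \<omega>} =
    vol (A \<inter> B) / vol (A \<union> B)"
proof -
  let ?C = "A \<inter> B" and ?D = "(A - B) \<union> (B - A)"
  have [measurable]: "A \<in> sets plane" "B \<in> sets plane" using A B by (auto simp: region_def)
  have r: "region ?C" "region ?D"
    by (rule region_subset[OF region_Un[OF A(1) B(1)]]; force)+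
  have s: "vol ?C + vol ?D = vol (A \<union> B)"
  proof -
    have "?C \<inter> ?D = {}" "?C \<union> ?D = A \<union> B" by auto
    then show ?thesis using vol_Un[OF r] by simp
  qed
  have pos: "0 < vol (A \<union> B)"
  proof -
    have "vol A + vol (B - A) = vol (A \<union> (B - A))"
      using B by (intro vol_Un[symmetric] A(1) region_subset[OF B(1), of "B - A"]) auto
    then show ?thesis using A vol_nonneg[of "B - A"] by (simp add: Un_Diff_cancel)
  qed
  have "AE \<omega> in config_space. win A (first A \<omega>) \<omega>" "AE \<omega> in config_space. win B (first B \<omega>) \<omega>"
    using A B by (auto intro: AE_win)
  moreover have "AE \<omega> in config_space. arrival ?C \<omega> = arrival ?D \<omega> \<longrightarrow> arrival ?C \<omega> = \<infinity>"
    by (rule AE_arrival_neq[OF r]) auto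
  ultimately have "AE \<omega> in config_space. first A \<omega> = first B \<omega> \<longleftrightarrow> arrival ?C \<omega> \<le> arrival ?D \<omega>"
  proof eventually_elim
    case (elim \<omega>)
    show ?case
    proof
      assume eq: "first A \<omega> = first B \<omega>"
      have "loc (first A \<omega>) \<omega> \<in> ?C" using elim eq by (auto simp: win_def)
      then have "arrival ?C \<omega> \<le> ereal (tm (first A \<omega>) \<omega>)"
        using elim by (intro arrival_le) (auto simp: win_def)
      also have "\<dots> \<le> arrival ?D \<omega>"
        unfolding le_arrival_iff
        using elim(1,2) eq arrival_le[of _ \<omega> A] arrival_le[of _ \<omega> B] by (auto simp: win_def)
      finally show "arrival ?C \<omega> \<le> arrival ?D \<omega>" .
    next
      assume le: "arrival ?C \<omega> \<le> arrival ?D \<omega>"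
      \<comment> \<open>Ties are excluded only at finite times, so finiteness has to come before the
        strict inequality.\<close>
      have "arrival ?C \<omega> < \<infinity>"
      proof (cases "loc (first A \<omega>) \<omega> \<in> B")
        case True
        then show ?thesis
          using elim(1) by (intro win_finite[OF win_subset[OF elim(1)]]) (auto simp: win_def)
      next
        case False
        then have "arrival ?D \<omega> \<le> ereal (tm (first A \<omega>) \<omega>)"
          using elim(1) by (intro arrival_le) (auto simp: win_def)
        then show ?thesis using le by (auto intro: le_less_trans)
      qed
      then have lt: "arrival ?C \<omega> < arrival ?D \<omega>" using le elim(3) by (auto simp: less_le)
      have not_D: "loc k \<omega> \<notin> ?D" if "live k \<omega>" "ereal (tm k \<omega>) \<le> arrival ?C \<omega>" for k
        using lt that arrival_le[of k \<omega> ?D] by (meson leD le_less_trans order_trans)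
      \<comment> \<open>Here \<open>A\<close> is a bound name standing for either region, while
        \<open>?C\<close> and \<open>?D\<close> keep their meaning. Both regions turn out to have
        the winners of \<open>?C\<close>, so their values of \<open>first\<close> agree.\<close>
      have "win A k \<omega> \<longleftrightarrow> win ?C k \<omega>" if "win A (first A \<omega>) \<omega>" "?D \<inter> A = A - ?C" "?C \<subseteq> A" for A k
      proof -
        have *: "arrival A \<omega> = arrival ?C \<omega>"
        proof -
          have "ereal (tm (first A \<omega>) \<omega>) \<le> arrival ?C \<omega>"
            using that by (intro win_arrival_le) auto
          then have "loc (first A \<omega>) \<omega> \<notin> ?D" using that by (intro not_D) (auto simp: win_def)
          then have "win ?C (first A \<omega>) \<omega>"
            using that by (intro win_subset[OF that(1)]) (auto simp: win_def)
          then show ?thesis using that by (auto simp: win_def)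
        qed
        show ?thesis
          using that(2,3) not_D[of k] * by (auto simp: win_def)
      qed
      from this[of A] this[of B] elim(1,2) show "first A \<omega> = first B \<omega>"
        by (intro first_cong) blast
    qed
  qed
  then have "measure config_space {\<omega> \<in> space config_space. first A \<omega> = first B \<omega>} =
      measure config_space {\<omega> \<in> space config_space. arrival ?C \<omega> \<le> arrival ?D \<omega>}"
    by (intro config.finite_measure_eq_AE) (auto elim!: eventually_mono)
  also have "\<dots> = vol ?C / (vol ?C + vol ?D)"
    using s pos by (intro prob_arrival_le r) auto
  finally show ?thesis using s by simp
qed

text \<open>Over \<open>x\<close> the region \<open>B\<close> lies inside \<open>A\<close>.
  Different earliest points, both over \<open>x\<close>, therefore mean that the part of
  \<open>A - B\<close> over \<open>x\<close> wins \<open>A\<close>, and that the part of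
  \<open>B\<close> over \<open>x\<close> then wins \<open>B\<close>. This is an order of arrivals in
  four disjoint pieces, a double race.\<close>

lemma prob_meet_at:
  assumes A: "region A" "vol A = 1" and B: "region B" "vol B = 1"
    and x: "{x} \<in> sets \<nu>" and sub: "B \<inter> {x} \<times> UNIV \<subseteq> A"
  shows "measure config_space {\<omega> \<in> space config_space. first A \<omega> \<noteq> first B \<omega> \<and> pick A \<omega> = x \<and> pick B \<omega> = x} =
    vol (B \<inter> {x} \<times> UNIV) * vol ((A - B) \<inter> {x} \<times> UNIV) / vol (A \<union> B)"
    (is "measure _ ?E = _")
proof -
  let ?x = "{x} \<times> (UNIV :: real set)"
  \<comment> \<open>The pieces are numbered as in \<open>prob_double_race\<close>: 1 wins
    \<open>A\<close>, 0 wins \<open>B\<close>, 2 competes only in \<open>A\<close>, and 3 competes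
    in \<open>B\<close>. Piece 3 may also meet \<open>A\<close>, but it cannot precede piece 1,
    which comes before 0, which comes before 3.\<close>
  define R where "R = (\<lambda>j::nat. [B \<inter> ?x, (A - B) \<inter> ?x, A - B - ?x, B - ?x] ! j)"
  have R: "R 0 = B \<inter> ?x" "R 1 = (A - B) \<inter> ?x" "R (Suc 0) = (A - B) \<inter> ?x" "R 2 = A - B - ?x" "R 3 = B - ?x"
    by (simp_all add: R_def numeral_2_eq_2 numeral_3_eq_3)
  have [measurable]: "A \<in> sets plane" "B \<in> sets plane" using A B by (auto simp: region_def)
  have [measurable]: "?x \<in> sets plane" "{x} \<in> sets \<nu>" using x by auto
  have Rs [measurable]: "R 0 \<in> sets plane" "R 1 \<in> sets plane" "R 2 \<in> sets plane" "R 3 \<in> sets plane"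
    unfolding R by measurable
  have sub': "R 0 \<subseteq> A \<inter> B" "R 1 \<subseteq> A - B" "R 2 \<subseteq> A - B" "R 3 \<subseteq> B"
    unfolding R using sub by auto
  have reg: "region (R 0)" "region (R 1)" "region (R 2)" "region (R 3)"
    using sub' Rs region_subset[OF A(1)] region_subset[OF B(1)] by blast+
  have lt4: "j = 0 \<or> j = 1 \<or> j = 2 \<or> j = 3" if "j < 4" for j :: nat using that by auto
  have disj: "disjoint_family_on R {..<4}"
    unfolding disjoint_family_on_def
    by (intro ballI impI) (use R in \<open>auto dest!: lt4\<close>)
  \<comment> \<open>Pieces 0 and 3 make up \<open>B\<close>, of volume 1, so the denominator of the
    restarted race drops out of the final quotient.\<close>
  have v3: "vol (R 0) + vol (R 3) = 1"
  proof -
    have "R 0 \<inter> R 3 = {}" "R 0 \<union> R 3 = B" by (auto simp: R)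
    then show ?thesis using vol_Un[OF reg(1,4)] B by simp
  qed
  have v: "vol (R 0) + vol (R 1) + vol (R 2) + vol (R 3) = vol (A \<union> B)"
  proof -
    have "R 1 \<inter> R 2 = {}" "R 1 \<union> R 2 = A - B" "B \<inter> (A - B) = {}" "B \<union> (A - B) = A \<union> B" by (auto simp: R)
    moreover from this have "region (A - B)" using region_Un[OF reg(2,3)] by simp
    ultimately show ?thesis
      using vol_Un[OF reg(2,3)] vol_Un[OF B(1), of "A - B"] v3 B by simp
  qed
  have "AE \<omega> in config_space. win A (first A \<omega>) \<omega>" "AE \<omega> in config_space. win B (first B \<omega>) \<omega>"
    using A B by (auto intro!: AE_win)
  moreover have dist: "AE \<omega> in config_space. arrival (R i) \<omega> = arrival (R j) \<omega> \<longrightarrow> arrival (R i) \<omega> = \<infinity>"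
    if "i < 4" "j < 4" "i \<noteq> j" for i j
    using that disj reg by (intro AE_arrival_neq) (auto simp: disjoint_family_on_def dest!: lt4)
  have "AE \<omega> in config_space. \<forall>i\<in>{..<4}. \<forall>j\<in>{..<4}. i \<noteq> j \<longrightarrow>
      arrival (R i) \<omega> = arrival (R j) \<omega> \<longrightarrow> arrival (R i) \<omega> = \<infinity>"
    using dist by (intro AE_finite_allI) auto
  ultimately have "AE \<omega> in config_space.
      (first A \<omega> \<noteq> first B \<omega> \<and> pick A \<omega> = x \<and> pick B \<omega> = x) \<longleftrightarrow>
      (arrival (R 1) \<omega> \<le> arrival (R 0) \<omega> \<and> arrival (R 1) \<omega> \<le> arrival (R 2) \<omega> \<and>
       arrival (R 0) \<omega> \<le> arrival (R 3) \<omega>)"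
  proof eventually_elim
    case (elim \<omega>)
    let ?T = "\<lambda>j. arrival (R j) \<omega>"
    note wA = elim(1) and wB = elim(2)
    have d: "?T i \<noteq> ?T j" if "i < 4" "j < 4" "i \<noteq> j" "?T i < \<infinity>" for i j
      using elim(3) that by auto
    have locA: "loc k \<omega> \<in> R 0 \<or> loc k \<omega> \<in> R 1 \<or> loc k \<omega> \<in> R 2 \<or> loc k \<omega> \<in> R 3" if "win A k \<omega>" for k
      using that unfolding R by (auto simp: win_def)
    have locB: "loc k \<omega> \<in> R 0 \<or> loc k \<omega> \<in> R 3" if "win B k \<omega>" for k
      using that unfolding R by (auto simp: win_def)
    have winR: "win C k \<omega> \<Longrightarrow> loc k \<omega> \<in> R j \<Longrightarrow> ?T j \<le> ereal (tm k \<omega>)" for C j k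
      by (intro arrival_le) (auto simp: win_def)
    have A_le: "arrival A \<omega> \<le> ?T 0" "arrival A \<omega> \<le> ?T 1" "arrival A \<omega> \<le> ?T 2"
      and B_le: "arrival B \<omega> \<le> ?T 0" "arrival B \<omega> \<le> ?T 3"
      using sub' by (auto intro!: arrival_antimono)
    have tA: "arrival A \<omega> = ereal (tm k \<omega>)" if "win A k \<omega>" for k using that by (simp add: win_def)
    have tB: "arrival B \<omega> = ereal (tm k \<omega>)" if "win B k \<omega>" for k using that by (simp add: win_def)
    show ?case
    proof
      assume meet: "first A \<omega> \<noteq> first B \<omega> \<and> pick A \<omega> = x \<and> pick B \<omega> = x"
      then have B0: "loc (first B \<omega>) \<omega> \<in> R 0"
        using wB by (auto simp: R win_def pick_def mem_Times_iff)
      have T0: "?T 0 = arrival B \<omega>"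
        using winR[OF wB B0] tB[OF wB] B_le by (simp add: antisym)
      \<comment> \<open>Points of \<open>R 0\<close> belong to both regions. If one of them won
        \<open>A\<close>, it would precede all other pieces, both regions would have the same
        winners, and \<open>first\<close> would agree.\<close>
      have "loc (first A \<omega>) \<omega> \<notin> R 0"
      proof
        assume "loc (first A \<omega>) \<omega> \<in> R 0"
        then have T0': "?T 0 = arrival A \<omega>"
          using winR[OF wA, of 0] tA[OF wA] A_le by (simp add: antisym)
        have fin: "?T 0 < \<infinity>" using T0' tA[OF wA] by simp
        have gt: "?T 0 < ?T 1" "?T 0 < ?T 2" "?T 0 < ?T 3"
          using d[of 0 1] d[of 0 2] d[of 0 3] fin A_le B_le T0 T0' by (auto simp: less_le)
        have "win A k \<omega> \<longleftrightarrow> win B k \<omega>" for k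
        proof
          assume w: "win A k \<omega>"
          then have "loc k \<omega> \<in> R 0"
            using locA[OF w] winR[OF w, of 1] winR[OF w, of 2] winR[OF w, of 3] gt tA[OF w] T0' by auto
          then show "win B k \<omega>" using w T0 T0' sub' by (auto simp: win_def)
        next
          assume w: "win B k \<omega>"
          then have "loc k \<omega> \<in> R 0"
            using locB[OF w] winR[OF w, of 3] gt tB[OF w] T0 by auto
          then show "win A k \<omega>" using w T0 T0' sub' by (auto simp: win_def)
        qed
        then have "first A \<omega> = first B \<omega>" by (rule first_cong)
        with meet show False by simp
      qed
      then have A1: "loc (first A \<omega>) \<omega> \<in> R 1"
        using meet wA by (auto simp: R win_def pick_def mem_Times_iff)
      then have "?T 1 = arrival A \<omega>"
        using winR[OF wA A1] tA[OF wA] A_le by (simp add: antisym)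
      then show "?T 1 \<le> ?T 0 \<and> ?T 1 \<le> ?T 2 \<and> ?T 0 \<le> ?T 3"
        using A_le B_le T0 by simp
    next
      assume le: "?T 1 \<le> ?T 0 \<and> ?T 1 \<le> ?T 2 \<and> ?T 0 \<le> ?T 3"
      have B0: "loc (first B \<omega>) \<omega> \<in> R 0"
      proof (rule ccontr)
        assume "loc (first B \<omega>) \<omega> \<notin> R 0"
        then have "?T 3 \<le> arrival B \<omega>"
          using locB[OF wB] winR[OF wB] tB[OF wB] by auto
        then have "?T 0 = ?T 3" "?T 0 < \<infinity>" using B_le le tB[OF wB] by auto
        then show False using d[of 0 3] by simp
      qed
      have fin: "?T 0 < \<infinity>" using winR[OF wB B0] by (auto intro: le_less_trans)
      moreover have "?T 1 < \<infinity>" using le fin by (auto intro: le_less_trans)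
      ultimately have gt: "?T 1 < ?T 0" "?T 1 < ?T 2" "?T 0 < ?T 3"
        using d[of 1 0] d[of 1 2] d[of 0 3] le by (auto simp: less_le)
      have A1: "loc (first A \<omega>) \<omega> \<in> R 1"
        using locA[OF wA] winR[OF wA, of 0] winR[OF wA, of 2] winR[OF wA, of 3] gt tA[OF wA] A_le
        by auto
      have "first A \<omega> \<noteq> first B \<omega>" using A1 B0 sub' by auto
      then show "first A \<omega> \<noteq> first B \<omega> \<and> pick A \<omega> = x \<and> pick B \<omega> = x"
        using A1 B0 by (auto simp: R pick_def)
    qed
  qed
  then have "measure config_space ?E = measure config_space {\<omega> \<in> space config_space.
      arrival (R 1) \<omega> \<le> arrival (R 0) \<omega> \<and> arrival (R 1) \<omega> \<le> arrival (R 2) \<omega> \<and>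
      arrival (R 0) \<omega> \<le> arrival (R 3) \<omega>}"
  proof (intro config.finite_measure_eq_AE)
    have [measurable]: "pick A \<in> measurable config_space \<nu>" "pick B \<in> measurable config_space \<nu>"
      "first A \<in> measurable config_space (count_space UNIV)"
      "first B \<in> measurable config_space (count_space UNIV)"
      by (auto intro: measurable_pick measurable_first)
    have [measurable]: "Measurable.pred config_space (\<lambda>\<omega>. pick A \<omega> \<in> {x})"
      "Measurable.pred config_space (\<lambda>\<omega>. pick B \<omega> \<in> {x})"
      by measurable
    show "?E \<in> sets config_space"
      by (rule subst[where P="\<lambda>S. S \<in> sets config_space", of "{\<omega> \<in> space config_space.
        first A \<omega> \<noteq> first B \<omega> \<and> pick A \<omega> \<in> {x} \<and> pick B \<omega> \<in> {x}}"]) (auto, measurable)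
  qed (use Rs in \<open>auto elim!: eventually_mono\<close>)
  also have "\<dots> = vol (R 0) * vol (R 1) /
      ((vol (R 0) + vol (R 3)) * (vol (R 0) + vol (R 1) + vol (R 2) + vol (R 3)))"
    using v3 disj reg by (intro prob_double_race) (auto dest!: lt4)
  also have "\<dots> = vol (R 0) * vol (R 1) / vol (A \<union> B)"
    unfolding v3 v by simp
  finally show ?thesis unfolding R .
qed


section \<open>Regions below densities\<close>

definition under :: "('a \<Rightarrow> real) \<Rightarrow> ('a \<times> real) set" where
  "under g = {p \<in> space plane. 0 \<le> snd p \<and> snd p < g (fst p)}"

definition prob_density :: "('a \<Rightarrow> real) \<Rightarrow> bool" where
  "prob_density g \<longleftrightarrow> g \<in> borel_measurable \<nu> \<and> (\<forall>x\<in>space \<nu>. 0 \<le> g x) \<and>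
     (\<integral>\<^sup>+x. ennreal (g x) \<partial>\<nu>) = 1"

lemma under_sets [measurable]:
  assumes [measurable]: "g \<in> borel_measurable \<nu>"
  shows "under g \<in> sets plane"
  unfolding under_def plane_def by measurable

lemma under_Int: "under g \<inter> under h = under (\<lambda>x. min (g x) (h x))"
  by (auto simp: under_def)

text \<open>Fubini: the slice of \<open>under g\<close> over \<open>x\<close> is
  \<open>{0..<g x}\<close>, of length \<open>g x\<close>.\<close>

lemma emeasure_under_cyl:
  assumes [measurable]: "g \<in> borel_measurable \<nu>" and nn: "\<And>x. x \<in> space \<nu> \<Longrightarrow> 0 \<le> g x"
    and C [measurable]: "C \<in> sets \<nu>"
  shows "emeasure plane (under g \<inter> C \<times> UNIV) = emeasure (density \<nu> g) C"
proof -
  have "under g \<inter> C \<times> UNIV \<in> sets plane"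
    by (intro sets.Int under_sets cyl_sets) auto
  then have "emeasure plane (under g \<inter> C \<times> UNIV) =
      (\<integral>\<^sup>+x. emeasure lborel (Pair x -` (under g \<inter> C \<times> UNIV)) \<partial>\<nu>)"
    unfolding plane_def by (rule lborel.emeasure_pair_measure_alt)
  also have "\<dots> = (\<integral>\<^sup>+x. ennreal (g x) * indicator C x \<partial>\<nu>)"
  proof (intro nn_integral_cong)
    fix x assume x: "x \<in> space \<nu>"
    then have "Pair x -` (under g \<inter> C \<times> UNIV) = (if x \<in> C then {0..<g x} else {})"
      by (auto simp: under_def plane_def space_pair_measure)
    then show "emeasure lborel (Pair x -` (under g \<inter> C \<times> UNIV)) = ennreal (g x) * indicator C x"
      using nn[OF x] by simp
  qed
  also have "\<dots> = emeasure (density \<nu> g) C"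
    by (simp add: emeasure_density)
  finally show ?thesis .
qed

lemma under_cyl_space: "under g \<inter> space \<nu> \<times> UNIV = under g"
  by (auto simp: under_def plane_def space_pair_measure)

lemma vol_under_cyl:
  assumes "prob_density g" "C \<in> sets \<nu>"
  shows "vol (under g \<inter> C \<times> UNIV) = measure (density \<nu> g) C"
  using emeasure_under_cyl[of g C] assms by (simp add: vol_def measure_def prob_density_def)

lemma prob_space_density: "prob_density g \<Longrightarrow> prob_space (density \<nu> g)"
  by (intro prob_spaceI) (auto simp: prob_density_def emeasure_density cong: nn_integral_cong)

lemma
  assumes "prob_density g"
  shows region_under: "region (under g)" and vol_under: "vol (under g) = 1"
proof -
  interpret G: prob_space "density \<nu> g" using assms by (rule prob_space_density)
  have "emeasure plane (under g) = 1"
    using emeasure_under_cyl[of g "space \<nu>"] assms G.emeasure_space_1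
    by (simp add: under_cyl_space prob_density_def)
  moreover have "under g \<subseteq> space \<nu> \<times> {0..}"
    by (auto simp: under_def plane_def space_pair_measure)
  ultimately show "region (under g)" "vol (under g) = 1"
    using assms by (auto simp: region_def vol_def measure_def prob_density_def)
qed

lemma distr_pick:
  assumes g: "prob_density g"
  shows "distr config_space \<nu> (pick (under g)) = density \<nu> g"
proof (rule measure_eqI)
  interpret G: prob_space "density \<nu> g" using g by (rule prob_space_density)
  have [measurable]: "pick (under g) \<in> measurable config_space \<nu>"
    using g by (intro measurable_pick under_sets) (auto simp: prob_density_def)
  fix C assume "C \<in> sets (distr config_space \<nu> (pick (under g)))"
  then have C: "C \<in> sets \<nu>" by simp
  have "emeasure (distr config_space \<nu> (pick (under g))) C =
      emeasure config_space {\<omega> \<in> space config_space. pick (under g) \<omega> \<in> C}"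
    using C by (subst emeasure_distr) (auto intro!: arg_cong[where f="emeasure _"])
  also have "\<dots> = ennreal (vol (under g \<inter> C \<times> UNIV))"
    using prob_pick[OF region_under[OF g] vol_under[OF g] C] by (simp add: config.emeasure_eq_measure)
  finally show "emeasure (distr config_space \<nu> (pick (under g))) C = emeasure (density \<nu> g) C"
    by (simp add: vol_under_cyl[OF g C] G.emeasure_eq_measure)
qed simp

lemma integrable_prob_density: "prob_density g \<Longrightarrow> integrable \<nu> g"
  unfolding prob_density_def by (intro integrableI_nonneg) auto

lemma integral_prob_density: "prob_density g \<Longrightarrow> (\<integral>x. g x \<partial>\<nu>) = 1"
  using nn_integral_eq_integral[OF integrable_prob_density, of g]
  by (auto simp: prob_density_def)

lemma integrable_min:
  assumes "prob_density g" "prob_density h"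
  shows "integrable \<nu> (\<lambda>x. min (g x) (h x))"
  using assms by (intro integrable_min integrable_prob_density)

lemma vol_under_Int:
  assumes g: "prob_density g" and h: "prob_density h"
  shows "vol (under g \<inter> under h) = (\<integral>x. min (g x) (h x) \<partial>\<nu>)"
proof -
  have [measurable]: "g \<in> borel_measurable \<nu>" "h \<in> borel_measurable \<nu>"
    using g h by (auto simp: prob_density_def)
  have nn: "0 \<le> min (g x) (h x)" if "x \<in> space \<nu>" for x
    using g h that by (auto simp: prob_density_def)
  have "emeasure plane (under g \<inter> under h) = (\<integral>\<^sup>+x. ennreal (min (g x) (h x)) \<partial>\<nu>)"
    using emeasure_under_cyl[of "\<lambda>x. min (g x) (h x)" "space \<nu>"] nn
    by (simp add: under_cyl_space under_Int emeasure_density cong: nn_integral_cong)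
  also have "\<dots> = ennreal (\<integral>x. min (g x) (h x) \<partial>\<nu>)"
    using nn by (intro nn_integral_eq_integral integrable_min g h) auto
  finally show ?thesis
    using nn by (simp add: vol_def measure_def integral_nonneg_AE)
qed

text \<open>Inclusion-exclusion for two regions of volume 1. As the integral of the minimum is
  \<open>1 - d\<close>, this volume is the \<open>1 + d\<close> of the final formula.\<close>

lemma vol_under_Un:
  assumes g: "prob_density g" and h: "prob_density h"
  shows "vol (under g \<union> under h) = 2 - (\<integral>x. min (g x) (h x) \<partial>\<nu>)"
proof -
  have [measurable]: "under g \<in> sets plane" "under h \<in> sets plane"
    using g h by (auto simp: prob_density_def)
  have r: "region (under h - under g)" "region (under g \<inter> under h)"
    using region_under[OF h] by (auto intro: region_subset)
  have "vol (under g \<union> (under h - under g)) = vol (under g) + vol (under h - under g)"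
    by (rule vol_Un[OF region_under[OF g] r(1)]) auto
  moreover have "vol (under g \<inter> under h \<union> (under h - under g)) =
      vol (under g \<inter> under h) + vol (under h - under g)"
    by (rule vol_Un[OF r(2,1)]) auto
  moreover have "under g \<inter> under h \<union> (under h - under g) = under h" by auto
  ultimately show ?thesis
    using vol_under[OF g] vol_under[OF h] vol_under_Int[OF g h] by simp
qed

section \<open>Coincidences at atoms, and the total variation distance\<close>

definition atoms :: "'a set" where
  "atoms = {x \<in> space \<nu>. measure \<nu> {x} \<noteq> 0}"

lemma countable_atoms: "countable atoms"
  using countable_support by (rule countable_subset[rotated]) (auto simp: atoms_def)

lemma measure_density_singleton:
  assumes g: "prob_density g" and x: "{x} \<in> sets \<nu>"
  shows "measure (density \<nu> g) {x} = g x * measure \<nu> {x}"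
proof -
  have "x \<in> space \<nu>" using sets.sets_into_space[OF x] by auto
  then have "emeasure (density \<nu> g) {x} = ennreal (g x * measure \<nu> {x})"
    using g x by (simp add: emeasure_density prob_density_def nn_integral_indicator_singleton
        emeasure_eq_measure ennreal_mult)
  then show ?thesis
    using g \<open>x \<in> space \<nu>\<close> by (simp add: measure_def prob_density_def)
qed

text \<open>The minimum times \<open>measure \<nu> {x}\<close> is the volume over \<open>x\<close>
  below the lower graph, and the absolute difference is the volume over \<open>x\<close> between the
  graphs: the two winning pieces of the double race.\<close>

lemma prob_meet_at_atom:
  assumes g: "prob_density g" and h: "prob_density h" and x: "{x} \<in> sets \<nu>"
  shows "measure config_space {\<omega> \<in> space config_space.
      first (under g) \<omega> \<noteq> first (under h) \<omega> \<and> pick (under g) \<omega> = x \<and> pick (under h) \<omega> = x} =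
    min (g x) (h x) * measure \<nu> {x} *
      \<bar>measure (density \<nu> g) {x} - measure (density \<nu> h) {x}\<bar> / vol (under g \<union> under h)"
proof -
  \<comment> \<open>The densities are bound anew here, so that the case \<open>g x \<le> h x\<close>
    follows by exchanging their roles.\<close>
  have *: "measure config_space {\<omega> \<in> space config_space.
      first (under g) \<omega> \<noteq> first (under h) \<omega> \<and> pick (under g) \<omega> = x \<and> pick (under h) \<omega> = x} =
    measure (density \<nu> h) {x} * (measure (density \<nu> g) {x} - measure (density \<nu> h) {x}) /
      vol (under g \<union> under h)"
    if g: "prob_density g" and h: "prob_density h" and le: "h x \<le> g x" for g h
  proof -
    have [measurable]: "under g \<in> sets plane" "under h \<in> sets plane" "{x} \<in> sets \<nu>"
      using g h x by (auto simp: prob_density_def)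
    have sub: "under h \<inter> {x} \<times> UNIV \<subseteq> under g"
      using le by (auto simp: under_def)
    have r: "region (under h \<inter> {x} \<times> UNIV)" "region ((under g - under h) \<inter> {x} \<times> UNIV)"
      using region_under[OF h] region_under[OF g] by (auto intro: region_subset)
    have "under h \<inter> {x} \<times> UNIV \<union> (under g - under h) \<inter> {x} \<times> UNIV = under g \<inter> {x} \<times> UNIV"
      using sub by auto
    then have "vol (under g \<inter> {x} \<times> UNIV) =
        vol (under h \<inter> {x} \<times> UNIV) + vol ((under g - under h) \<inter> {x} \<times> UNIV)"
      using vol_Un[OF r] by (simp add: Int_commute Int_left_commute Diff_Int_distrib)
    then show ?thesis
      using prob_meet_at[OF region_under[OF g] vol_under[OF g] region_under[OF h] vol_under[OF h] x sub]
      by (simp add: vol_under_cyl g h x)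
  qed
  have nn: "0 \<le> g x" "0 \<le> h x"
    using g h sets.sets_into_space[OF x] by (auto simp: prob_density_def)
  show ?thesis
  proof (cases "h x \<le> g x")
    case True
    then have "h x * measure \<nu> {x} \<le> g x * measure \<nu> {x}" by (intro mult_right_mono) auto
    then show ?thesis using *[OF g h True] True
      by (simp add: measure_density_singleton g h x)
  next
    case False
    then have le: "g x \<le> h x" by simp
    then have "g x * measure \<nu> {x} \<le> h x * measure \<nu> {x}" by (intro mult_right_mono) auto
    moreover have "{\<omega> \<in> space config_space. first (under h) \<omega> \<noteq> first (under g) \<omega> \<and>
          pick (under h) \<omega> = x \<and> pick (under g) \<omega> = x} =
        {\<omega> \<in> space config_space. first (under g) \<omega> \<noteq> first (under h) \<omega> \<and>
          pick (under g) \<omega> = x \<and> pick (under h) \<omega> = x}"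
      by auto
    ultimately show ?thesis using *[OF h g le] le
      by (simp add: measure_density_singleton g h x Un_commute[of "under h"])
  qed
qed


text \<open>The function differs from 0 only on the countable set of atoms, whose singletons are
  measurable.\<close>

lemma measurable_point_mass:
  assumes x: "\<And>x. x \<in> space \<nu> \<Longrightarrow> {x} \<in> sets \<nu>"
  shows "(\<lambda>x. measure \<nu> {x}) \<in> borel_measurable \<nu>"
proof (rule measurable_discrete_difference[where f="\<lambda>_. 0" and X=atoms])
  show "\<And>y. y \<in> atoms \<Longrightarrow> {y} \<in> sets \<nu>" using x by (auto simp: atoms_def)
qed (auto simp: countable_atoms, auto simp: atoms_def)

text \<open>The integrand of the correction term, with \<open>\<nu>\<close> as the reference
  measure. Its product with the mass of \<open>x\<close>, divided by the volume of the union, is the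
  probability that distinct earliest points meet at \<open>x\<close>.\<close>

definition overlap :: "('a \<Rightarrow> real) \<Rightarrow> ('a \<Rightarrow> real) \<Rightarrow> 'a \<Rightarrow> real" where
  "overlap g h x = min (g x) (h x) * \<bar>measure (density \<nu> g) {x} - measure (density \<nu> h) {x}\<bar>"

lemma overlap_props:
  assumes g: "prob_density g" and h: "prob_density h"
    and x: "\<And>x. x \<in> space \<nu> \<Longrightarrow> {x} \<in> sets \<nu>"
  shows borel_measurable_overlap: "overlap g h \<in> borel_measurable \<nu>"
    and overlap_nonneg: "\<And>x. x \<in> space \<nu> \<Longrightarrow> 0 \<le> overlap g h x"
    and overlap_outside: "\<And>x. x \<in> space \<nu> - atoms \<Longrightarrow> overlap g h x = 0"
    and integrable_overlap: "integrable \<nu> (overlap g h)"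
proof -
  interpret G: prob_space "density \<nu> g" using g by (rule prob_space_density)
  interpret H: prob_space "density \<nu> h" using h by (rule prob_space_density)
  note [measurable] = measurable_point_mass[OF x]
  have [measurable]: "g \<in> borel_measurable \<nu>" "h \<in> borel_measurable \<nu>"
    and nn: "\<And>x. x \<in> space \<nu> \<Longrightarrow> 0 \<le> g x \<and> 0 \<le> h x"
    using g h by (auto simp: prob_density_def)
  have eq: "overlap g h x = min (g x) (h x) * \<bar>g x * measure \<nu> {x} - h x * measure \<nu> {x}\<bar>"
    if "x \<in> space \<nu>" for x
    using measure_density_singleton[OF g x[OF that]] measure_density_singleton[OF h x[OF that]]
    by (simp add: overlap_def)
  have "(\<lambda>x. min (g x) (h x) * \<bar>g x * measure \<nu> {x} - h x * measure \<nu> {x}\<bar>) \<in> borel_measurable \<nu>"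
    by measurable
  then show m [measurable]: "overlap g h \<in> borel_measurable \<nu>"
    by (subst measurable_cong[OF eq])
  show nonneg: "0 \<le> overlap g h x" if "x \<in> space \<nu>" for x
    using nn[OF that] by (simp add: overlap_def)
  show "overlap g h x = 0" if "x \<in> space \<nu> - atoms" for x
    using that by (simp add: eq atoms_def)
  show "integrable \<nu> (overlap g h)"
  proof (rule Bochner_Integration.integrable_bound[OF integrable_prob_density[OF g] m])
    show "AE x in \<nu>. norm (overlap g h x) \<le> norm (g x)"
    proof (rule AE_I2)
      fix x assume x: "x \<in> space \<nu>"
      have "\<bar>measure (density \<nu> g) {x} - measure (density \<nu> h) {x}\<bar> \<le> 1"
        using G.prob_le_1[of "{x}"] H.prob_le_1[of "{x}"]
          measure_nonneg[of "density \<nu> g" "{x}"] measure_nonneg[of "density \<nu> h" "{x}"] by linarith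
      then have "overlap g h x \<le> g x * 1"
        unfolding overlap_def using nn[OF x] by (intro mult_mono) auto
      then show "norm (overlap g h x) \<le> norm (g x)"
        using nonneg[OF x] nn[OF x] by simp
    qed
  qed
qed

text \<open>The part of the coincidence event that is certainly measurable. Its remainder consists
  of distinct earliest points that share a position outside \<open>atoms\<close>.\<close>

definition agree :: "('a \<Rightarrow> real) \<Rightarrow> ('a \<Rightarrow> real) \<Rightarrow> 'a config set" where
  "agree g h = {\<omega> \<in> space config_space. first (under g) \<omega> = first (under h) \<omega> \<or>
     pick (under g) \<omega> = pick (under h) \<omega> \<and> pick (under g) \<omega> \<in> atoms}"

text \<open>The event splits into a common earliest point and, disjointly for each of the countably
  many atoms, distinct earliest points meeting there.\<close>

lemma
  assumes g: "prob_density g" and h: "prob_density h"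
    and x: "\<And>x. x \<in> space \<nu> \<Longrightarrow> {x} \<in> sets \<nu>"
  shows agree_sets: "agree g h \<in> sets config_space"
    and measure_agree: "measure config_space (agree g h) =
      ((\<integral>x. min (g x) (h x) \<partial>\<nu>) + (\<integral>x. overlap g h x \<partial>\<nu>)) /
        (2 - (\<integral>x. min (g x) (h x) \<partial>\<nu>))"
proof -
  let ?m = "\<integral>x. min (g x) (h x) \<partial>\<nu>"
  let ?V = "vol (under g \<union> under h)"
  let ?S = "{\<omega> \<in> space config_space. first (under g) \<omega> = first (under h) \<omega>}"
  let ?E = "\<lambda>x. {\<omega> \<in> space config_space.
      first (under g) \<omega> \<noteq> first (under h) \<omega> \<and> pick (under g) \<omega> = x \<and> pick (under h) \<omega> = x}"
  have us: "under g \<in> sets plane" "under h \<in> sets plane"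
    using g h by (auto simp: prob_density_def)
  have [measurable]: "first (under g) \<in> measurable config_space (count_space UNIV)"
    "first (under h) \<in> measurable config_space (count_space UNIV)"
    "pick (under g) \<in> measurable config_space \<nu>" "pick (under h) \<in> measurable config_space \<nu>"
    using us by (auto intro: measurable_first measurable_pick)
  have S: "?S \<in> sets config_space" by measurable
  have E: "?E x \<in> sets config_space" if "x \<in> atoms" for x
  proof -
    have [measurable]: "{x} \<in> sets \<nu>" using that x by (auto simp: atoms_def)
    have "{\<omega> \<in> space config_space. first (under g) \<omega> \<noteq> first (under h) \<omega> \<and>
        pick (under g) \<omega> \<in> {x} \<and> pick (under h) \<omega> \<in> {x}} \<in> sets config_space"
      by measurable
    then show ?thesis by simp
  qed
  have U: "(\<Union>x\<in>atoms. ?E x) \<in> sets config_space"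
    using E countable_atoms by (intro sets.countable_UN'') auto
  have agree_eq: "agree g h = ?S \<union> (\<Union>x\<in>atoms. ?E x)"
    by (auto simp: agree_def)
  show "agree g h \<in> sets config_space"
    unfolding agree_eq using S U by (rule sets.Un)
  have V: "?V = 2 - ?m" by (rule vol_under_Un[OF g h])
  have Vpos: "0 < ?V"
  proof -
    have "?m \<le> (\<integral>x. g x \<partial>\<nu>)"
      using integrable_min[OF g h] integrable_prob_density[OF g] by (intro integral_mono) auto
    then show ?thesis using V integral_prob_density[OF g] by simp
  qed
  have atom_sets: "{y} \<in> sets \<nu>" if "y \<in> atoms" for y
    using x[of y] that by (simp add: atoms_def)
  define f where "f x = overlap g h x / ?V" for x
  have f_meas: "(\<lambda>x. ennreal (f x)) \<in> borel_measurable \<nu>"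
    unfolding f_def
    by (intro measurable_compose[OF _ measurable_ennreal] borel_measurable_divide
        borel_measurable_overlap[OF g h x] borel_measurable_const)
  have f_nn: "0 \<le> f y" if "y \<in> space \<nu>" for y
    unfolding f_def using overlap_nonneg[OF g h x that] Vpos by (rule divide_nonneg_pos)
  have "emeasure config_space (\<Union>x\<in>atoms. ?E x) =
      (\<integral>\<^sup>+x. emeasure config_space (?E x) \<partial>count_space atoms)"
  proof (rule emeasure_UN_countable[OF E countable_atoms])
    show "disjoint_family_on ?E atoms" unfolding disjoint_family_on_def by blast
  qed
  \<comment> \<open>The probability of meeting at \<open>y\<close> is the mass of \<open>{y}\<close>
    for the density \<open>f\<close>. The sum over the atoms is thus the mass of
    \<open>atoms\<close>, and since \<open>overlap\<close> vanishes elsewhere, the integral may run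
    over the whole space.\<close>
  also have "\<dots> = (\<integral>\<^sup>+y. emeasure (density \<nu> (\<lambda>x. ennreal (f x))) {y} \<partial>count_space atoms)"
  proof (intro nn_integral_cong)
    fix y assume "y \<in> space (count_space atoms)"
    then have y: "y \<in> space \<nu>" "{y} \<in> sets \<nu>" using x by (auto simp: atoms_def)
    have "emeasure config_space (?E y) = ennreal (f y * measure \<nu> {y})"
      unfolding config.emeasure_eq_measure prob_meet_at_atom[OF g h y(2)] overlap_def f_def
      by (intro arg_cong[where f=ennreal]) simp
    also have "\<dots> = ennreal (f y) * emeasure \<nu> {y}"
      unfolding emeasure_eq_measure by (intro ennreal_mult f_nn y measure_nonneg)
    also have "\<dots> = emeasure (density \<nu> (\<lambda>x. ennreal (f x))) {y}"
      unfolding emeasure_density[OF f_meas y(2)]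
      by (rule nn_integral_indicator_singleton[OF y(2), of "\<lambda>x. ennreal (f x)", symmetric])
    finally show "emeasure config_space (?E y) = emeasure (density \<nu> (\<lambda>x. ennreal (f x))) {y}" .
  qed
  also have "\<dots> = emeasure (density \<nu> (\<lambda>x. ennreal (f x))) atoms"
    by (rule emeasure_countable_singleton[symmetric]) (simp_all add: atom_sets countable_atoms)
  also have "\<dots> = (\<integral>\<^sup>+x. ennreal (f x) * indicator atoms x \<partial>\<nu>)"
    by (rule emeasure_density[OF f_meas sets.countable[OF atom_sets countable_atoms]])
  also have "\<dots> = (\<integral>\<^sup>+x. ennreal (f x) \<partial>\<nu>)"
  proof (rule nn_integral_cong)
    show "ennreal (f y) * indicator atoms y = ennreal (f y)" if "y \<in> space \<nu>" for y
      using overlap_outside[OF g h x, of y] that by (cases "y \<in> atoms") (simp_all add: f_def)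
  qed
  also have "\<dots> = ennreal (\<integral>x. f x \<partial>\<nu>)"
    using f_nn integrable_overlap[OF g h x]
    by (intro nn_integral_eq_integral AE_I2) (auto simp: f_def)
  also have "(\<integral>x. f x \<partial>\<nu>) = (\<integral>x. overlap g h x \<partial>\<nu>) / ?V"
    by (simp add: f_def)
  finally have "measure config_space (\<Union>x\<in>atoms. ?E x) = (\<integral>x. overlap g h x \<partial>\<nu>) / ?V"
    using overlap_nonneg[OF g h x] Vpos
    by (simp add: measure_def integral_nonneg_AE[OF AE_I2] divide_nonneg_pos)
  moreover have "measure config_space (agree g h) =
      measure config_space ?S + measure config_space (\<Union>x\<in>atoms. ?E x)"
    unfolding agree_eq by (intro config.finite_measure_Union S U) auto
  moreover have "measure config_space ?S = ?m / ?V"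
    using prob_same_first[OF region_under[OF g] _ region_under[OF h]]
    by (simp add: vol_under g h vol_under_Int)
  ultimately show "measure config_space (agree g h) =
      (?m + (\<integral>x. overlap g h x \<partial>\<nu>)) / (2 - ?m)"
    by (simp add: V add_divide_distrib)
qed

text \<open>Scheffe's identity: the supremum is attained on the set where \<open>h < g\<close>,
  because \<open>g - min g h\<close> equals \<open>g - h\<close> there and 0 elsewhere.\<close>

lemma SUP_abs_diff_density:
  assumes g: "prob_density g" and h: "prob_density h"
  shows "(SUP A\<in>sets \<nu>. \<bar>measure (density \<nu> g) A - measure (density \<nu> h) A\<bar>) =
    1 - (\<integral>x. min (g x) (h x) \<partial>\<nu>)"
proof (rule cSup_eq_maximum)
  let ?m = "\<integral>x. min (g x) (h x) \<partial>\<nu>"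
  have [measurable]: "g \<in> borel_measurable \<nu>" "h \<in> borel_measurable \<nu>"
    using g h by (auto simp: prob_density_def)
  have m: "measure (density \<nu> g) A = (\<integral>x. g x * indicator A x \<partial>\<nu>)"
    if "prob_density g" "A \<in> sets \<nu>" for g A
  proof -
    have "emeasure (density \<nu> g) A = (\<integral>\<^sup>+x. ennreal (g x * indicator A x) \<partial>\<nu>)"
      using that by (auto simp: emeasure_density prob_density_def ennreal_mult' ennreal_indicator
          intro!: nn_integral_cong)
    also have "\<dots> = ennreal (\<integral>x. g x * indicator A x \<partial>\<nu>)"
      using that integrable_prob_density[OF that(1)]
      by (intro nn_integral_eq_integral integrable_real_mult_indicator) (auto simp: prob_density_def)
    finally show ?thesis
      using that by (auto simp: measure_def prob_density_def intro!: integral_nonneg_AE AE_I2)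
  qed
  have i: "integrable \<nu> (\<lambda>x. g x * indicator A x)" if "prob_density g" "A \<in> sets \<nu>" for g A
    using that by (intro integrable_real_mult_indicator integrable_prob_density)
  have le: "measure (density \<nu> g) A - measure (density \<nu> h) A \<le> 1 - (\<integral>x. min (g x) (h x) \<partial>\<nu>)"
    if g: "prob_density g" and h: "prob_density h" and A: "A \<in> sets \<nu>" for g h A
  proof -
    have "measure (density \<nu> g) A - measure (density \<nu> h) A =
        (\<integral>x. g x * indicator A x - h x * indicator A x \<partial>\<nu>)"
      by (simp add: m g h A i)
    also have "\<dots> \<le> (\<integral>x. g x - min (g x) (h x) \<partial>\<nu>)"
      by (intro integral_mono Bochner_Integration.integrable_diff i g h A integrable_min
          integrable_prob_density) (auto simp: indicator_def)
    also have "\<dots> = 1 - (\<integral>x. min (g x) (h x) \<partial>\<nu>)"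
      by (simp add: integrable_min integrable_prob_density integral_prob_density g h)
    finally show ?thesis .
  qed
  show "y \<le> 1 - ?m"
    if y: "y \<in> (\<lambda>A. \<bar>measure (density \<nu> g) A - measure (density \<nu> h) A\<bar>) ` sets \<nu>" for y
  proof -
    from y obtain A where A: "A \<in> sets \<nu>"
      "y = \<bar>measure (density \<nu> g) A - measure (density \<nu> h) A\<bar>" by auto
    show ?thesis using le[OF g h A(1)] le[OF h g A(1)] A(2) by (simp add: min.commute)
  qed
  let ?A = "{x \<in> space \<nu>. h x < g x}"
  have A: "?A \<in> sets \<nu>" by measurable
  have "measure (density \<nu> g) ?A - measure (density \<nu> h) ?A =
      (\<integral>x. g x * indicator ?A x - h x * indicator ?A x \<partial>\<nu>)"
    by (simp only: m g h A i Bochner_Integration.integral_diff)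
  also have "\<dots> = (\<integral>x. g x - min (g x) (h x) \<partial>\<nu>)"
    by (intro Bochner_Integration.integral_cong) (auto simp: indicator_def)
  also have "\<dots> = 1 - ?m"
    by (simp add: integrable_min integrable_prob_density integral_prob_density g h)
  finally have eq: "measure (density \<nu> g) ?A - measure (density \<nu> h) ?A = 1 - ?m" .
  moreover have "0 \<le> 1 - ?m" using le[OF g h, of "{}"] by simp
  ultimately show "1 - ?m \<in> (\<lambda>A. \<bar>measure (density \<nu> g) A - measure (density \<nu> h) A\<bar>) ` sets \<nu>"
    using A by (intro image_eqI[of _ _ ?A]) auto
qed

end

section \<open>Removing coincidences of positions\<close>

text \<open>Extension of a measure by a set \<open>D\<close> of inner measure 0. Sets are measured
  by a representative in \<open>sets M\<close> that agrees with them off \<open>D\<close>; two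
  representatives differ by events inside \<open>D\<close>, which are null, so the value is well
  defined. All subsets of \<open>D\<close> become measurable at the same time.\<close>

lemma (in prob_space) extend_inner_null:
  assumes D: "D \<subseteq> space M" and null: "\<And>E. E \<in> sets M \<Longrightarrow> E \<subseteq> D \<Longrightarrow> emeasure M E = 0"
  obtains N where "prob_space N" "space N = space M" "sets M \<subseteq> sets N"
    "\<And>E. E \<in> sets M \<Longrightarrow> emeasure N E = emeasure M E"
    "\<And>S. S \<subseteq> D \<Longrightarrow> S \<in> sets N" "emeasure N D = 0"
proof -
  define \<A> where "\<A> = {S. S \<subseteq> space M \<and> (\<exists>E\<in>sets M. S - D = E - D)}"
  define rep where "rep S = (SOME E. E \<in> sets M \<and> S - D = E - D)" for S
  have rep: "rep S \<in> sets M" "S - D = rep S - D" if "S \<in> \<A>" for S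
    using someI_ex[of "\<lambda>E. E \<in> sets M \<and> S - D = E - D"] that by (auto simp: \<A>_def rep_def)
  have wd: "emeasure M E = emeasure M E'" if E: "E \<in> sets M" "E' \<in> sets M" "E - D = E' - D" for E E'
  proof (rule emeasure_eq_AE)
    have "E - E' \<subseteq> D" "E' - E \<subseteq> D" using E(3) by blast+
    then have "emeasure M (E - E') = 0" "emeasure M (E' - E) = 0"
      using E(1,2) by (simp_all add: null sets.Diff)
    then have "E - E' \<in> null_sets M" "E' - E \<in> null_sets M"
      using E by (auto intro!: null_setsI)
    from this[THEN AE_not_in] show "AE x in M. x \<in> E \<longleftrightarrow> x \<in> E'"
      by eventually_elim blast
  qed (rule E)+
  have rep_eq: "emeasure M (rep S) = emeasure M E" if "S \<in> \<A>" "E \<in> sets M" "S - D = E - D" for S E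
    by (rule wd[OF rep(1)[OF that(1)] that(2)]) (simp only: rep(2)[OF that(1), symmetric] that(3))
  have sub: "\<A> \<subseteq> Pow (space M)" by (auto simp: \<A>_def)
  have sa: "sigma_algebra (space M) \<A>"
    unfolding sigma_algebra_iff2
  proof (intro conjI ballI allI impI sub)
    show "{} \<in> \<A>" unfolding \<A>_def by (auto intro!: bexI[of _ "{}"])
    show "space M - S \<in> \<A>" if S: "S \<in> \<A>" for S
    proof -
      have "(space M - S) - D = (space M - rep S) - D" using rep(2)[OF S] by blast
      moreover have "space M - rep S \<in> sets M" using rep(1)[OF S] by (rule sets.compl_sets)
      ultimately show ?thesis unfolding \<A>_def by blast
    qed
    fix S :: "nat \<Rightarrow> 'a set" assume S: "range S \<subseteq> \<A>"
    then have SA: "S n \<in> \<A>" for n by blast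
    have "(\<Union>n. S n) - D = (\<Union>n. S n - D)" by blast
    also have "\<dots> = (\<Union>n. rep (S n) - D)" using rep(2)[OF SA] by simp
    also have "\<dots> = (\<Union>n. rep (S n)) - D" by blast
    finally have "(\<Union>n. S n) - D = (\<Union>n. rep (S n)) - D" .
    moreover have "(\<Union>n. rep (S n)) \<in> sets M" using rep(1)[OF SA] by (intro sets.countable_UN) blast
    moreover have "(\<Union>n. S n) \<subseteq> space M" using SA sub by blast
    ultimately show "(\<Union>n. S n) \<in> \<A>" unfolding \<A>_def by blast
  qed
  define N where "N = measure_of (space M) \<A> (\<lambda>S. emeasure M (rep S))"
  have ca: "countably_additive \<A> (\<lambda>S. emeasure M (rep S))"
  proof (rule countably_additiveI)
    fix S :: "nat \<Rightarrow> 'a set" assume S: "range S \<subseteq> \<A>" "disjoint_family S" "(\<Union>n. S n) \<in> \<A>"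
    \<comment> \<open>Representatives of disjoint sets may overlap, but only inside
      \<open>D\<close>. Making them disjoint changes nothing off \<open>D\<close>, so they remain
      representatives and the additivity of \<open>M\<close> applies.\<close>
    let ?E = "disjointed (\<lambda>n. rep (S n))"
    have SA: "S n \<in> \<A>" for n using S(1) by blast
    have Eset: "?E n \<in> sets M" for n
      unfolding disjointed_def using rep(1)[OF SA] by (intro sets.Diff sets.finite_UN) auto
    have eq: "S n - D = ?E n - D" for n
    proof -
      have "(rep (S n) - D) \<inter> rep (S m) = {}" if "m < n" for m
      proof -
        have "S n \<inter> S m = {}" using S(2) that by (auto simp: disjoint_family_on_def)
        then have "(S n - D) \<inter> (S m - D) = {}" by blast
        then show ?thesis unfolding rep(2)[OF SA] by blast
      qed
      then have "(rep (S n) - D) \<inter> (\<Union>m\<in>{0..<n}. rep (S m)) = {}" by fastforce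
      then show ?thesis unfolding disjointed_def rep(2)[OF SA, of n] by blast
    qed
    have "(\<Sum>n. emeasure M (rep (S n))) = (\<Sum>n. emeasure M (?E n))"
      using rep_eq[OF SA Eset eq] by simp
    also have "\<dots> = emeasure M (\<Union>n. ?E n)"
    proof (rule suminf_emeasure)
      show "range ?E \<subseteq> sets M" using Eset by blast
    qed (rule disjoint_family_disjointed)
    also have "\<dots> = emeasure M (rep (\<Union>n. S n))"
    proof (rule rep_eq[OF S(3), symmetric])
      show "(\<Union>n. ?E n) \<in> sets M" using Eset by (intro sets.countable_UN) blast
      have "(\<Union>n. S n) - D = (\<Union>n. S n - D)" by blast
      also have "\<dots> = (\<Union>n. ?E n - D)" using eq by simp
      also have "\<dots> = (\<Union>n. ?E n) - D" by blast
      finally show "(\<Union>n. S n) - D = (\<Union>n. ?E n) - D" .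
    qed
    finally show "(\<Sum>n. emeasure M (rep (S n))) = emeasure M (rep (\<Union>n. S n))" .
  qed
  have emp: "{} \<in> \<A>" unfolding \<A>_def by (auto intro!: bexI[of _ "{}"])
  have pos: "positive \<A> (\<lambda>S. emeasure M (rep S))"
    using rep_eq[OF emp, of "{}"] by (simp add: positive_def)
  have sets_N: "sets N = \<A>"
    unfolding N_def using sa sub by (simp add: sigma_algebra.sigma_sets_eq)
  have space_N: "space N = space M"
    unfolding N_def by (rule space_measure_of[OF sub])
  have em: "emeasure N S = emeasure M (rep S)" if "S \<in> \<A>" for S
    unfolding N_def by (rule emeasure_measure_of_sigma[OF sa pos ca that])
  have M_sub: "sets M \<subseteq> \<A>" by (auto simp: \<A>_def dest: sets.sets_into_space)
  have eq: "emeasure N E = emeasure M E" if "E \<in> sets M" for E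
  proof -
    have "E \<in> \<A>" using that M_sub by blast
    then show ?thesis using rep_eq[of E E] that by (simp add: em)
  qed
  have D_sub: "S \<in> \<A>" if "S \<subseteq> D" for S
    using that D by (auto simp: \<A>_def intro!: bexI[of _ "{}"])
  show ?thesis
  proof (rule that[of N])
    show "prob_space N"
      by (rule prob_spaceI) (simp add: space_N eq emeasure_space_1)
    show "emeasure N D = 0"
      using rep_eq[OF D_sub, of D "{}"] D_sub[of D] by (simp add: em)
  qed (use sets_N space_N M_sub eq D_sub in auto)
qed

text \<open>Moves the family to the space of functions, where the coupled variables become
  coordinate maps. The product sigma-algebra could be too small for the events
  \<open>\<phi> i \<noteq> \<phi> j\<close>; the image measure is therefore taken on the largest
  sigma-algebra for which the map \<open>f\<close> is measurable.\<close>

lemma (in prob_space) push_to_functions: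
  fixes Y :: "'i \<Rightarrow> 'a \<Rightarrow> 'c"
  assumes Y: "\<And>i. i \<in> I \<Longrightarrow> Y i \<in> measurable M K"
    and neq: "\<And>i j. i \<in> I \<Longrightarrow> j \<in> I \<Longrightarrow> {\<omega> \<in> space M. Y i \<omega> \<noteq> Y j \<omega>} \<in> sets M"
  obtains P :: "('i \<Rightarrow> 'c) measure" where "prob_space P"
    "\<And>i. i \<in> I \<Longrightarrow> (\<lambda>\<phi>. \<phi> i) \<in> measurable P K"
    "\<And>i. i \<in> I \<Longrightarrow> distr P K (\<lambda>\<phi>. \<phi> i) = distr M K (Y i)"
    "\<And>i j. i \<in> I \<Longrightarrow> j \<in> I \<Longrightarrow> {\<phi> \<in> space P. \<phi> i \<noteq> \<phi> j} \<in> sets P"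
    "\<And>i j. i \<in> I \<Longrightarrow> j \<in> I \<Longrightarrow> \<P>(\<phi> in P. \<phi> i \<noteq> \<phi> j) = \<P>(\<omega> in M. Y i \<omega> \<noteq> Y j \<omega>)"
proof -
  define f where "f \<omega> = (\<lambda>i. Y i \<omega>)" for \<omega>
  define \<Omega> where "\<Omega> = {\<phi>. \<forall>i\<in>I. \<phi> i \<in> space K}"
  \<comment> \<open>\<open>G\<close> contains every set with measurable preimage, so an event
    concerning the \<open>Y i\<close> passes to the functions as soon as it is measurable in
    \<open>M\<close>.\<close>
  define G where "G = {B. B \<subseteq> \<Omega> \<and> f -` B \<inter> space M \<in> sets M}"
  define P where "P = distr M (sigma \<Omega> G) f"
  have G: "G \<subseteq> Pow \<Omega>" by (auto simp: G_def)
  have f_space: "f \<omega> \<in> \<Omega>" if "\<omega> \<in> space M" for \<omega>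
    using measurable_space[OF Y that] by (auto simp: \<Omega>_def f_def)
  have f [measurable]: "f \<in> measurable M (sigma \<Omega> G)"
    using G by (intro measurable_measure_of) (auto simp: G_def f_space)
  have sp: "space P = \<Omega>" using G by (simp add: P_def)
  have setsP: "B \<in> sets P" if "B \<in> G" for B
    using that G by (auto simp: P_def)
  have coord: "(\<lambda>\<phi>. \<phi> i) \<in> measurable P K" if i: "i \<in> I" for i
  proof (rule measurableI)
    show "\<phi> i \<in> space K" if "\<phi> \<in> space P" for \<phi> using that i by (simp add: sp \<Omega>_def)
    fix A assume A: "A \<in> sets K"
    have "f -` ((\<lambda>\<phi>. \<phi> i) -` A \<inter> \<Omega>) \<inter> space M = Y i -` A \<inter> space M"
      using f_space by (auto simp: f_def)
    then show "(\<lambda>\<phi>. \<phi> i) -` A \<inter> space P \<in> sets P"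
      using measurable_sets[OF Y[OF i] A] by (intro setsP) (auto simp: G_def sp)
  qed
  have pre: "f -` {\<phi> \<in> \<Omega>. \<phi> i \<noteq> \<phi> j} \<inter> space M = {\<omega> \<in> space M. Y i \<omega> \<noteq> Y j \<omega>}" for i j
    using f_space by (auto simp: f_def)
  have neqP: "{\<phi> \<in> space P. \<phi> i \<noteq> \<phi> j} \<in> sets P" if "i \<in> I" "j \<in> I" for i j
    using neq[OF that] pre[of i j] by (intro setsP) (auto simp: G_def sp)
  show ?thesis
  proof (rule that[of P])
    show "prob_space P" unfolding P_def by (rule prob_space_distr) simp
    show "distr P K (\<lambda>\<phi>. \<phi> i) = distr M K (Y i)" if "i \<in> I" for i
      using coord[OF that] f unfolding P_def by (subst distr_distr) (auto simp: o_def f_def)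
    show "\<P>(\<phi> in P. \<phi> i \<noteq> \<phi> j) = \<P>(\<omega> in M. Y i \<omega> \<noteq> Y j \<omega>)" if "i \<in> I" "j \<in> I" for i j
      using neqP[OF that] f pre[of i j] unfolding P_def
      by (subst measure_distr) (auto simp: space_measure_of[OF G])
  qed (use coord neqP in auto)
qed

section \<open>Positions of two points, and what an event can see of them\<close>

context poisson_race
begin

definition pos :: "nat \<times> nat \<Rightarrow> 'a config \<Rightarrow> 'a" where
  "pos k \<omega> = fst (loc k \<omega>)"

lemma measurable_pos [measurable]: "pos k \<in> measurable config_space \<nu>"
  using measurable_loc[of k] unfolding plane_def pos_def by (rule measurable_compose[OF _ measurable_fst])

lemma emeasure_mark_law_pos:
  assumes A: "A \<in> sets \<nu>"
  shows "emeasure (mark_law c) ((A \<times> UNIV) \<times> UNIV) = emeasure \<nu> A"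
proof -
  obtain a b where ab: "prod_decode c = (a, b)" by fastforce
  have "(A \<times> UNIV) \<times> UNIV \<in> sets (plane \<Otimes>\<^sub>M lborel)"
    using A by (intro pair_measureI cyl_sets) auto
  then have "emeasure (mark_law c) ((A \<times> UNIV) \<times> UNIV) =
      emeasure (plane \<Otimes>\<^sub>M lborel) (cell c \<inter> (A \<times> UNIV) \<times> UNIV)"
    by (rule emeasure_mark_law)
  also have "cell c \<inter> (A \<times> UNIV) \<times> UNIV = (A \<times> {real a..<real a + 1}) \<times> {real b..<real b + 1}"
    using sets.sets_into_space[OF A] by (auto simp: cell_def ab)
  also have "emeasure (plane \<Otimes>\<^sub>M lborel) \<dots> =
      emeasure plane (A \<times> {real a..<real a + 1}) * emeasure lborel {real b..<real b + 1}"
    using A by (intro lborel.emeasure_pair_measure_Times) (auto simp: plane_def)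
  also have "\<dots> = emeasure \<nu> A"
    using A by (simp add: emeasure_plane_times)
  finally show ?thesis .
qed

lemma emeasure_cell_pos:
  assumes J: "finite J" and A: "\<And>r. r \<in> J \<Longrightarrow> A r \<in> sets \<nu>"
  shows "{y \<in> space (cell_space c). \<forall>r\<in>J. fst (fst (snd y r)) \<in> A r} \<in> sets (cell_space c)"
    and "emeasure (cell_space c) {y \<in> space (cell_space c). \<forall>r\<in>J. fst (fst (snd y r)) \<in> A r} =
      (\<Prod>r\<in>J. emeasure \<nu> (A r))"
proof -
  interpret P: prob_space "\<Pi>\<^sub>M r\<in>(UNIV::nat set). mark_law c" by (rule prob_marks)
  interpret L: prob_space "mark_law c" by (rule prob_mark_law)
  interpret PL: product_prob_space "\<lambda>_. mark_law c" "UNIV :: nat set" ..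
  let ?A = "\<lambda>r. (A r \<times> (UNIV :: real set)) \<times> (UNIV :: real set)"
  have As: "?A r \<in> sets (mark_law c)" if "r \<in> J" for r
    unfolding sets_mark_law using A[OF that] by (intro pair_measureI cyl_sets) auto
  let ?B = "{f \<in> space (\<Pi>\<^sub>M r\<in>UNIV. mark_law c). \<forall>r\<in>J. f r \<in> ?A r}"
  have B: "?B \<in> sets (\<Pi>\<^sub>M r\<in>UNIV. mark_law c)"
  proof (rule sets.sets_Collect_finite_All[OF _ J])
    fix r assume "r \<in> J"
    have "(\<lambda>f. f r) -` ?A r \<inter> space (\<Pi>\<^sub>M r\<in>(UNIV :: nat set). mark_law c) \<in>
        sets (\<Pi>\<^sub>M r\<in>UNIV. mark_law c)"
      by (rule measurable_sets[OF measurable_component_singleton[of r UNIV "\<lambda>_. mark_law c"] As[OF \<open>r \<in> J\<close>]]) simp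
    then show "{f \<in> space (\<Pi>\<^sub>M r\<in>(UNIV :: nat set). mark_law c). f r \<in> ?A r} \<in>
        sets (\<Pi>\<^sub>M r\<in>UNIV. mark_law c)"
      by (simp only: vimage_def Int_def mem_Collect_eq conj_commute)
  qed
  have eq: "{y \<in> space (cell_space c). \<forall>r\<in>J. fst (fst (snd y r)) \<in> A r} = UNIV \<times> ?B"
    by (auto simp: cell_space_def space_pair_measure mem_Times_iff)
  have "UNIV \<times> ?B \<in> sets (cell_space c)"
    unfolding cell_space_def by (rule pair_measureI[OF _ B]) simp
  then show "{y \<in> space (cell_space c). \<forall>r\<in>J. fst (fst (snd y r)) \<in> A r} \<in> sets (cell_space c)"
    unfolding eq .
  have "emeasure (cell_space c) (UNIV \<times> ?B) = emeasure (\<Pi>\<^sub>M r\<in>UNIV. mark_law c) ?B"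
    unfolding cell_space_def using measure_pmf.emeasure_space_1[of "poisson_pmf 1"]
    by (subst P.emeasure_pair_measure_Times[OF _ B]) simp_all
  also have "\<dots> = (\<Prod>r\<in>J. emeasure (mark_law c) (?A r))"
    by (rule PL.emeasure_PiM_Collect[OF _ J As]) simp
  finally show "emeasure (cell_space c) {y \<in> space (cell_space c). \<forall>r\<in>J. fst (fst (snd y r)) \<in> A r} =
      (\<Prod>r\<in>J. emeasure \<nu> (A r))"
    unfolding eq by (simp add: emeasure_mark_law_pos A cong: prod.cong)
qed

text \<open>Labels are fixed in advance and every label carries a mark. Two different marks are
  independent with position law \<open>\<nu>\<close>, whether they are coordinates of one cell or
  belong to different cells; these are the two cases.\<close>

lemma distr_pos_pair:
  assumes kl: "k \<noteq> l"
  shows "distr config_space (\<nu> \<Otimes>\<^sub>M \<nu>) (\<lambda>\<omega>. (pos k \<omega>, pos l \<omega>)) = \<nu> \<Otimes>\<^sub>M \<nu>"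
proof (rule pair_measure_eqI[symmetric])
  interpret C: prob_space "cell_space c" for c by (rule prob_cell_space)
  interpret P: product_prob_space cell_space "UNIV :: nat set" ..
  fix A B assume AB: "A \<in> sets \<nu>" "B \<in> sets \<nu>"
  obtain c r c' r' where k: "k = (c, r)" and l: "l = (c', r')" by fastforce
  have sp: "\<omega> d \<in> space (cell_space d)" if "\<omega> \<in> space config_space" for \<omega> d
    using measurable_space[OF measurable_cell that] .
  let ?pre = "{\<omega> \<in> space config_space. pos k \<omega> \<in> A \<and> pos l \<omega> \<in> B}"
  have "emeasure (distr config_space (\<nu> \<Otimes>\<^sub>M \<nu>) (\<lambda>\<omega>. (pos k \<omega>, pos l \<omega>))) (A \<times> B) =
      emeasure config_space ((\<lambda>\<omega>. (pos k \<omega>, pos l \<omega>)) -` (A \<times> B) \<inter> space config_space)"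
    by (rule emeasure_distr) (intro measurable_Pair measurable_pos, rule pair_measureI[OF AB])
  also have "(\<lambda>\<omega>. (pos k \<omega>, pos l \<omega>)) -` (A \<times> B) \<inter> space config_space = ?pre"
    by blast
  also have "emeasure config_space ?pre = emeasure \<nu> A * emeasure \<nu> B"
  proof (cases "c = c'")
    case True
    then have r: "r \<noteq> r'" using kl k l by simp
    let ?J = "{r, r'}" and ?A = "\<lambda>s. if s = r then A else B"
    let ?Y = "{y \<in> space (cell_space c). \<forall>s\<in>?J. fst (fst (snd y s)) \<in> ?A s}"
    have A: "?A s \<in> sets \<nu>" for s using AB by simp
    have Y: "?Y \<in> sets (cell_space c)" "emeasure (cell_space c) ?Y = (\<Prod>s\<in>?J. emeasure \<nu> (?A s))"
      by (rule emeasure_cell_pos[where J="?J" and A="?A"], simp, rule A)+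
    have "\<omega> \<in> ?pre \<longleftrightarrow> \<omega> \<in> {\<omega> \<in> space config_space. \<omega> c \<in> ?Y}" for \<omega>
      using r sp[of \<omega> c]
      by (cases "\<omega> \<in> space config_space") (simp_all add: pos_def loc_def k l True[symmetric])
    then have "?pre = {\<omega> \<in> space config_space. \<omega> c \<in> ?Y}" by (rule set_eqI)
    also have "emeasure config_space \<dots> = emeasure (cell_space c) ?Y"
      unfolding config_space_def
      by (rule P.emeasure_PiM_Collect_single[OF UNIV_I Y(1)])
    finally show ?thesis using r unfolding Y(2) by simp
  next
    case False
    define A' where "A' d = (if d = c then A else B)" for d
    define s where "s d = (if d = c then r else r')" for d
    have at: "A' c = A" "A' c' = B" "s c = r" "s c' = r'"
      using False by (simp_all add: A'_def s_def)
    have A': "A' d \<in> sets \<nu>" for d using AB by (simp add: A'_def)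
    let ?Y = "\<lambda>d. {y \<in> space (cell_space d). \<forall>r\<in>{s d}. fst (fst (snd y r)) \<in> A' d}"
    have Y: "?Y d \<in> sets (cell_space d)" "emeasure (cell_space d) (?Y d) = emeasure \<nu> (A' d)" for d
      using emeasure_cell_pos[of "{s d}" "\<lambda>_. A' d" d] A'[of d] by simp_all
    have "\<omega> \<in> ?pre \<longleftrightarrow> \<omega> \<in> {\<omega> \<in> space config_space. \<forall>d\<in>{c, c'}. \<omega> d \<in> ?Y d}" for \<omega>
      using sp[of \<omega> c] sp[of \<omega> c']
      by (cases "\<omega> \<in> space config_space") (simp_all add: pos_def loc_def k l at)
    then have "?pre = {\<omega> \<in> space config_space. \<forall>d\<in>{c, c'}. \<omega> d \<in> ?Y d}" by (rule set_eqI)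
    also have "emeasure config_space \<dots> = (\<Prod>d\<in>{c, c'}. emeasure (cell_space d) (?Y d))"
      unfolding config_space_def
      by (rule P.emeasure_PiM_Collect[OF subset_UNIV _ Y(1)]) simp
    also have "\<dots> = (\<Prod>d\<in>{c, c'}. emeasure \<nu> (A' d))"
      by (rule prod.cong[OF refl Y(2)])
    finally show ?thesis using False by (simp add: at)
  qed
  finally show "emeasure \<nu> A * emeasure \<nu> B =
      emeasure (distr config_space (\<nu> \<Otimes>\<^sub>M \<nu>) (\<lambda>\<omega>. (pos k \<omega>, pos l \<omega>))) (A \<times> B)" ..
qed (simp_all add: sigma_finite_measure_axioms)

definition indist :: "'a set set \<Rightarrow> 'a \<Rightarrow> 'a \<Rightarrow> bool" where
  "indist \<A> x y \<longleftrightarrow> (\<forall>A\<in>\<A>. x \<in> A \<longleftrightarrow> y \<in> A)"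

text \<open>Counts, heights and times must agree exactly; only positions may change, and only within
  a class that \<open>\<A>\<close> does not separate. The family thus has to describe positions
  only.\<close>

definition cindist :: "'a set set \<Rightarrow> 'a config \<Rightarrow> 'a config \<Rightarrow> bool" where
  "cindist \<A> \<omega> \<omega>' \<longleftrightarrow> (\<forall>c. fst (\<omega> c) = fst (\<omega>' c) \<and>
     (\<forall>r. snd (snd (\<omega> c) r) = snd (snd (\<omega>' c) r) \<and>
          snd (fst (snd (\<omega> c) r)) = snd (fst (snd (\<omega>' c) r)) \<and>
          indist \<A> (fst (fst (snd (\<omega> c) r))) (fst (fst (snd (\<omega>' c) r)))))"

lemma cindist_antimono: "\<A> \<subseteq> \<B> \<Longrightarrow> cindist \<B> \<omega> \<omega>' \<Longrightarrow> cindist \<A> \<omega> \<omega>'"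
  unfolding cindist_def indist_def by blast

text \<open>Events determined by some countable family form a sigma-algebra, because countable
  unions of countable families are countable. All coordinates are measurable for it: preimages of
  position sets use the family with one member, those of counts, heights and times the empty
  family.\<close>

lemma event_countably_determined:
  assumes E: "E \<in> sets config_space"
  obtains \<A> where "countable \<A>" "\<A> \<subseteq> sets \<nu>"
    "\<And>\<omega> \<omega>'. \<omega> \<in> space config_space \<Longrightarrow> \<omega>' \<in> space config_space \<Longrightarrow> cindist \<A> \<omega> \<omega>' \<Longrightarrow>
      \<omega> \<in> E \<Longrightarrow> \<omega>' \<in> E"
proof -
  let ?\<Omega> = "space config_space"
  define det where "det \<A> E \<longleftrightarrow> (\<forall>\<omega>\<in>?\<Omega>. \<forall>\<omega>'\<in>?\<Omega>. cindist \<A> \<omega> \<omega>' \<longrightarrow> (\<omega> \<in> E \<longleftrightarrow> \<omega>' \<in> E))" for \<A> E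
  define Inv where "Inv = {E. E \<subseteq> ?\<Omega> \<and> (\<exists>\<A>. countable \<A> \<and> \<A> \<subseteq> sets \<nu> \<and> det \<A> E)}"
  have sub: "Inv \<subseteq> Pow ?\<Omega>" by (auto simp: Inv_def)
  have sa: "sigma_algebra ?\<Omega> Inv"
    unfolding sigma_algebra_iff2
  proof (intro conjI ballI allI impI sub)
    show "{} \<in> Inv" by (auto simp: Inv_def det_def)
    show "?\<Omega> - S \<in> Inv" if S: "S \<in> Inv" for S
    proof -
      from S obtain \<A> where \<A>: "countable \<A>" "\<A> \<subseteq> sets \<nu>" "det \<A> S"
        by (auto simp: Inv_def)
      have "det \<A> (?\<Omega> - S)"
        unfolding det_def
      proof (intro ballI impI)
        fix \<omega> \<omega>' assume *: "\<omega> \<in> ?\<Omega>" "\<omega>' \<in> ?\<Omega>" "cindist \<A> \<omega> \<omega>'"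
        then have "\<omega> \<in> S \<longleftrightarrow> \<omega>' \<in> S" using \<A>(3) unfolding det_def by simp
        then show "\<omega> \<in> ?\<Omega> - S \<longleftrightarrow> \<omega>' \<in> ?\<Omega> - S" using *(1,2) by simp
      qed
      then have "\<exists>\<A>. countable \<A> \<and> \<A> \<subseteq> sets \<nu> \<and> det \<A> (?\<Omega> - S)" using \<A>(1,2) by blast
      then show ?thesis by (simp add: Inv_def)
    qed
    fix S :: "nat \<Rightarrow> _ set" assume S: "range S \<subseteq> Inv"
    then have "\<forall>n. \<exists>\<A>. countable \<A> \<and> \<A> \<subseteq> sets \<nu> \<and> det \<A> (S n)"
      by (auto simp: Inv_def)
    then obtain \<A> where \<A>: "\<And>n. countable (\<A> n)" "\<And>n. \<A> n \<subseteq> sets \<nu>" "\<And>n. det (\<A> n) (S n)"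
      by metis
    have "det (\<Union>n. \<A> n) (\<Union>n. S n)"
      unfolding det_def
    proof (intro ballI impI)
      fix \<omega> \<omega>' assume *: "\<omega> \<in> ?\<Omega>" "\<omega>' \<in> ?\<Omega>" "cindist (\<Union>n. \<A> n) \<omega> \<omega>'"
      have "cindist (\<A> n) \<omega> \<omega>'" for n by (rule cindist_antimono[OF _ *(3)]) auto
      then have "\<omega> \<in> S n \<longleftrightarrow> \<omega>' \<in> S n" for n using \<A>(3)[of n] * by (auto simp: det_def)
      then show "\<omega> \<in> (\<Union>n. S n) \<longleftrightarrow> \<omega>' \<in> (\<Union>n. S n)" by auto
    qed
    then show "(\<Union>n. S n) \<in> Inv"
    proof -
      assume det: "det (\<Union>n. \<A> n) (\<Union>n. S n)"
      have "countable (\<Union>n. \<A> n)" "(\<Union>n. \<A> n) \<subseteq> sets \<nu>"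
        using \<A>(1,2) by auto
      with det have "\<exists>\<A>. countable \<A> \<and> \<A> \<subseteq> sets \<nu> \<and> det \<A> (\<Union>n. S n)" by blast
      moreover have "(\<Union>n. S n) \<subseteq> ?\<Omega>" using S sub by blast
      ultimately show ?thesis by (simp add: Inv_def)
    qed
  qed
  define N where "N = sigma ?\<Omega> Inv"
  have sp: "space N = ?\<Omega>" unfolding N_def by (rule space_measure_of[OF sub])
  have sets_N: "sets N = Inv"
    unfolding N_def using sa sub by (simp add: sigma_algebra.sigma_sets_eq)
  have spc: "\<omega> c \<in> space (cell_space c)" if "\<omega> \<in> ?\<Omega>" for \<omega> c
    using measurable_space[OF measurable_cell that] .
  have spm: "snd (\<omega> c) r \<in> space (mark_law c)" if "\<omega> \<in> ?\<Omega>" for \<omega> c r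
    using measurable_space[OF measurable_mark spc[OF that]] .
  have InvI: "f -` B \<inter> space N \<in> sets N" if "countable \<A>" "\<A> \<subseteq> sets \<nu>"
    "\<And>\<omega> \<omega>'. \<omega> \<in> ?\<Omega> \<Longrightarrow> \<omega>' \<in> ?\<Omega> \<Longrightarrow> cindist \<A> \<omega> \<omega>' \<Longrightarrow> f \<omega> \<in> B \<longleftrightarrow> f \<omega>' \<in> B" for f B \<A>
  proof -
    have "det \<A> (f -` B \<inter> ?\<Omega>)"
      unfolding det_def
    proof (intro ballI impI)
      fix \<omega> \<omega>' assume "\<omega> \<in> ?\<Omega>" "\<omega>' \<in> ?\<Omega>" "cindist \<A> \<omega> \<omega>'"
      then show "\<omega> \<in> f -` B \<inter> ?\<Omega> \<longleftrightarrow> \<omega>' \<in> f -` B \<inter> ?\<Omega>" using that(3)[of \<omega> \<omega>'] by simp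
    qed
    then have "\<exists>\<A>. countable \<A> \<and> \<A> \<subseteq> sets \<nu> \<and> det \<A> (f -` B \<inter> ?\<Omega>)" using that(1,2) by blast
    then show ?thesis unfolding sets_N sp by (simp add: Inv_def)
  qed
  have count: "(\<lambda>\<omega>. fst (\<omega> c)) \<in> measurable N (measure_pmf (poisson_pmf 1))" for c
  proof (rule measurableI)
    show "(\<lambda>\<omega>. fst (\<omega> c)) -` B \<inter> space N \<in> sets N" for B
      by (rule InvI[of "{}"]) (auto simp: cindist_def)
  qed simp
  have mark: "(\<lambda>\<omega>. snd (\<omega> c) r) \<in> measurable N (mark_law c)" for c r
  proof -
    have x: "(\<lambda>\<omega>. fst (fst (snd (\<omega> c) r))) \<in> measurable N \<nu>"
    proof (rule measurableI)
      show "fst (fst (snd (\<omega> c) r)) \<in> space \<nu>" if "\<omega> \<in> space N" for \<omega>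
        using spm[of \<omega> c r] that sp by (auto simp: space_mark_law)
      show "(\<lambda>\<omega>. fst (fst (snd (\<omega> c) r))) -` B \<inter> space N \<in> sets N" if "B \<in> sets \<nu>" for B
        using that by (intro InvI[of "{B}"]) (auto simp: cindist_def indist_def)
    qed
    have u: "(\<lambda>\<omega>. snd (fst (snd (\<omega> c) r))) \<in> measurable N lborel"
    proof (rule measurableI)
      show "(\<lambda>\<omega>. snd (fst (snd (\<omega> c) r))) -` B \<inter> space N \<in> sets N" for B
        by (rule InvI[of "{}"]) (auto simp: cindist_def)
    qed simp
    have t: "(\<lambda>\<omega>. snd (snd (\<omega> c) r)) \<in> measurable N lborel"
    proof (rule measurableI)
      show "(\<lambda>\<omega>. snd (snd (\<omega> c) r)) -` B \<inter> space N \<in> sets N" for B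
        by (rule InvI[of "{}"]) (auto simp: cindist_def)
    qed simp
    have "(\<lambda>\<omega>. snd (\<omega> c) r) \<in> measurable N ((\<nu> \<Otimes>\<^sub>M lborel) \<Otimes>\<^sub>M lborel)"
      by (intro measurable_pair) (use x u t in \<open>simp_all add: o_def\<close>)
    then show ?thesis
      by (subst measurable_cong_sets[OF refl sets_mark_law]) (simp only: plane_def)
  qed
  have "(\<lambda>\<omega>. \<omega> c) \<in> measurable N (cell_space c)" for c
    unfolding cell_space_def
  proof (rule measurable_pair)
    show "fst \<circ> (\<lambda>\<omega>. \<omega> c) \<in> measurable N (measure_pmf (poisson_pmf 1))"
      using count by (simp add: o_def)
    have "(\<lambda>\<omega> r. snd (\<omega> c) r) \<in> measurable N (\<Pi>\<^sub>M r\<in>UNIV. mark_law c)"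
      using mark by (intro measurable_PiM_single') (auto simp: sp spm)
    then show "snd \<circ> (\<lambda>\<omega>. \<omega> c) \<in> measurable N (\<Pi>\<^sub>M r\<in>UNIV. mark_law c)"
      by (simp add: o_def)
  qed
  \<comment> \<open>Measurability of the identity into the product is tested on coordinates; it says
    that every event of \<open>config_space\<close> already belongs to \<open>Inv\<close>.\<close>
  then have "(\<lambda>\<omega> c. \<omega> c) \<in> measurable N config_space"
    unfolding config_space_def by (intro measurable_PiM_single') (auto simp: sp spc)
  then have "(\<lambda>\<omega>. \<omega>) -` E \<inter> space N \<in> sets N" using E by (intro measurable_sets) auto
  moreover have "(\<lambda>\<omega>. \<omega>) -` E \<inter> space N = E" using sets.sets_into_space[OF E] sp by auto
  ultimately have "E \<in> Inv" by (simp add: sets_N)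
  then obtain \<A> where \<A>: "countable \<A>" "\<A> \<subseteq> sets \<nu>" "det \<A> E"
    by (auto simp: Inv_def)
  show ?thesis
    using \<A>(3)[unfolded det_def, rule_format, THEN iffD1] by (rule that[OF \<A>(1,2)])
qed

text \<open>All labels are compared, without reference to densities or regions, so that one
  extension serves all pairs of variables. Coincidences at atoms are left out because they do have
  positive probability and are counted by \<open>agree\<close>.\<close>

definition diagonal :: "'a config set" where
  "diagonal = {\<omega> \<in> space config_space. \<exists>k l. k \<noteq> l \<and> pos k \<omega> = pos l \<omega> \<and> pos k \<omega> \<notin> atoms}"

lemma finite_nonatoms_null:
  assumes x: "\<And>x. x \<in> space \<nu> \<Longrightarrow> {x} \<in> sets \<nu>"
    and C: "finite C" "C \<subseteq> space \<nu>" "C \<inter> atoms = {}"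
  shows "emeasure \<nu> C = 0"
proof -
  have "emeasure \<nu> C = (\<Sum>y\<in>C. emeasure \<nu> {y})"
    using C x by (intro emeasure_eq_sum_singleton) auto
  also have "\<dots> = 0"
    using C by (intro sum.neutral) (auto simp: atoms_def emeasure_eq_measure)
  finally show ?thesis .
qed

text \<open>The event that two points share a position carrying no atom need not be measurable (the
  diagonal of \<open>\<nu> \<Otimes>\<^sub>M \<nu>\<close> need not be). An event inside it only sees countably many sets of
  \<open>\<nu>\<close>, so coinciding points can be moved apart inside their class of indistinguishable points,
  unless that class is null.\<close>

lemma diagonal_inner_null:
  assumes x: "\<And>x. x \<in> space \<nu> \<Longrightarrow> {x} \<in> sets \<nu>"
    and E: "E \<in> sets config_space" "E \<subseteq> diagonal"
  shows "emeasure config_space E = 0"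
proof -
  obtain \<A> where \<A>: "countable \<A>" "\<A> \<subseteq> sets \<nu>"
    and inv: "\<And>\<omega> \<omega>'. \<omega> \<in> space config_space \<Longrightarrow> \<omega>' \<in> space config_space \<Longrightarrow> cindist \<A> \<omega> \<omega>' \<Longrightarrow>
      \<omega> \<in> E \<Longrightarrow> \<omega>' \<in> E"
    using event_countably_determined[OF E(1)] by blast
  define cls where "cls a = {y \<in> space \<nu>. indist \<A> a y}" for a
  have cls_eq: "cls a = cls b" if "z \<in> cls a" "z \<in> cls b" for a b z
  proof -
    have "\<forall>A\<in>\<A>. (a \<in> A) = (b \<in> A)" using that by (simp add: cls_def indist_def)
    then show ?thesis by (simp add: cls_def indist_def)
  qed
  have cls_self: "a \<in> cls a" if "a \<in> space \<nu>" for a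
    using that by (simp add: cls_def indist_def)
  \<comment> \<open>The equivalence relation of being indistinguishable is a measurable substitute
    for the diagonal, since it is a countable intersection of measurable conditions. Its slice at
    \<open>a\<close> is the class of \<open>a\<close>.\<close>
  define R where "R = {p \<in> space (\<nu> \<Otimes>\<^sub>M \<nu>). indist \<A> (fst p) (snd p)}"
  have R: "R \<in> sets (\<nu> \<Otimes>\<^sub>M \<nu>)"
  proof -
    have "Measurable.pred (\<nu> \<Otimes>\<^sub>M \<nu>) (\<lambda>p. fst p \<in> A \<longleftrightarrow> snd p \<in> A)" if "A \<in> \<A>" for A
    proof -
      have [measurable]: "A \<in> sets \<nu>" using that \<A>(2) by blast
      show ?thesis by measurable
    qed
    then have "Measurable.pred (\<nu> \<Otimes>\<^sub>M \<nu>) (\<lambda>p. \<forall>n. from_nat_into \<A> n \<in> \<A> \<longrightarrow>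
        (fst p \<in> from_nat_into \<A> n \<longleftrightarrow> snd p \<in> from_nat_into \<A> n))"
      by (intro pred_intros_countable pred_intros_imp') auto
    also have "(\<lambda>p. \<forall>n. from_nat_into \<A> n \<in> \<A> \<longrightarrow>
        (fst p \<in> from_nat_into \<A> n \<longleftrightarrow> snd p \<in> from_nat_into \<A> n)) =
        (\<lambda>p. \<forall>A\<in>\<A>. fst p \<in> A \<longleftrightarrow> snd p \<in> A)"
      using from_nat_into_surj[OF \<A>(1)] by (intro ext) metis
    finally have "Measurable.pred (\<nu> \<Otimes>\<^sub>M \<nu>) (\<lambda>p. \<forall>A\<in>\<A>. fst p \<in> A \<longleftrightarrow> snd p \<in> A)" .
    then show ?thesis unfolding R_def indist_def pred_def .
  qed
  have slice: "Pair a -` R = cls a" if "a \<in> space \<nu>" for a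
    using that by (auto simp: R_def cls_def space_pair_measure)
  have null_m: "(\<lambda>a. emeasure \<nu> (Pair a -` R)) \<in> borel_measurable \<nu>"
    using R by (rule measurable_emeasure_Pair)
  \<comment> \<open>Indistinguishable pairs in a null class: every slice is null, so by Fubini the
    whole set is. Two given labels therefore almost surely avoid it.\<close>
  define N0 where "N0 = {p \<in> space (\<nu> \<Otimes>\<^sub>M \<nu>). p \<in> R \<and> emeasure \<nu> (Pair (fst p) -` R) = 0}"
  have N0: "N0 \<in> sets (\<nu> \<Otimes>\<^sub>M \<nu>)"
    unfolding N0_def using R measurable_compose[OF measurable_fst null_m] by measurable
  have "emeasure (\<nu> \<Otimes>\<^sub>M \<nu>) N0 = (\<integral>\<^sup>+a. emeasure \<nu> (Pair a -` N0) \<partial>\<nu>)"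
    by (rule emeasure_pair_measure_alt[OF N0])
  also have "\<dots> = (\<integral>\<^sup>+a. 0 \<partial>\<nu>)"
  proof (rule nn_integral_cong)
    fix a assume a: "a \<in> space \<nu>"
    show "emeasure \<nu> (Pair a -` N0) = 0"
    proof (cases "emeasure \<nu> (Pair a -` R) = 0")
      case True
      have "emeasure \<nu> (Pair a -` N0) \<le> emeasure \<nu> (Pair a -` R)"
        by (rule emeasure_mono[OF _ sets_Pair1[OF R]]) (auto simp: N0_def)
      then show ?thesis using True by simp
    next
      case False
      then have "Pair a -` N0 = {}" by (auto simp: N0_def)
      then show ?thesis by simp
    qed
  qed
  finally have "N0 \<in> null_sets (\<nu> \<Otimes>\<^sub>M \<nu>)" using N0 by (simp add: null_sets_def)
  then have N0_AE: "AE p in \<nu> \<Otimes>\<^sub>M \<nu>. p \<notin> N0" by (rule AE_not_in)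
  have "AE \<omega> in config_space. (pos k \<omega>, pos l \<omega>) \<notin> N0" if "k \<noteq> l" for k l
    by (rule AE_distrD[OF measurable_Pair[OF measurable_pos measurable_pos]])
       (subst distr_pos_pair[OF that], rule N0_AE)
  then have "AE \<omega> in config_space. \<forall>k l. k \<noteq> l \<longrightarrow> (pos k \<omega>, pos l \<omega>) \<notin> N0"
    by (simp add: AE_all_countable)
  then have "AE \<omega> in config_space. \<omega> \<notin> E"
  proof (rule AE_mp, intro AE_I2 impI)
    fix \<omega> assume \<omega>: "\<omega> \<in> space config_space"
      and W: "\<forall>k l. k \<noteq> l \<longrightarrow> (pos k \<omega>, pos l \<omega>) \<notin> N0"
    \<comment> \<open>The injection is chosen for the class, not for one of its points, so that all
      labels in one class use the same injection.\<close>
    define spread where "spread C = (SOME f::nat \<Rightarrow> 'a. inj f \<and> range f \<subseteq> C)" for C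
    \<comment> \<open>Three ways to destroy a coincidence counted by \<open>diagonal\<close>: a
      class with an atom sends all its points to an atom; a class of positive measure without atoms
      is infinite and spreads its points injectively by label; in a null class nothing moves, and
      the avoidance of \<open>N0\<close> rules coincidences out.\<close>
    define new where "new a k =
      (if cls a \<inter> atoms \<noteq> {} then SOME b. b \<in> cls a \<inter> atoms
       else if emeasure \<nu> (cls a) \<noteq> 0 then spread (cls a) (prod_encode k) else a)" for a k
    have spread: "inj (spread (cls a))" "range (spread (cls a)) \<subseteq> cls a"
      if "cls a \<inter> atoms = {}" "emeasure \<nu> (cls a) \<noteq> 0" for a
    proof -
      have "infinite (cls a)"
      proof
        assume fin: "finite (cls a)"
        have "cls a \<subseteq> space \<nu>" unfolding cls_def by (rule Collect_restrict)
        from finite_nonatoms_null[OF x fin this that(1)] that(2) show False by simp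
      qed
      then have "\<exists>f::nat \<Rightarrow> 'a. inj f \<and> range f \<subseteq> cls a" by (rule infinite_countable_subset)
      from someI_ex[OF this] show "inj (spread (cls a))" "range (spread (cls a)) \<subseteq> cls a"
        unfolding spread_def by blast+
    qed
    have new_atom: "new a k \<in> cls a \<inter> atoms" if "cls a \<inter> atoms \<noteq> {}" for a k
    proof -
      have "\<exists>b. b \<in> cls a \<inter> atoms" using that by blast
      then show ?thesis unfolding new_def if_P[OF that] by (rule someI_ex)
    qed
    have new_cls: "new a k \<in> cls a" if "a \<in> space \<nu>" for a k
    proof (cases "cls a \<inter> atoms \<noteq> {}")
      case True
      then show ?thesis using new_atom[OF True] by blast
    next
      case False
      then have na: "cls a \<inter> atoms = {}" by simp
      show ?thesis
        unfolding new_def if_not_P[OF False]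
        using spread(2)[OF na] cls_self[OF that] by (cases "emeasure \<nu> (cls a) = 0") auto
    qed
    have pos_space: "pos k \<omega> \<in> space \<nu>" for k
      using measurable_space[OF measurable_pos \<omega>] .
    define \<omega>' where "\<omega>' c = (fst (\<omega> c), \<lambda>r.
      ((new (pos (c, r) \<omega>) (c, r), snd (fst (snd (\<omega> c) r))), snd (snd (\<omega> c) r)))" for c
    have pos': "pos k \<omega>' = new (pos k \<omega>) k" for k
      by (cases k) (simp add: pos_def loc_def \<omega>'_def)
    have new_space: "new (pos k \<omega>) k \<in> space \<nu>" for k
      using new_cls[OF pos_space] by (simp add: cls_def)
    have \<omega>': "\<omega>' \<in> space config_space"
    proof -
      have cell: "space (cell_space c) = UNIV \<times> (UNIV \<rightarrow> (space \<nu> \<times> UNIV) \<times> UNIV)" for c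
        by (simp only: cell_space_def space_pair_measure space_PiM space_mark_law
            space_measure_pmf PiE_UNIV_domain)
      have "\<omega>' c \<in> space (cell_space c)" for c
        using new_space unfolding cell \<omega>'_def by simp
      then show ?thesis
        by (simp add: config_space_def space_PiM PiE_UNIV_domain)
    qed
    have "indist \<A> (pos (c, r) \<omega>) (new (pos (c, r) \<omega>) (c, r))" for c r
      using new_cls[OF pos_space] by (simp add: cls_def)
    then have ci: "cindist \<A> \<omega> \<omega>'"
      unfolding cindist_def \<omega>'_def by (simp add: pos_def loc_def)
    show "\<omega> \<notin> E"
    proof
      assume "\<omega> \<in> E"
      then have "\<omega>' \<in> E" by (rule inv[OF \<omega> \<omega>' ci])
      then have "\<omega>' \<in> diagonal" using E(2) by (rule subsetD[rotated])
      then have "\<exists>k l. k \<noteq> l \<and> pos k \<omega>' = pos l \<omega>' \<and> pos k \<omega>' \<notin> atoms"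
        by (simp only: diagonal_def mem_Collect_eq)
      then obtain k l where kl: "k \<noteq> l" and eq: "new (pos k \<omega>) k = new (pos l \<omega>) l"
        and na: "new (pos k \<omega>) k \<notin> atoms"
        unfolding pos' by (elim exE conjE)
      have C: "cls (pos k \<omega>) = cls (pos l \<omega>)"
        by (rule cls_eq[OF new_cls[OF pos_space, of k k]]) (unfold eq, rule new_cls[OF pos_space])
      have na': "cls (pos k \<omega>) \<inter> atoms = {}"
        using new_atom[of "pos k \<omega>" k] na by blast
      show False
      proof (cases "emeasure \<nu> (cls (pos k \<omega>)) = 0")
        case True
        have "new (pos k \<omega>) k = pos k \<omega>" "new (pos l \<omega>) l = pos l \<omega>"
          unfolding new_def C[symmetric] using True na' by simp_all
        then have same: "pos k \<omega> = pos l \<omega>" using eq by simp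
        have "(pos k \<omega>, pos k \<omega>) \<in> R"
          using cls_self[OF pos_space, of k] slice[OF pos_space, of k] by blast
        moreover have "(pos k \<omega>, pos k \<omega>) \<in> space (\<nu> \<Otimes>\<^sub>M \<nu>)"
          using pos_space[of k] by (simp add: space_pair_measure)
        ultimately have "(pos k \<omega>, pos l \<omega>) \<in> N0"
          using True slice[OF pos_space, of k] unfolding same[symmetric] N0_def by simp
        then show False using W[rule_format, OF kl] by contradiction
      next
        case False
        then have "spread (cls (pos k \<omega>)) (prod_encode k) = spread (cls (pos k \<omega>)) (prod_encode l)"
          using eq unfolding new_def C[symmetric] using na' False by simp
        then have "prod_encode k = prod_encode l"
          using spread(1)[OF na' False] by (simp add: inj_eq)
        then show False using kl by (simp add: prod_encode_eq)
      qed
    qed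
  qed
  then have "E \<in> null_sets config_space"
    using E(1) by (simp add: AE_iff_null_sets)
  then show ?thesis by (rule null_setsD1)
qed


section \<open>The coupling\<close>

lemma pick_eq_pos: "pick A \<omega> = pos (first A \<omega>) \<omega>"
  by (simp add: pick_def pos_def)

text \<open>All variables are picks from one configuration, and passing to the extended measure
  preserves their laws. There the coincidences missed by \<open>agree\<close> are null, which yields
  both the measurability and the probability of inequality.\<close>

lemma ex_coupling:
  fixes g :: "'i \<Rightarrow> 'a \<Rightarrow> real"
  assumes x: "\<And>x. x \<in> space \<nu> \<Longrightarrow> {x} \<in> sets \<nu>"
    and g: "\<And>i. i \<in> I \<Longrightarrow> prob_density (g i)"
  obtains P :: "('i \<Rightarrow> 'a) measure" where "prob_space P"
    "\<And>i. i \<in> I \<Longrightarrow> (\<lambda>\<phi>. \<phi> i) \<in> measurable P \<nu>"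
    "\<And>i. i \<in> I \<Longrightarrow> distr P \<nu> (\<lambda>\<phi>. \<phi> i) = density \<nu> (g i)"
    "\<And>i j. i \<in> I \<Longrightarrow> j \<in> I \<Longrightarrow> {\<phi> \<in> space P. \<phi> i \<noteq> \<phi> j} \<in> sets P"
    "\<And>i j. i \<in> I \<Longrightarrow> j \<in> I \<Longrightarrow> \<P>(\<phi> in P. \<phi> i \<noteq> \<phi> j) =
      1 - ((\<integral>x. min (g i x) (g j x) \<partial>\<nu>) + (\<integral>x. overlap (g i) (g j) x \<partial>\<nu>)) /
        (2 - (\<integral>x. min (g i x) (g j x) \<partial>\<nu>))"
proof -
  have sub: "diagonal \<subseteq> space config_space" by (auto simp: diagonal_def)
  have null: "emeasure config_space E = 0" if "E \<in> sets config_space" "E \<subseteq> diagonal" for E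
    by (rule diagonal_inner_null[OF x that])
  obtain N where N: "prob_space N" "space N = space config_space" "sets config_space \<subseteq> sets N"
    "\<And>E. E \<in> sets config_space \<Longrightarrow> emeasure N E = emeasure config_space E"
    "\<And>S. S \<subseteq> diagonal \<Longrightarrow> S \<in> sets N" "emeasure N diagonal = 0"
    by (rule config.extend_inner_null[OF sub null]) (assumption, assumption, (rule that; simp))
  interpret N: prob_space N by (rule N(1))
  let ?Y = "\<lambda>i. pick (under (g i))"
  have Y_config: "?Y i \<in> measurable config_space \<nu>" if "i \<in> I" for i
    using g[OF that] by (intro measurable_pick under_sets) (simp add: prob_density_def)
  have Y: "?Y i \<in> measurable N \<nu>" if "i \<in> I" for i
    using Y_config[OF that] N(2,3) unfolding measurable_def by auto
  have distr_Y: "distr N \<nu> (?Y i) = density \<nu> (g i)" if i: "i \<in> I" for i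
  proof -
    have "distr N \<nu> (?Y i) = distr config_space \<nu> (?Y i)"
    proof (rule measure_eqI)
      fix A assume "A \<in> sets (distr N \<nu> (?Y i))"
      then have A: "A \<in> sets \<nu>" by simp
      have "emeasure N (?Y i -` A \<inter> space config_space) =
          emeasure config_space (?Y i -` A \<inter> space config_space)"
        by (rule N(4)) (rule measurable_sets[OF Y_config[OF i] A])
      then show "emeasure (distr N \<nu> (?Y i)) A = emeasure (distr config_space \<nu> (?Y i)) A"
        by (simp add: emeasure_distr[OF Y[OF i] A] emeasure_distr[OF Y_config[OF i] A] N(2))
    qed simp
    then show ?thesis using distr_pick[OF g[OF i]] by simp
  qed
  have neq: "{\<omega> \<in> space N. ?Y i \<omega> \<noteq> ?Y j \<omega>} \<in> sets N" (is "?D \<in> _")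
    and prob_neq: "\<P>(\<omega> in N. ?Y i \<omega> \<noteq> ?Y j \<omega>) = 1 - measure config_space (agree (g i) (g j))"
    if ij: "i \<in> I" "j \<in> I" for i j
  proof -
    let ?A = "agree (g i) (g j)" and ?D = "{\<omega> \<in> space N. ?Y i \<omega> \<noteq> ?Y j \<omega>}"
    \<comment> \<open>The coincidences outside \<open>agree\<close>. They lie in
      \<open>diagonal\<close>, hence are measurable and null for \<open>N\<close>, although possibly
      not events of \<open>config_space\<close>.\<close>
    define S where "S = (space N - ?A) - ?D"
    have A: "?A \<in> sets config_space" by (rule agree_sets[OF g[OF ij(1)] g[OF ij(2)] x])
    have S_sub: "S \<subseteq> diagonal"
    proof
      fix \<omega> assume "\<omega> \<in> S"
      then have \<omega>: "\<omega> \<in> space config_space" "\<omega> \<notin> ?A" "?Y i \<omega> = ?Y j \<omega>"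
        by (simp_all add: S_def N(2))
      then have "first (under (g i)) \<omega> \<noteq> first (under (g j)) \<omega>" "?Y i \<omega> \<notin> atoms"
        by (simp_all add: agree_def)
      with \<omega>(1,3) show "\<omega> \<in> diagonal"
        unfolding diagonal_def pick_eq_pos by blast
    qed
    have "?D \<inter> ?A = {}"
      by (auto simp: agree_def pick_eq_pos)
    then have D_eq: "?D = (space N - ?A) - S" by (auto simp: S_def)
    have A_N: "space N - ?A \<in> sets N" using A N(3) by blast
    have S_N: "S \<in> sets N" by (rule N(5)[OF S_sub])
    show "?D \<in> sets N" unfolding D_eq using A_N S_N by (rule sets.Diff)
    have "emeasure N S \<le> emeasure N diagonal"
      using S_sub N(5)[OF order_refl] by (rule emeasure_mono)
    then have S0: "S \<in> null_sets N" using S_N N(6) by (simp add: null_sets_def)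
    have "measure N ?D = measure N (space N - ?A)"
      unfolding D_eq measure_def emeasure_Diff_null_set[OF S0 A_N] ..
    also have "\<dots> = 1 - measure N ?A"
      using A N(3) by (intro N.prob_compl) blast
    also have "measure N ?A = measure config_space ?A"
      unfolding measure_def N(4)[OF A] ..
    finally show "\<P>(\<omega> in N. ?Y i \<omega> \<noteq> ?Y j \<omega>) = 1 - measure config_space ?A" .
  qed
  obtain P :: "('i \<Rightarrow> 'a) measure" where P: "prob_space P"
    "\<And>i. i \<in> I \<Longrightarrow> (\<lambda>\<phi>. \<phi> i) \<in> measurable P \<nu>"
    "\<And>i. i \<in> I \<Longrightarrow> distr P \<nu> (\<lambda>\<phi>. \<phi> i) = distr N \<nu> (?Y i)"
    "\<And>i j. i \<in> I \<Longrightarrow> j \<in> I \<Longrightarrow> {\<phi> \<in> space P. \<phi> i \<noteq> \<phi> j} \<in> sets P"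
    "\<And>i j. i \<in> I \<Longrightarrow> j \<in> I \<Longrightarrow> \<P>(\<phi> in P. \<phi> i \<noteq> \<phi> j) = \<P>(\<omega> in N. ?Y i \<omega> \<noteq> ?Y j \<omega>)"
    using N.push_to_functions[of I ?Y \<nu>, OF Y neq] by blast
  show ?thesis
  proof (rule that[OF P(1,2)])
    show "distr P \<nu> (\<lambda>\<phi>. \<phi> i) = density \<nu> (g i)" if "i \<in> I" for i
      using P(3)[OF that] distr_Y[OF that] by simp
    show "\<P>(\<phi> in P. \<phi> i \<noteq> \<phi> j) =
      1 - ((\<integral>x. min (g i x) (g j x) \<partial>\<nu>) + (\<integral>x. overlap (g i) (g j) x \<partial>\<nu>)) /
        (2 - (\<integral>x. min (g i x) (g j x) \<partial>\<nu>))" if ij: "i \<in> I" "j \<in> I" for i j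
      using P(5)[OF ij] prob_neq[OF ij] measure_agree[OF g[OF ij(1)] g[OF ij(2)] x] by simp
  qed (simp_all add: P(4))
qed

lemma AE_prob_density_unique:
  assumes "prob_density g" "prob_density g'" "density \<nu> g = density \<nu> g'"
  shows "AE x in \<nu>. g x = g' x"
proof -
  have "AE x in \<nu>. ennreal (g x) = ennreal (g' x)"
    using assms by (intro density_unique) (auto simp: prob_density_def)
  then show ?thesis
  proof (rule AE_mp, intro AE_I2 impI)
    fix x assume "x \<in> space \<nu>" "ennreal (g x) = ennreal (g' x)"
    then show "g x = g' x" using assms by (simp add: prob_density_def)
  qed
qed

text \<open>The formula is claimed for every choice of densities, while the coupling is built from
  one fixed choice; densities of the same law agree almost everywhere.\<close>

lemma integral_overlap_cong:
  assumes x: "\<And>x. x \<in> space \<nu> \<Longrightarrow> {x} \<in> sets \<nu>"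
    and g: "prob_density g" "prob_density g'" "density \<nu> g = density \<nu> g'"
    and h: "prob_density h" "prob_density h'" "density \<nu> h = density \<nu> h'"
  shows "(\<integral>x. overlap g h x \<partial>\<nu>) = (\<integral>x. overlap g' h' x \<partial>\<nu>)"
proof (rule integral_cong_AE)
  show "AE x in \<nu>. overlap g h x = overlap g' h' x"
    using AE_prob_density_unique[OF g] AE_prob_density_unique[OF h]
    by eventually_elim (simp add: overlap_def g(3) h(3))
qed (rule borel_measurable_overlap[OF g(1) h(1) x] borel_measurable_overlap[OF g(2) h(2) x], assumption)+

end

section \<open>From a sigma-finite measure to an equivalent probability measure\<close>

lemma (in sigma_finite_measure) ex_prob_weight:
  assumes "emeasure M (space M) \<noteq> 0"
  obtains w :: "'a \<Rightarrow> real" where "w \<in> borel_measurable M" "\<And>x. x \<in> space M \<Longrightarrow> 0 < w x"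
    "prob_space (density M w)"
proof -
  obtain h where h [measurable]: "h \<in> borel_measurable M" and fin: "integral\<^sup>N M h \<noteq> \<infinity>"
    and pos: "\<And>x. x \<in> space M \<Longrightarrow> 0 < h x \<and> h x < \<infinity>"
    using Ex_finite_integrable_function by blast
  let ?c = "integral\<^sup>N M h"
  have "?c \<noteq> 0"
  proof
    assume "?c = 0"
    then have "AE x in M. h x = 0" by (simp add: nn_integral_0_iff_AE)
    then have "AE x in M. False"
      by (rule AE_mp) (rule AE_I2, use pos in force)
    then show False using assms by (simp add: ae_filter_eq_bot_iff)
  qed
  \<comment> \<open>A strictly positive integrable function, which exists by sigma-finiteness, is
    normalised by its integral; positivity later permits division by \<open>w\<close>.\<close>
  define w where "w x = enn2real (h x / ?c)" for x
  have w_eq: "ennreal (w x) = h x / ?c" if "x \<in> space M" for x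
    unfolding w_def using pos[OF that] \<open>?c \<noteq> 0\<close>
    by (intro ennreal_enn2real) (auto simp: ennreal_divide_eq_top_iff less_top[symmetric])
  show ?thesis
  proof (rule that[of w])
    show [measurable]: "w \<in> borel_measurable M" unfolding w_def by measurable
    show "0 < w x" if "x \<in> space M" for x
    proof -
      have "0 < h x / ?c" using pos[OF that] fin by (simp add: ennreal_zero_less_divide less_top)
      then show ?thesis using w_eq[OF that] by (metis ennreal_0 ennreal_less_zero_iff less_irrefl ennreal_eq_0_iff not_le)
    qed
    show "prob_space (density M w)"
    proof (rule prob_spaceI)
      have "emeasure (density M w) (space (density M w)) = (\<integral>\<^sup>+x. h x / ?c \<partial>M)"
        using w_eq by (simp add: emeasure_density cong: nn_integral_cong)
      also have "\<dots> = ?c / ?c" by (rule nn_integral_divide[OF h])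
      also have "\<dots> = 1" using \<open>?c \<noteq> 0\<close> fin by (simp add: ennreal_divide_self less_top[symmetric])
      finally show "emeasure (density M w) (space (density M w)) = 1" .
    qed
  qed
qed

theorem proposition5:
  fixes M :: "'a measure"
    and I :: "'i set"
    and Q :: "'i \<Rightarrow> 'b measure"
    and X :: "'i \<Rightarrow> 'b \<Rightarrow> 'a"
  assumes "sigma_finite_measure M"
    and "\<And>x. x \<in> space M \<Longrightarrow> {x} \<in> sets M"
    and "\<And>i. i \<in> I \<Longrightarrow> prob_space (Q i)"
    and "\<And>i. i \<in> I \<Longrightarrow> X i \<in> measurable (Q i) M"
    and "\<And>i. i \<in> I \<Longrightarrow> continuous_wrt (Q i) M (X i)"
  shows "\<exists>(P :: ('i \<Rightarrow> 'a) measure) (X' :: 'i \<Rightarrow> ('i \<Rightarrow> 'a) \<Rightarrow> 'a).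
    is_coupling I M Q X P X' \<and>
    (\<forall>i\<in>I. \<forall>j\<in>I. {\<omega> \<in> space P. X' i \<omega> \<noteq> X' j \<omega>} \<in> sets P) \<and>
    (\<forall>i\<in>I. \<forall>j\<in>I. \<forall>g h. has_density (Q i) M (X i) g \<longrightarrow> has_density (Q j) M (X j) h \<longrightarrow>
       \<P>(\<omega> in P. X' i \<omega> \<noteq> X' j \<omega>) =
         F (tv_dist M (Q i) (X i) (Q j) (X j))
         - 1 / (1 + tv_dist M (Q i) (X i) (Q j) (X j)) *
           (LINT x|M. min (g x) (h x) *
              \<bar>\<P>(\<omega> in Q i. X i \<omega> = x) - \<P>(\<omega> in Q j. X j \<omega> = x)\<bar>)) \<and>
    (no_atoms M \<longrightarrow>
       (\<forall>i\<in>I. \<forall>j\<in>I. \<P>(\<omega> in P. X' i \<omega> \<noteq> X' j \<omega>) = F (tv_dist M (Q i) (X i) (Q j) (X j))))"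
proof (cases "I = {}")
  \<comment> \<open>With no variables \<open>M\<close> may be the zero measure, for which no weight
    \<open>w\<close> exists, so an arbitrary probability measure is supplied.\<close>
  case True
  have "prob_space (return (count_space UNIV) (undefined :: 'i \<Rightarrow> 'a))"
    by (rule prob_space_return) simp
  then show ?thesis
    using True by (intro exI[of _ "return (count_space UNIV) undefined"] exI[of _ "\<lambda>i \<phi>. \<phi> i"])
      (simp add: is_coupling_def)
next
  case False
  interpret M: sigma_finite_measure M by (rule assms(1))
  have dens_eq: "g \<in> borel_measurable M" "\<And>x. x \<in> space M \<Longrightarrow> 0 \<le> g x"
    "distr (Q i) M (X i) = density M g" "(\<integral>\<^sup>+x. ennreal (g x) \<partial>M) = 1"
    if i: "i \<in> I" and d: "has_density (Q i) M (X i) g" for i g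
  proof -
    interpret Qi: prob_space "Q i" by (rule assms(3)[OF i])
    have dist: "distributed (Q i) M (X i) (\<lambda>x. ennreal (g x))" and nn: "\<And>x. x \<in> space M \<Longrightarrow> 0 \<le> g x"
      using d by (auto simp: has_density_def)
    show "g \<in> borel_measurable M"
      by (rule distributed_real_measurable[OF nn dist])
    show "\<And>x. x \<in> space M \<Longrightarrow> 0 \<le> g x" by (rule nn)
    show eq: "distr (Q i) M (X i) = density M g"
      using dist by (rule distributed_distr_eq_density)
    have "prob_space (density M g)"
      unfolding eq[symmetric] by (rule Qi.prob_space_distr[OF assms(4)[OF i]])
    then have "emeasure (density M g) (space M) = 1"
      using prob_space.emeasure_space_1 by fastforce
    then show "(\<integral>\<^sup>+x. ennreal (g x) \<partial>M) = 1"
      using distributed_borel_measurable[OF dist] by (simp add: emeasure_density cong: nn_integral_cong)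
  qed
  obtain g where g: "\<And>i. i \<in> I \<Longrightarrow> has_density (Q i) M (X i) (g i)"
    using assms(5) unfolding continuous_wrt_def by metis
  \<comment> \<open>Some variable exists, and its density has integral 1, which is impossible for
    the zero measure.\<close>
  have "emeasure M (space M) \<noteq> 0"
  proof
    assume "emeasure M (space M) = 0"
    then have "space M \<in> null_sets M" by (simp add: null_sets_def)
    then have "AE x in M. False" by (rule AE_mp[OF AE_not_in]) (rule AE_I2, simp)
    then have "(\<integral>\<^sup>+x. ennreal (f x) \<partial>M) = (\<integral>\<^sup>+x. 0 \<partial>M)" for f
      by (intro nn_integral_cong_AE) (auto elim: eventually_mono)
    then show False using False dens_eq(4)[OF _ g] by fastforce
  qed
  then obtain w :: "'a \<Rightarrow> real" where w [measurable]: "w \<in> borel_measurable M"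
    and w_pos: "\<And>x. x \<in> space M \<Longrightarrow> 0 < w x" and prob: "prob_space (density M w)"
    by (rule M.ex_prob_weight) (rule that; simp)
  define \<nu> where "\<nu> = density M w"
  have sets_\<nu> [measurable_cong, simp]: "sets \<nu> = sets M" and space_\<nu> [simp]: "space \<nu> = space M"
    by (simp_all add: \<nu>_def)
  interpret poisson_race \<nu> unfolding \<nu>_def by (rule poisson_race.intro) (rule prob)
  have x: "{x} \<in> sets \<nu>" if "x \<in> space \<nu>" for x using assms(2) that by simp
  have transfer: "prob_density (\<lambda>x. g x / w x)" "density \<nu> (\<lambda>x. g x / w x) = distr (Q i) M (X i)"
    if i: "i \<in> I" and d: "has_density (Q i) M (X i) g" for i g
  proof -
    note g = dens_eq[OF i d]
    note [measurable] = g(1)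
    have mult: "ennreal (w x) * ennreal (g x / w x) = ennreal (g x)" if "x \<in> space M" for x
      using w_pos[OF that] g(2)[OF that] by (simp add: ennreal_mult[symmetric])
    have "density \<nu> (\<lambda>x. g x / w x) = density M (\<lambda>x. ennreal (w x) * ennreal (g x / w x))"
      unfolding \<nu>_def by (rule density_density_eq) measurable
    also have "\<dots> = density M g"
      using mult by (intro density_cong) auto
    finally show eq: "density \<nu> (\<lambda>x. g x / w x) = distr (Q i) M (X i)"
      unfolding g(3) .
    have "(\<integral>\<^sup>+x. ennreal (g x / w x) \<partial>\<nu>) = (\<integral>\<^sup>+x. ennreal (w x) * ennreal (g x / w x) \<partial>M)"
      unfolding \<nu>_def by (rule nn_integral_density) measurable
    also have "\<dots> = 1"
      unfolding g(4)[symmetric] by (rule nn_integral_cong) (rule mult)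
    finally show "prob_density (\<lambda>x. g x / w x)"
      using g(2) w_pos by (auto simp: prob_density_def less_imp_le)
  qed
  have prob_in: "\<P>(\<omega> in Q i. X i \<omega> \<in> A) = measure (distr (Q i) M (X i)) A"
    if "i \<in> I" "A \<in> sets M" for i A
    using measure_distr[OF assms(4)[OF that(1)] that(2)]
    by (simp add: vimage_def Int_def conj_commute)
  have prob_eq: "\<P>(\<omega> in Q i. X i \<omega> = x) = measure (distr (Q i) M (X i)) {x}"
    if "i \<in> I" "x \<in> space M" for i x
    using prob_in[OF that(1) assms(2)[OF that(2)]] by simp
  have tv: "tv_dist M (Q i) (X i) (Q j) (X j) = 1 - (\<integral>x. min (g x / w x) (h x / w x) \<partial>\<nu>)"
    if ij: "i \<in> I" "j \<in> I" and g: "has_density (Q i) M (X i) g" and h: "has_density (Q j) M (X j) h"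
    for i j g h
    using SUP_abs_diff_density[OF transfer(1)[OF ij(1) g] transfer(1)[OF ij(2) h]]
    unfolding tv_dist_def transfer(2)[OF ij(1) g] transfer(2)[OF ij(2) h] sets_\<nu>
    by (simp add: prob_in ij cong: SUP_cong_simp)
  \<comment> \<open>Under the integral over \<open>M\<close> the extra factor \<open>w\<close> is
    absorbed by the minimum, \<open>w * min (g / w) (h / w) = min g h\<close>, while the point
    probabilities depend only on the laws.\<close>
  have overlap_M: "(\<integral>x. overlap (\<lambda>x. g x / w x) (\<lambda>x. h x / w x) x \<partial>\<nu>) =
      (LINT x|M. min (g x) (h x) * \<bar>\<P>(\<omega> in Q i. X i \<omega> = x) - \<P>(\<omega> in Q j. X j \<omega> = x)\<bar>)"
    if ij: "i \<in> I" "j \<in> I" and g: "has_density (Q i) M (X i) g" and h: "has_density (Q j) M (X j) h"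
    for i j g h
  proof -
    let ?o = "overlap (\<lambda>x. g x / w x) (\<lambda>x. h x / w x)"
    have "?o \<in> borel_measurable \<nu>"
      using transfer(1)[OF ij(1) g] transfer(1)[OF ij(2) h] x by (rule borel_measurable_overlap)
    then have [measurable]: "?o \<in> borel_measurable M"
      by (simp only: measurable_cong_sets[OF sets_\<nu> refl])
    have "(\<integral>x. f x \<partial>\<nu>) = (\<integral>x. w x *\<^sub>R f x \<partial>M)" if "f \<in> borel_measurable M" for f :: "'a \<Rightarrow> real"
      unfolding \<nu>_def using that w by (rule integral_density) (auto simp: less_imp_le w_pos)
    then have "(\<integral>x. ?o x \<partial>\<nu>) = (\<integral>x. w x *\<^sub>R ?o x \<partial>M)"
      by simp
    also have "\<dots> = (LINT x|M. min (g x) (h x) *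
        \<bar>\<P>(\<omega> in Q i. X i \<omega> = x) - \<P>(\<omega> in Q j. X j \<omega> = x)\<bar>)"
    proof (rule Bochner_Integration.integral_cong[OF refl])
      fix y assume y: "y \<in> space M"
      have "w y * min (g y / w y) (h y / w y) = min (g y) (h y)"
        using w_pos[OF y] by (simp add: min_def divide_le_cancel)
      then show "w y *\<^sub>R ?o y = min (g y) (h y) *
          \<bar>\<P>(\<omega> in Q i. X i \<omega> = y) - \<P>(\<omega> in Q j. X j \<omega> = y)\<bar>"
        unfolding overlap_def transfer(2)[OF ij(1) g] transfer(2)[OF ij(2) h]
          prob_eq[OF ij(1) y] prob_eq[OF ij(2) y]
        by (simp only: real_scaleR_def mult.assoc[symmetric])
    qed
    finally show ?thesis .
  qed
  have dens: "prob_density (\<lambda>x. g i x / w x)" if "i \<in> I" for i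
    by (rule transfer(1)[OF that g[OF that]])
  obtain P :: "('i \<Rightarrow> 'a) measure" where P: "prob_space P"
    "\<And>i. i \<in> I \<Longrightarrow> (\<lambda>\<phi>. \<phi> i) \<in> measurable P \<nu>"
    "\<And>i. i \<in> I \<Longrightarrow> distr P \<nu> (\<lambda>\<phi>. \<phi> i) = density \<nu> (\<lambda>x. g i x / w x)"
    "\<And>i j. i \<in> I \<Longrightarrow> j \<in> I \<Longrightarrow> {\<phi> \<in> space P. \<phi> i \<noteq> \<phi> j} \<in> sets P"
    "\<And>i j. i \<in> I \<Longrightarrow> j \<in> I \<Longrightarrow> \<P>(\<phi> in P. \<phi> i \<noteq> \<phi> j) =
      1 - ((\<integral>x. min (g i x / w x) (g j x / w x) \<partial>\<nu>) +
          (\<integral>x. overlap (\<lambda>x. g i x / w x) (\<lambda>x. g j x / w x) x \<partial>\<nu>)) /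
        (2 - (\<integral>x. min (g i x / w x) (g j x / w x) \<partial>\<nu>))"
    using ex_coupling[of I "\<lambda>i x. g i x / w x", OF x dens] by blast
  have formula: "\<P>(\<phi> in P. \<phi> i \<noteq> \<phi> j) = F (tv_dist M (Q i) (X i) (Q j) (X j))
      - 1 / (1 + tv_dist M (Q i) (X i) (Q j) (X j)) *
        (LINT x|M. min (g' x) (h' x) * \<bar>\<P>(\<omega> in Q i. X i \<omega> = x) - \<P>(\<omega> in Q j. X j \<omega> = x)\<bar>)"
    if ij: "i \<in> I" "j \<in> I" and g': "has_density (Q i) M (X i) g'" and h': "has_density (Q j) M (X j) h'"
    for i j g' h'
  proof -
    let ?m = "\<integral>x. min (g i x / w x) (g j x / w x) \<partial>\<nu>"
    let ?o = "\<integral>x. overlap (\<lambda>x. g i x / w x) (\<lambda>x. g j x / w x) x \<partial>\<nu>"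
    let ?d = "tv_dist M (Q i) (X i) (Q j) (X j)"
    note gi = g[OF ij(1)] and gj = g[OF ij(2)]
    have d: "?d = 1 - ?m" by (rule tv[OF ij gi gj])
    have o: "?o = (LINT x|M. min (g' x) (h' x) *
        \<bar>\<P>(\<omega> in Q i. X i \<omega> = x) - \<P>(\<omega> in Q j. X j \<omega> = x)\<bar>)"
      unfolding overlap_M[OF ij g' h', symmetric]
      by (rule integral_overlap_cong[OF x])
         (simp_all add: transfer[OF ij(1) gi] transfer[OF ij(1) g'] transfer[OF ij(2) gj] transfer[OF ij(2) h'])
    have "?m \<le> (\<integral>x. g i x / w x \<partial>\<nu>)"
      using transfer(1)[OF ij(1) gi] transfer(1)[OF ij(2) gj]
      by (intro integral_mono integrable_min integrable_prob_density) auto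
    then have "2 - ?m \<noteq> 0"
      using integral_prob_density[OF transfer(1)[OF ij(1) gi]] by simp
    \<comment> \<open>With \<open>d = 1 - ?m\<close> the denominator \<open>2 - ?m\<close> is
      \<open>1 + d\<close> and the complement of \<open>?m / (2 - ?m)\<close> is
      \<open>F d\<close>.\<close>
    then have "1 - (?m + ?o) / (2 - ?m) = 2 * (1 - ?m) / (1 + (1 - ?m)) - 1 / (1 + (1 - ?m)) * ?o"
    proof -
      have "1 + (1 - ?m) = 2 - ?m" by simp
      then show ?thesis using \<open>2 - ?m \<noteq> 0\<close> by (simp only:) (simp add: divide_simps)
    qed
    then show ?thesis
      unfolding P(5)[OF ij] F_def d o .
  qed
  have atomless: "\<P>(\<phi> in P. \<phi> i \<noteq> \<phi> j) = F (tv_dist M (Q i) (X i) (Q j) (X j))"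
    if na: "no_atoms M" and ij: "i \<in> I" "j \<in> I" for i j
  proof -
    \<comment> \<open>A singleton that is null for \<open>M\<close> is null for every law with a
      density, so the integrand of the correction term vanishes at each point.\<close>
    have zero: "\<P>(\<omega> in Q k. X k \<omega> = y) = 0" if k: "k \<in> I" and y: "y \<in> space M" for k y
    proof -
      have "{y} \<in> null_sets M"
        using na y assms(2)[OF y] by (simp add: no_atoms_def null_sets_def)
      then have "{y} \<in> null_sets (density M (g k))"
        using absolutely_continuousI_density[of "\<lambda>x. ennreal (g k x)" M] dens_eq(1)[OF k g[OF k]]
        by (auto simp: absolutely_continuous_def)
      then show ?thesis
        unfolding prob_eq[OF k y] dens_eq(3)[OF k g[OF k]] by (simp add: null_sets_def measure_def)
    qed
    have "(LINT x|M. min (g i x) (g j x) * \<bar>\<P>(\<omega> in Q i. X i \<omega> = x) - \<P>(\<omega> in Q j. X j \<omega> = x)\<bar>) =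
        (LINT x|M. 0)"
      by (rule Bochner_Integration.integral_cong) (simp_all add: zero ij)
    then show ?thesis using formula[OF ij g[OF ij(1)] g[OF ij(2)]] by simp
  qed
  have coupling: "is_coupling I M Q X P (\<lambda>i \<phi>. \<phi> i)"
    unfolding is_coupling_def
  proof (intro conjI ballI P(1))
    fix i assume i: "i \<in> I"
    show "(\<lambda>\<phi>. \<phi> i) \<in> measurable P M"
      using P(2)[OF i] by (simp only: measurable_cong_sets[OF refl sets_\<nu>])
    have "distr P M (\<lambda>\<phi>. \<phi> i) = distr P \<nu> (\<lambda>\<phi>. \<phi> i)"
      by (rule distr_cong) simp_all
    then show "distr P M (\<lambda>\<phi>. \<phi> i) = distr (Q i) M (X i)"
      unfolding P(3)[OF i] transfer(2)[OF i g[OF i]] .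
  qed
  show ?thesis
    by (intro exI[of _ P] exI[of _ "\<lambda>i \<phi>. \<phi> i"] conjI coupling ballI allI impI)
       (rule P(4) formula atomless; assumption)+
qed

end
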